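(* Let $k\ge1$ be a real number. Let $(N^n,g_N)$ be a compact Riemannian manifold with non-negative sectional curvature, and let $\overline M^{n+1}=[a,\infty)\times N^n$ be the warped product with metric $\overline g=dr^2+\lambda^2(r)g_N$, where $\lambda$ is smooth and positive on $(a,\infty)$ with $\lambda''(r)\ge0$, $\lambda'(r)>0$, and $$\limsup_{r\to\infty}\frac{\lambda''\lambda}{\lambda'^2}<\infty,\qquad \limsup_{r\to\infty,\ \lambda''(r)>0}\frac{\lambda'''\lambda}{\lambda'\lambda''}<\infty .$$ Assume further that both of the following hold: (1) if $\sup_{r>a}\lambda'(r)<\infty$, then $\mathrm{Ric}_N>0$; (2) if $\sup_{r>a}\lambda'(r)=\infty$, then $\liminf_{r\to\infty}\lambda''\lambda/\lambda'^2>0$. Let $\Sigma$ be a smooth, closed, mean convex and star-shaped hypersurface in $\overline M^{n+1}$, and let $\Omega$ be the domain enclosed by $\Sigma$ and $\Gamma=\{a\}\times N^n$. Then $$\int_\Sigma\lambda^k\,d\mu\ \ge\ \frac{n}{n+k}\,|N|^{-\frac kn}\,|\Sigma|^{\frac{n+k}{n}}+k\int_\Omega\lambda^{k-1}\lambda'\,dv+\frac{k}{n+k}\,\lambda^k(a)\,|\Gamma| .$$ Equality holds if and only if $\Sigma$ is a slice $\{r\}\times N^n$.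
   Context: Here $a\ge0$, and $\{a\}\times N$ is allowed to degenerate to a point. $\Sigma$ is star-shaped if it is a graph $\{(u_0(x),x):x\in N\}$ of a smooth function $u_0:N\to(a,\infty)$. Mean convex means that the mean curvature $H$ of $\Sigma$ with respect to the unit normal $\nu$ pointing out of $\Omega$ (the side with $\langle\nu,\partial_r\rangle>0$) is positive, with the sign convention that slices have $H=n\lambda'/\lambda$. $d\mu$ and $dv$ are the area element of $\Sigma$ and the volume element of $\overline M$; $|\Sigma|,|\Gamma|$ are areas in $\overline g$, and $|N|$ is the volume of $(N,g_N)$. $\mathrm{Ric}_N$ is the Ricci curvature of $(N,g_N)$. The second limsup is taken over those $r$ with $\lambda''(r)>0$. *)

theory Defs
  imports "HOL-Analysis.Analysis"
begin

section \<open>Smooth functions on open sets of Euclidean spaces\<close>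

text \<open>Only meant for open domains: the derivatives are two-sided ones.\<close>

fun cont_diff_on :: "nat \<Rightarrow> 'e::euclidean_space set \<Rightarrow> ('e \<Rightarrow> 'b::real_normed_vector) \<Rightarrow> bool" where
  "cont_diff_on 0 S f \<longleftrightarrow> continuous_on S f"
| "cont_diff_on (Suc m) S f \<longleftrightarrow>
     (\<forall>x\<in>S. f differentiable (at x)) \<and>
     (\<forall>v. cont_diff_on m S (\<lambda>x. frechet_derivative f (at x) v))"

definition smooth_on :: "'e::euclidean_space set \<Rightarrow> ('e \<Rightarrow> 'b::real_normed_vector) \<Rightarrow> bool" where
  "smooth_on S f \<longleftrightarrow> (\<forall>m. cont_diff_on m S f)"


section \<open>Riemannian manifolds\<close>

text \<open>
  A Riemannian chart is a coordinate map together with the expression of the metric tensor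
  in these coordinates: \<open>rmet c x v w\<close> is $g_{ij}(x) v^i w^j$.
\<close>

record ('a, 'e) rchart =
  rdom :: "'a set"
  rcoord :: "'a \<Rightarrow> 'e"
  rmet :: "'e \<Rightarrow> 'e \<Rightarrow> 'e \<Rightarrow> real"

definition rimg :: "('a, 'e) rchart \<Rightarrow> 'e set" where
  "rimg c = rcoord c ` rdom c"

definition rinv :: "('a, 'e) rchart \<Rightarrow> 'e \<Rightarrow> 'a" where
  "rinv c = inv_into (rdom c) (rcoord c)"

definition transition :: "('a, 'e) rchart \<Rightarrow> ('a, 'e) rchart \<Rightarrow> 'e \<Rightarrow> 'e" where
  "transition c d = rcoord d \<circ> rinv c"

definition positive_inner :: "('e::euclidean_space \<Rightarrow> 'e \<Rightarrow> real) \<Rightarrow> bool" where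
  "positive_inner B \<longleftrightarrow>
     bilinear B \<and> (\<forall>v w. B v w = B w v) \<and> (\<forall>v. v \<noteq> 0 \<longrightarrow> B v v > 0)"

text \<open>
  The atlas need not be maximal. The last two conjuncts say that the coordinate changes are
  smooth and that the local expressions of the metric define one tensor field.
\<close>

definition riemannian_manifold ::
    "'a::topological_space set \<Rightarrow> ('a, 'e::euclidean_space) rchart set \<Rightarrow> bool" where
  "riemannian_manifold M P \<longleftrightarrow>
     Hausdorff_space (top_of_set M) \<and> second_countable (top_of_set M) \<and>
     (\<Union>c\<in>P. rdom c) = M \<and>
     (\<forall>c\<in>P. openin (top_of_set M) (rdom c) \<and> open (rimg c) \<and>
        homeomorphism (rdom c) (rimg c) (rcoord c) (rinv c)) \<and>
     (\<forall>c\<in>P. (\<forall>x\<in>rimg c. positive_inner (rmet c x)) \<and>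
        (\<forall>v w. smooth_on (rimg c) (\<lambda>x. rmet c x v w))) \<and>
     (\<forall>c\<in>P. \<forall>d\<in>P. smooth_on (rcoord c ` (rdom c \<inter> rdom d)) (transition c d)) \<and>
     (\<forall>c\<in>P. \<forall>d\<in>P. \<forall>x\<in>rcoord c ` (rdom c \<inter> rdom d). \<forall>v w.
        rmet c x v w =
          rmet d (transition c d x)
            (frechet_derivative (transition c d) (at x) v)
            (frechet_derivative (transition c d) (at x) w))"

definition smooth_function :: "('a, 'e::euclidean_space) rchart set \<Rightarrow> ('a \<Rightarrow> real) \<Rightarrow> bool" where
  "smooth_function P u \<longleftrightarrow> (\<forall>c\<in>P. smooth_on (rimg c) (u \<circ> rinv c))"


section \<open>Connection and curvature in coordinates\<close>

text \<open>The vector representing the linear form \<open>l\<close> with respect to the inner product \<open>B\<close>.\<close>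

definition sharp :: "('e::euclidean_space \<Rightarrow> 'e \<Rightarrow> real) \<Rightarrow> ('e \<Rightarrow> real) \<Rightarrow> 'e" where
  "sharp B l = (THE w. \<forall>z. B w z = l z)"

definition trace_map :: "('e::euclidean_space \<Rightarrow> 'e) \<Rightarrow> real" where
  "trace_map L = (\<Sum>b\<in>Basis. L b \<bullet> b)"

text \<open>
  \<open>christoffel g x v w\<close> is $\Gamma^k_{ij}(x) v^i w^j \partial_k$, i.e. $\nabla_v w$ for vector
  fields with constant coefficients; the defining equation is the Koszul formula.
\<close>

definition christoffel ::
    "('e::euclidean_space \<Rightarrow> 'e \<Rightarrow> 'e \<Rightarrow> real) \<Rightarrow> 'e \<Rightarrow> 'e \<Rightarrow> 'e \<Rightarrow> 'e" where
  "christoffel g x v w = sharp (g x) (\<lambda>z.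
     (frechet_derivative (\<lambda>y. g y w z) (at x) v
      + frechet_derivative (\<lambda>y. g y v z) (at x) w
      - frechet_derivative (\<lambda>y. g y v w) (at x) z) / 2)"

text \<open>$R(u,v)w = \nabla_u\nabla_v w - \nabla_v\nabla_u w$ for constant coefficients.\<close>

definition riem_curv ::
    "('e::euclidean_space \<Rightarrow> 'e \<Rightarrow> 'e \<Rightarrow> real) \<Rightarrow> 'e \<Rightarrow> 'e \<Rightarrow> 'e \<Rightarrow> 'e \<Rightarrow> 'e" where
  "riem_curv g x u v w =
     frechet_derivative (\<lambda>y. christoffel g y v w) (at x) u
     - frechet_derivative (\<lambda>y. christoffel g y u w) (at x) v
     + christoffel g x u (christoffel g x v w)
     - christoffel g x v (christoffel g x u w)"

definition sectional_curv ::
    "('e::euclidean_space \<Rightarrow> 'e \<Rightarrow> 'e \<Rightarrow> real) \<Rightarrow> 'e \<Rightarrow> 'e \<Rightarrow> 'e \<Rightarrow> real" where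
  "sectional_curv g x u v =
     g x (riem_curv g x u v v) u / (g x u u * g x v v - (g x u v)\<^sup>2)"

definition ricci_curv ::
    "('e::euclidean_space \<Rightarrow> 'e \<Rightarrow> 'e \<Rightarrow> real) \<Rightarrow> 'e \<Rightarrow> 'e \<Rightarrow> 'e \<Rightarrow> real" where
  "ricci_curv g x v w = trace_map (\<lambda>u. riem_curv g x u v w)"

definition nonneg_sectional_curvature :: "('a, 'e::euclidean_space) rchart set \<Rightarrow> bool" where
  "nonneg_sectional_curvature P \<longleftrightarrow>
     (\<forall>c\<in>P. \<forall>x\<in>rimg c. \<forall>u v. u \<noteq> v \<and> independent {u, v} \<longrightarrow>
        sectional_curv (rmet c) x u v \<ge> 0)"

definition positive_ricci_curvature :: "('a, 'e::euclidean_space) rchart set \<Rightarrow> bool" where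
  "positive_ricci_curvature P \<longleftrightarrow>
     (\<forall>c\<in>P. \<forall>x\<in>rimg c. \<forall>v. v \<noteq> 0 \<longrightarrow> ricci_curv (rmet c) x v v > 0)"


section \<open>Submanifolds and their volume measure\<close>

text \<open>
  \<open>X\<close>, defined on the open set \<open>W\<close>, is in the coordinates \<open>c\<close> a local parametrization of the
  subset \<open>S\<close>: an immersion whose image is relatively open in \<open>S\<close>, and a homeomorphism onto
  this image. The dimension of the parameter space \<open>'p\<close> is the dimension of the submanifold;
  it may be the full dimension.
\<close>

definition local_param ::
    "('a::topological_space, 'e::euclidean_space) rchart \<Rightarrow> 'a set \<Rightarrow>
     'p::euclidean_space set \<Rightarrow> ('p \<Rightarrow> 'e) \<Rightarrow> bool" where
  "local_param c S W X \<longleftrightarrow>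
     open W \<and> smooth_on W X \<and> (\<forall>y\<in>W. inj (frechet_derivative X (at y))) \<and>
     X ` W \<subseteq> rimg c \<and>
     openin (top_of_set S) ((rinv c \<circ> X) ` W) \<and>
     homeomorphism W ((rinv c \<circ> X) ` W) (rinv c \<circ> X) (inv_into W (rinv c \<circ> X))"

definition induced_metric ::
    "('e::euclidean_space \<Rightarrow> 'e \<Rightarrow> 'e \<Rightarrow> real) \<Rightarrow> ('p::euclidean_space \<Rightarrow> 'e) \<Rightarrow>
     'p \<Rightarrow> 'p \<Rightarrow> 'p \<Rightarrow> real" where
  "induced_metric g X y v w =
     g (X y) (frechet_derivative X (at y) v) (frechet_derivative X (at y) w)"

text \<open>
  The determinant of the matrix of \<open>B\<close> in the standard basis. This is the Leibniz formula
  by which \<open>det\<close> is defined, for an arbitrary Euclidean space in place of \<open>real ^ 'n\<close>.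
\<close>

definition gram_det :: "('p::euclidean_space \<Rightarrow> 'p \<Rightarrow> real) \<Rightarrow> real" where
  "gram_det B =
     (\<Sum>p | p permutes (Basis :: 'p set). of_int (sign p) * (\<Prod>b\<in>Basis. B b (p b)))"

text \<open>
  The Riemannian volume (area) measure of the submanifold \<open>S\<close>, whose dimension is that
  of \<open>'p\<close>: the Borel measure on \<open>S\<close> given in each local parametrization by
  $\sqrt{\det g_{ij}}\,dx$.
\<close>

definition volume_measure ::
    "'p::euclidean_space itself \<Rightarrow> ('a::topological_space, 'e::euclidean_space) rchart set \<Rightarrow>
     'a set \<Rightarrow> 'a measure" where
  "volume_measure T P S = (THE \<mu>.
     sets \<mu> = sets (restrict_space borel S) \<and>
     (\<forall>c\<in>P. \<forall>(W::'p set) X. local_param c S W X \<longrightarrow>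
        (\<forall>B\<in>sets borel. B \<subseteq> W \<longrightarrow>
           emeasure \<mu> ((rinv c \<circ> X) ` B) =
             (\<integral>\<^sup>+ y. ennreal (sqrt (gram_det (induced_metric (rmet c) X y))) * indicator B y
                \<partial>lborel))))"


section \<open>Mean curvature of hypersurfaces\<close>

definition unit_normal ::
    "('e::euclidean_space \<Rightarrow> 'e \<Rightarrow> 'e \<Rightarrow> real) \<Rightarrow> ('p::euclidean_space \<Rightarrow> 'e) \<Rightarrow>
     'p \<Rightarrow> 'e \<Rightarrow> bool" where
  "unit_normal g X y \<nu> \<longleftrightarrow>
     g (X y) \<nu> \<nu> = 1 \<and> (\<forall>v. g (X y) (frechet_derivative X (at y) v) \<nu> = 0)"

text \<open>
  $h(v,w) = -\overline g(\overline\nabla_{X_* v} X_* w, \nu)$; with this sign the spheres in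
  Euclidean space have positive \<open>h\<close> with respect to the outward normal.
\<close>

definition second_fundamental_form ::
    "('e::euclidean_space \<Rightarrow> 'e \<Rightarrow> 'e \<Rightarrow> real) \<Rightarrow> ('p::euclidean_space \<Rightarrow> 'e) \<Rightarrow> 'e \<Rightarrow>
     'p \<Rightarrow> 'p \<Rightarrow> 'p \<Rightarrow> real" where
  "second_fundamental_form g X \<nu> y v w =
     - g (X y)
         (frechet_derivative (\<lambda>z. frechet_derivative X (at z) w) (at y) v
          + christoffel g (X y)
              (frechet_derivative X (at y) v) (frechet_derivative X (at y) w))
         \<nu>"

text \<open>The trace of the Weingarten map, i.e. $H = g^{ij} h_{ij}$ (not divided by \<open>n\<close>).\<close>

definition mean_curvature ::
    "('e::euclidean_space \<Rightarrow> 'e \<Rightarrow> 'e \<Rightarrow> real) \<Rightarrow> ('p::euclidean_space \<Rightarrow> 'e) \<Rightarrow> 'e \<Rightarrow>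
     'p \<Rightarrow> real" where
  "mean_curvature g X \<nu> y =
     trace_map (\<lambda>v. sharp (induced_metric g X y) (second_fundamental_form g X \<nu> y v))"


section \<open>Warped products\<close>

text \<open>
  The chart of $[a,\infty)\times N$ with metric $dr^2 + \lambda^2(r) g_N$ obtained from a
  chart of \<open>N\<close>. Its image $[a,\infty)\times\varphi(U)$ includes the boundary, where the metric
  may degenerate. The coordinate vector $\partial_r$ is \<open>(1, 0)\<close>.
\<close>

definition warped_chart ::
    "real \<Rightarrow> (real \<Rightarrow> real) \<Rightarrow> ('a, 'e::euclidean_space) rchart \<Rightarrow> (real \<times> 'a, real \<times> 'e) rchart"
  where
  "warped_chart a lam c =
     \<lparr> rdom = {a..} \<times> rdom c,
       rcoord = (\<lambda>(r, x). (r, rcoord c x)),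
       rmet = (\<lambda>(r, x) (s, v) (t, w). s * t + (lam r)\<^sup>2 * rmet c x v w) \<rparr>"

definition warped_product ::
    "real \<Rightarrow> (real \<Rightarrow> real) \<Rightarrow> ('a, 'e::euclidean_space) rchart set \<Rightarrow>
     (real \<times> 'a, real \<times> 'e) rchart set"
  where
  "warped_product a lam P = warped_chart a lam ` P"

definition closed_hypersurface ::
    "(real \<times> 'a::topological_space, real \<times> 'e::euclidean_space) rchart set \<Rightarrow>
     (real \<times> 'a) set \<Rightarrow> bool" where
  "closed_hypersurface Q S \<longleftrightarrow>
     compact S \<and>
     (\<forall>p\<in>S. \<exists>c\<in>Q. \<exists>(W::'e set) X. local_param c S W X \<and> p \<in> (rinv c \<circ> X) ` W)"

definition star_shaped :: "real \<Rightarrow> 'a set \<Rightarrow> ('a, 'e::euclidean_space) rchart set \<Rightarrow>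
    (real \<times> 'a) set \<Rightarrow> bool" where
  "star_shaped a N P S \<longleftrightarrow>
     (\<exists>u. smooth_function P u \<and> (\<forall>x\<in>N. a < u x) \<and> S = (\<lambda>x. (u x, x)) ` N)"

text \<open>
  Positivity of \<open>H\<close> with respect to the unit normal \<open>\<nu>\<close> with $\langle\nu,\partial_r\rangle > 0$.
\<close>

definition mean_convex ::
    "(real \<times> 'a::topological_space, real \<times> 'e::euclidean_space) rchart set \<Rightarrow>
     (real \<times> 'a) set \<Rightarrow> bool" where
  "mean_convex Q S \<longleftrightarrow>
     (\<forall>c\<in>Q. \<forall>(W::'e set) X. local_param c S W X \<longrightarrow>
        (\<forall>y\<in>W. \<forall>\<nu>. unit_normal (rmet c) X y \<nu> \<and> rmet c (X y) \<nu> (1, 0) > 0 \<longrightarrow>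
           mean_curvature (rmet c) X \<nu> y > 0))"

text \<open>The open region between $\{a\}\times N$ and the graph \<open>S\<close>.\<close>

definition enclosed_domain :: "real \<Rightarrow> (real \<times> 'a) set \<Rightarrow> (real \<times> 'a) set" where
  "enclosed_domain a S = {(r, x). a < r \<and> (\<exists>s. (s, x) \<in> S \<and> r < s)}"

text \<open>
  The volume measure of $[a,\infty)\times N$ is taken on the interior, the boundary being a
  null set.
\<close>

definition warped_volume ::
    "real \<Rightarrow> (real \<Rightarrow> real) \<Rightarrow> 'a::topological_space set \<Rightarrow>
     ('a, 'e::euclidean_space) rchart set \<Rightarrow> (real \<times> 'a) measure" where
  "warped_volume a lam N P =
     volume_measure TYPE(real \<times> 'e) (warped_product a lam P) ({a<..} \<times> N)"

definition warped_area ::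
    "real \<Rightarrow> (real \<Rightarrow> real) \<Rightarrow> ('a::topological_space, 'e::euclidean_space) rchart set \<Rightarrow>
     (real \<times> 'a) set \<Rightarrow> (real \<times> 'a) measure" where
  "warped_area a lam P S = volume_measure TYPE('e) (warped_product a lam P) S"

end

theory Submission
  imports Defs
begin

text \<open>
  On the graph $r=u(x)$ write $\lambda=\lambda(u)$, $s=\lambda^2+|\nabla u|^2$, $v=\sqrt s/\lambda\ge1$,
  $w=\lambda^n$ and $p=1+k/n$, with gradient and integrals taken on $N$. The area element of the graph
  is $wv$, and integration in $r$ turns the integral over $\Omega$ into
  $\int_N(w^p-\lambda(a)^{n+k})/(n+k)$. Therefore the boundary term cancels, and the theorem says
  $$p\int_N w^pv\ \ge\ (p-1)\int_N w^p+A^p|N|,\qquad A=\frac1{|N|}\int_N wv,$$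
  with equality exactly for constant $u$ (\<open>graph_inequality\<close>). By the choice of $A$, the difference of
  the two sides is the integral of $S=B(w)+wB'(w)(v-1)$, where
  $B(t)=t^p-A^p-pA^{p-1}(t-A)$ is the gap between $t^p$ and its tangent at $A$.

  The geometric input is the identity
  $$\mathrm{div}\Bigl(\frac{\nabla u}{\sqrt s}\Bigr)=\frac{n\lambda\lambda'}{\sqrt s}-\lambda H$$
  (\<open>divz_eq_mean_curvature\<close>). Multiplied by $\Phi(u)$ with $\Phi\ge0$ and integrated over $N$, it
  gives for $H>0$
  $$\int_N\frac{\Phi(u)\,n\lambda\lambda'+\Phi'(u)|\nabla u|^2}{\sqrt s}\ \ge\ 0$$
  (\<open>weighted_flux_inequality\<close>). The weight to take is $\Phi=\psi(w)/(n\lambda')$, where $\psi=B$ on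
  $(0,A]$ and $\psi=0$ beyond; it is of class $C^1$ because $B$ vanishes to second order at $A$.
  Since $\lambda''\ge0$, the derivative of $1/\lambda'$ contributes with the right sign and can be dropped.
  What remains is $\int_NT\ge0$ for $T=\psi(w)/v+w\psi'(w)(v-1/v)$ (\<open>bregman_flux\<close>).

  Finally $T\le S$ pointwise (\<open>pointwise_comparison\<close>): where $w>A$ one has $T=0<S$, and where
  $w\le A$ one has $S-T=(1-1/v)(B(w)-wB'(w))$ with $B(w)\ge0\ge B'(w)$. In the case of equality $S=T$
  everywhere, so $w\le A$, and $v=1$ wherever $w<A$. A point with $w=A$ is a maximum of $u$, so the
  gradient vanishes there and again $v=1$. Now the mean of $w\le A$ is $A$; hence $w$ and $u$ are constant.

  The remaining work gives these integrals a meaning. The volume measure is defined by what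
  it is in every local parametrization; that such a measure exists is proved by gluing finitely many pieces
  of charts (\<open>chart_cover\<close>), consistently because of the change of variables formula
  (\<open>nn_integral_diffeomorphism\<close>). The flux inequality is localized by a partition of unity, so that
  the divergence theorem is needed only for compactly supported fields on a Euclidean space
  (\<open>integral_divergence_zero\<close>).
\<close>

section \<open>Euclidean spaces as spaces of coordinate vectors\<close>

text \<open>
  Determinants and the change of variables theorem for Lebesgue measure concern \<open>real ^ 'm\<close>, the latter
  with a well-ordered index type, while the parameter space of a submanifold may be a product such as
  \<open>real \<times> real ^ 'n\<close>. The basis vectors of the space serve as the index type.
\<close>

typedef (overloaded) 'p bidx = "Basis :: 'p::euclidean_space set"
  using nonempty_Basis by blast

instance bidx :: (euclidean_space) finite
proof
  have "(UNIV :: 'a bidx set) = Abs_bidx ` Basis"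
    by (metis Abs_bidx_cases UNIV_eq_I imageI)
  then show "finite (UNIV :: 'a bidx set)"
    by (metis finite_Basis finite_imageI)
qed

definition bidx_rank :: "'p::euclidean_space bidx \<Rightarrow> nat" where
  "bidx_rank = (SOME f. inj f)"

lemma inj_bidx_rank: "inj (bidx_rank :: 'p::euclidean_space bidx \<Rightarrow> nat)"
proof -
  obtain f :: "'p bidx \<Rightarrow> nat" where "inj f"
    using finite_imp_inj_to_nat_seg[OF finite_class.finite_UNIV] by blast
  then show ?thesis
    unfolding bidx_rank_def by (rule someI[of inj])
qed

instantiation bidx :: (euclidean_space) wellorder
begin

definition "x \<le> y \<longleftrightarrow> bidx_rank x \<le> bidx_rank (y :: 'a bidx)"
definition "x < y \<longleftrightarrow> bidx_rank x < bidx_rank (y :: 'a bidx)"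

instance
proof
  fix P :: "'a bidx \<Rightarrow> bool" and x
  assume "\<And>x. (\<And>y. y < x \<Longrightarrow> P y) \<Longrightarrow> P x"
  then show "P x"
    unfolding less_bidx_def by (induction x rule: measure_induct_rule[of bidx_rank]) auto
qed (auto simp: less_eq_bidx_def less_bidx_def dest: injD[OF inj_bidx_rank])

end

lemma bij_Rep_bidx: "bij_betw Rep_bidx UNIV (Basis :: 'p::euclidean_space set)"
  using type_definition.Rep_range[OF type_definition_bidx]
  by (auto simp: bij_betw_def inj_def Rep_bidx_inject)

lemma sum_bidx: "(\<Sum>i\<in>UNIV. f (Rep_bidx i)) = (\<Sum>b\<in>(Basis :: 'p::euclidean_space set). f b)"
  by (rule sum.reindex_bij_betw[OF bij_Rep_bidx])

lemma Rep_bidx_Basis [simp]: "Rep_bidx i \<in> Basis"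
  by (rule Rep_bidx)

lemma inner_Rep_bidx: "Rep_bidx i \<bullet> Rep_bidx j = (if i = j then 1 else 0)"
  by (simp add: inner_Basis Rep_bidx_inject)

definition bvec :: "'p::euclidean_space \<Rightarrow> real ^ 'p bidx" where
  "bvec v = (\<chi> i. v \<bullet> Rep_bidx i)"

definition unbvec :: "real ^ 'p bidx \<Rightarrow> 'p::euclidean_space" where
  "unbvec x = (\<Sum>i\<in>UNIV. x $ i *\<^sub>R Rep_bidx i)"

lemma unbvec_bvec [simp]: "unbvec (bvec v) = v"
  unfolding unbvec_def bvec_def by (simp add: sum_bidx[where f = "\<lambda>b. (v \<bullet> b) *\<^sub>R b"] euclidean_representation)

lemma bvec_unbvec [simp]: "bvec (unbvec x) = x"
  by (simp add: unbvec_def bvec_def vec_eq_iff inner_sum_left inner_Rep_bidx if_distrib cong: if_cong)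

lemma linear_bvec: "linear bvec"
  by (auto intro!: linearI simp: bvec_def vec_eq_iff inner_simps)

lemma linear_unbvec: "linear unbvec"
  by (auto intro!: linearI simp: unbvec_def scaleR_add_left sum.distrib scaleR_sum_right)

lemma unbvec_axis: "unbvec (axis i 1) = Rep_bidx i"
proof -
  have "(axis i (1::real) $ j) *\<^sub>R Rep_bidx j = (if j = i then Rep_bidx i else 0)" for j
    by (simp add: axis_def)
  then show ?thesis
    unfolding unbvec_def by simp
qed

section \<open>Gram determinants\<close>

text \<open>
  The determinant of an endomorphism of a Euclidean space.
\<close>

definition bdet :: "('p::euclidean_space \<Rightarrow> 'p) \<Rightarrow> real" where
  "bdet T = det (matrix (bvec \<circ> T \<circ> unbvec))"

definition bgram :: "('p::euclidean_space \<Rightarrow> 'p \<Rightarrow> real) \<Rightarrow> real ^ 'p bidx ^ 'p bidx" where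
  "bgram B = (\<chi> i k. B (Rep_bidx i) (Rep_bidx k))"

text \<open>
  A bijection from the index type to the basis carries permutations to permutations of the same sign,
  so the Leibniz sums agree term by term.
\<close>

lemma gram_det_reindex:
  fixes j :: "'m::finite \<Rightarrow> 'p::euclidean_space"
  assumes j: "bij_betw j UNIV Basis"
  shows "gram_det B = det (\<chi> i k. B (j i) (j k))"
proof -
  have inj: "inj j" and im: "j ` UNIV = Basis"
    using j by (auto simp: bij_betw_def)
  have eq: "map_permutation UNIV j = (\<lambda>\<pi> x. if x \<in> Basis then j (\<pi> (inv_into UNIV j x)) else x)"
    by (auto simp: map_permutation_def restrict_id_def im fun_eq_iff)
  have "gram_det B = (\<Sum>p | p permutes (UNIV::'m set). of_int (sign (map_permutation UNIV j p)) *
      (\<Prod>b\<in>Basis. B b (map_permutation UNIV j p b)))"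
    unfolding gram_det_def eq by (rule sum.reindex_bij_betw[OF bij_betw_permutations[OF j], symmetric])
  also have "\<dots> = (\<Sum>p | p permutes (UNIV::'m set). of_int (sign p) * (\<Prod>i\<in>UNIV. B (j i) (j (p i))))"
  proof (rule sum.cong)
    fix p assume "p \<in> {p. p permutes (UNIV::'m set)}"
    then have "sign (map_permutation UNIV j p) = sign p"
      by (intro sign_map_permutation) (use inj in auto)
    moreover have "(\<Prod>b\<in>Basis. B b (map_permutation UNIV j p b)) = (\<Prod>i\<in>UNIV. B (j i) (map_permutation UNIV j p (j i)))"
      by (rule prod.reindex_bij_betw[OF j, symmetric])
    ultimately show "of_int (sign (map_permutation UNIV j p)) * (\<Prod>b\<in>Basis. B b (map_permutation UNIV j p b))
        = of_int (sign p) * (\<Prod>i\<in>UNIV. B (j i) (j (p i)))"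
      by (simp add: map_permutation_apply inj)
  qed auto
  finally show ?thesis
    by (simp add: det_def)
qed

lemma gram_det_eq_det: "gram_det B = det (bgram B)"
  unfolding bgram_def by (rule gram_det_reindex[OF bij_Rep_bidx])

lemma bilinear_expand:
  fixes B :: "'p::euclidean_space \<Rightarrow> 'p \<Rightarrow> real"
  assumes "bilinear B"
  shows "B v w = (\<Sum>b\<in>Basis. \<Sum>c\<in>Basis. (v \<bullet> b) * (w \<bullet> c) * B b c)"
proof -
  have "B v w = B (\<Sum>b\<in>Basis. (v \<bullet> b) *\<^sub>R b) (\<Sum>c\<in>Basis. (w \<bullet> c) *\<^sub>R c)"
    by (simp add: euclidean_representation)
  also have "\<dots> = (\<Sum>(b,c)\<in>Basis\<times>Basis. B ((v \<bullet> b) *\<^sub>R b) ((w \<bullet> c) *\<^sub>R c))"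
    by (rule bilinear_sum[OF assms])
  also have "\<dots> = (\<Sum>b\<in>Basis. \<Sum>c\<in>Basis. (v \<bullet> b) * (w \<bullet> c) * B b c)"
    by (simp add: sum.cartesian_product bilinear_lmul[OF assms] bilinear_rmul[OF assms] mult.assoc mult.left_commute)
  finally show ?thesis .
qed

text \<open>
  The matrix of the pulled back form is $M^{\mathsf T}GM$. This is how the volume density changes
  from one parametrization to another.
\<close>

lemma gram_det_pullback:
  fixes T :: "'p::euclidean_space \<Rightarrow> 'p"
  assumes B: "bilinear B"
  shows "gram_det (\<lambda>v w. B (T v) (T w)) = (bdet T)\<^sup>2 * gram_det B"
proof -
  define M where "M = matrix (bvec \<circ> T \<circ> unbvec)"
  have M: "M $ i $ j = T (Rep_bidx j) \<bullet> Rep_bidx i" for i j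
    by (simp add: M_def matrix_def unbvec_axis bvec_def)
  have "bgram (\<lambda>v w. B (T v) (T w)) $ i $ k = (transpose M ** bgram B ** M) $ i $ k" for i k
  proof -
    let ?v = "T (Rep_bidx i)" and ?w = "T (Rep_bidx k)"
    have "B ?v ?w = (\<Sum>b\<in>Basis. \<Sum>c\<in>Basis. (?v \<bullet> b) * (?w \<bullet> c) * B b c)"
      by (rule bilinear_expand[OF B])
    also have "\<dots> = (\<Sum>b\<in>UNIV. \<Sum>c\<in>UNIV. (?v \<bullet> Rep_bidx b) * (?w \<bullet> Rep_bidx c) * B (Rep_bidx b) (Rep_bidx c))"
      by (simp add: sum_bidx[symmetric])
    also have "\<dots> = (\<Sum>c\<in>UNIV. \<Sum>b\<in>UNIV. (?v \<bullet> Rep_bidx b) * (?w \<bullet> Rep_bidx c) * B (Rep_bidx b) (Rep_bidx c))"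
      by (rule sum.swap)
    also have "\<dots> = (transpose M ** bgram B ** M) $ i $ k"
      by (simp add: matrix_matrix_mult_def transpose_def bgram_def M sum_distrib_right sum_distrib_left mult_ac)
    finally show ?thesis
      by (simp add: bgram_def)
  qed
  then have "bgram (\<lambda>v w. B (T v) (T w)) = transpose M ** bgram B ** M"
    by (simp add: vec_eq_iff)
  then show ?thesis
    by (simp add: gram_det_eq_det det_mul bdet_def M_def power2_eq_square)
qed

lemma gram_det_scale: "gram_det (\<lambda>v w. c * B v w) = c ^ DIM('p) * gram_det (B :: 'p::euclidean_space \<Rightarrow> 'p \<Rightarrow> real)"
  by (simp add: gram_det_def prod.distrib sum_distrib_left mult_ac)

lemma gram_det_inner: "gram_det (\<lambda>v w :: 'p::euclidean_space. v \<bullet> w) = 1"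
proof -
  have "bgram (\<lambda>v w :: 'p. v \<bullet> w) = mat 1"
    by (simp add: bgram_def mat_def vec_eq_iff inner_Rep_bidx)
  then show ?thesis
    by (simp add: gram_det_eq_det)
qed

section \<open>Gradients and traces with respect to an inner product\<close>

lemma positive_inner_bilinear: "positive_inner B \<Longrightarrow> bilinear B"
  and positive_inner_sym: "positive_inner B \<Longrightarrow> B v w = B w v"
  and positive_inner_pos: "positive_inner B \<Longrightarrow> v \<noteq> 0 \<Longrightarrow> B v v > 0"
  by (auto simp: positive_inner_def)

lemma positive_inner_nonneg: "positive_inner B \<Longrightarrow> B v v \<ge> 0"
  by (cases "v = 0") (auto simp: positive_inner_def bilinear_def linear_0 dest: less_imp_le)

lemma positive_inner_linear:
  assumes "positive_inner B"
  shows "linear (B v)" "linear (\<lambda>v. B v w)"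
  using assms by (auto simp: positive_inner_def bilinear_def)

lemma positive_inner_cancel:
  assumes B: "positive_inner B" and eq: "\<And>z. B w z = B w' z"
  shows "w = w'"
proof (rule ccontr)
  assume "w \<noteq> w'"
  then have "B (w - w') (w - w') > 0"
    using B by (auto simp: positive_inner_def)
  moreover have "B (w - w') z = 0" for z
    using eq by (simp add: bilinear_lsub[OF positive_inner_bilinear[OF B]])
  ultimately show False by simp
qed

text \<open>
  Riesz representation in finite dimension: $w\mapsto B(w,\cdot)$ is injective, hence surjective.
\<close>

lemma sharp_ex:
  fixes B :: "'p::euclidean_space \<Rightarrow> 'p \<Rightarrow> real"
  assumes B: "positive_inner B" and l: "linear l"
  shows "\<exists>w. \<forall>z. B w z = l z"
proof -
  note lin = positive_inner_linear[OF B]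
  define F where "F w = (\<Sum>b\<in>Basis. B w b *\<^sub>R b)" for w
  have F: "F w \<bullet> b = B w b" if "b \<in> Basis" for w b
    using that by (simp add: F_def inner_sum_left_Basis)
  have "linear F"
    unfolding F_def by (intro linearI)
      (auto simp: linear_add[OF lin(2)] linear_cmul[OF lin(2)] scaleR_add_left sum.distrib scaleR_sum_right)
  moreover have "inj F"
  proof (rule injI)
    fix w w' assume "F w = F w'"
    then have eq: "B w b = B w' b" if "b \<in> Basis" for b
      using F that by metis
    have "B w z = B w' z" for z
    proof (rule linear_eq_on_span[OF lin(1) lin(1), where B = Basis])
    qed (use eq in \<open>auto simp: span_Basis\<close>)
    then show "w = w'"
      by (rule positive_inner_cancel[OF B])
  qed
  ultimately have "surj F"
    using linear_injective_imp_surjective by blast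
  then obtain w where w: "F w = (\<Sum>b\<in>Basis. l b *\<^sub>R b)"
    by (metis surjD)
  have "B w z = l z" for z
  proof (rule linear_eq_on_span[OF lin(1) l, where B = Basis])
    fix b :: 'p assume "b \<in> Basis"
    then show "B w b = l b"
      using F[of b w] by (simp add: w inner_sum_left_Basis)
  qed (auto simp: span_Basis)
  then show ?thesis by blast
qed

lemma sharp_apply:
  assumes B: "positive_inner B" and l: "linear l"
  shows "B (sharp B l) z = l z"
proof -
  have "\<exists>!w. \<forall>z. B w z = l z"
    using sharp_ex[OF assms] positive_inner_cancel[OF B] by metis
  from theI'[OF this] show ?thesis
    by (simp add: sharp_def)
qed

lemma sharp_eqI:
  assumes B: "positive_inner B" and eq: "\<And>z. B w z = l z"
  shows "sharp B l = w"
  unfolding sharp_def by (rule the_equality) (use eq positive_inner_cancel[OF B] in auto)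

text \<open>
  $g^{ij}\beta_{ij}$. The mean curvature is this trace of the second fundamental form with respect to
  the induced metric.
\<close>

definition gtrace :: "('p::euclidean_space \<Rightarrow> 'p \<Rightarrow> real) \<Rightarrow> ('p \<Rightarrow> 'p \<Rightarrow> real) \<Rightarrow> real" where
  "gtrace g \<beta> = trace_map (\<lambda>v. sharp g (\<beta> v))"

lemma linear_inner_left: "linear (\<lambda>x::'p::real_inner. b \<bullet> x)"
  by (auto intro: linearI simp: inner_simps)

lemma sharp_inner:
  assumes g: "positive_inner g" and l: "linear l"
  shows "sharp g l \<bullet> b = l (sharp g (\<lambda>x. b \<bullet> x))"
proof -
  have "sharp g l \<bullet> b = b \<bullet> sharp g l"
    by (rule inner_commute)
  also have "\<dots> = g (sharp g (\<lambda>x. b \<bullet> x)) (sharp g l)"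
    by (rule sharp_apply[OF g linear_inner_left, symmetric])
  also have "\<dots> = l (sharp g (\<lambda>x. b \<bullet> x))"
    by (simp add: positive_inner_sym[OF g, of _ "sharp g l"] sharp_apply[OF g l])
  finally show ?thesis .
qed

lemma gtrace_eq:
  assumes g: "positive_inner g" and b: "\<And>v. v \<in> Basis \<Longrightarrow> linear (\<beta> v)"
  shows "gtrace g \<beta> = (\<Sum>b\<in>Basis. \<beta> b (sharp g (\<lambda>x. b \<bullet> x)))"
  unfolding gtrace_def trace_map_def using sharp_inner[OF g b] by simp

lemma bilinear_linear1: "bilinear \<beta> \<Longrightarrow> linear (\<beta> v)"
  and bilinear_linear2: "bilinear \<beta> \<Longrightarrow> linear (\<lambda>v. \<beta> v w)"
  by (auto simp: bilinear_def)

lemma gtrace_add: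
  assumes g: "positive_inner g" and "bilinear \<beta>" "bilinear \<gamma>"
  shows "gtrace g (\<lambda>v w. \<beta> v w + \<gamma> v w) = gtrace g \<beta> + gtrace g \<gamma>"
  using assms by (simp add: gtrace_eq bilinear_linear1 linear_compose_add sum.distrib)

lemma gtrace_scale:
  assumes g: "positive_inner g" and "bilinear \<beta>"
  shows "gtrace g (\<lambda>v w. c * \<beta> v w) = c * gtrace g \<beta>"
proof -
  have "linear (\<lambda>w. c * \<beta> v w)" for v
    using linear_compose_scale_right[OF bilinear_linear1[OF assms(2)], of c] by simp
  then show ?thesis
    using assms by (simp add: gtrace_eq bilinear_linear1 sum_distrib_left)
qed

lemma gtrace_map:
  assumes g: "positive_inner g"
  shows "gtrace g (\<lambda>v w. g (L v) w) = trace_map L"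
  unfolding gtrace_def by (simp add: sharp_eqI[OF g])

lemma gtrace_self:
  assumes g: "positive_inner (g :: 'p::euclidean_space \<Rightarrow> _)"
  shows "gtrace g g = real DIM('p)"
  using gtrace_map[OF g, of "\<lambda>x. x"] by (simp add: trace_map_def)

lemma gtrace_rank_one:
  assumes g: "positive_inner g" and l: "linear l" and l': "linear l'"
  shows "gtrace g (\<lambda>v w. l v * l' w) = l (sharp g l')"
proof -
  have "linear (\<lambda>w. l v * l' w)" for v
    using linear_compose_scale_right[OF l', of "l v"] by simp
  then have "gtrace g (\<lambda>v w. l v * l' w) = (\<Sum>b\<in>Basis. l b * (sharp g l' \<bullet> b))"
    using gtrace_eq[OF g, of "\<lambda>v w. l v * l' w"] by (simp add: sharp_inner[OF g l'])
  also have "\<dots> = l (\<Sum>b\<in>Basis. (sharp g l' \<bullet> b) *\<^sub>R b)"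
    by (simp add: linear_sum[OF l] linear_cmul[OF l] mult.commute)
  finally show ?thesis
    by (simp add: euclidean_representation)
qed

text \<open>
  Both sides are $\sum_{b,c}g^{bc}\beta(b,c)$, and $g^{bc}$ is symmetric.
\<close>

lemma gtrace_swap:
  fixes \<beta> :: "'p::euclidean_space \<Rightarrow> 'p \<Rightarrow> real"
  assumes g: "positive_inner g" and b: "bilinear \<beta>"
  shows "gtrace g (\<lambda>v w. \<beta> w v) = gtrace g \<beta>"
proof -
  let ?S = "\<lambda>b. sharp g (\<lambda>x. b \<bullet> x)"
  have S: "?S b \<bullet> c = ?S c \<bullet> b" for b c
    by (metis (no_types, lifting) g inner_commute linear_inner_left sharp_inner)
  have lin: "l (?S b) = (\<Sum>c\<in>Basis. (?S b \<bullet> c) * l c)" if "linear l" for l :: "'p \<Rightarrow> real" and b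
  proof -
    have "l (?S b) = l (\<Sum>c\<in>Basis. (?S b \<bullet> c) *\<^sub>R c)"
      by (simp add: euclidean_representation)
    then show ?thesis
      by (simp add: linear_sum[OF that] linear_cmul[OF that])
  qed
  have "gtrace g (\<lambda>v w. \<beta> w v) = (\<Sum>b\<in>Basis. \<beta> (?S b) b)"
    using gtrace_eq[OF g, of "\<lambda>v w. \<beta> w v"] bilinear_linear2[OF b] by simp
  also have "\<dots> = (\<Sum>b\<in>Basis. \<Sum>c\<in>Basis. (?S b \<bullet> c) * \<beta> c b)"
    by (simp add: lin[OF bilinear_linear2[OF b]])
  also have "\<dots> = (\<Sum>c\<in>Basis. \<Sum>b\<in>Basis. (?S c \<bullet> b) * \<beta> c b)"
    by (subst sum.swap) (simp add: S)
  also have "\<dots> = gtrace g \<beta>"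
    by (simp add: gtrace_eq[OF g bilinear_linear1[OF b]] lin[OF bilinear_linear1[OF b]])
  finally show ?thesis .
qed

lemma positive_inner_rank_one:
  assumes g: "positive_inner g" and q: "linear q" and c: "c > 0" and t: "t \<ge> 0"
  shows "positive_inner (\<lambda>v w. c * g v w + t * (q v * q w))"
proof -
  note lin = positive_inner_linear[OF g]
  have "bilinear (\<lambda>v w. c * g v w + t * (q v * q w))"
    unfolding bilinear_def by (auto intro!: linearI
      simp: linear_add[OF lin(1)] linear_add[OF lin(2)] linear_cmul[OF lin(1)] linear_cmul[OF lin(2)]
        linear_add[OF q] linear_cmul[OF q] algebra_simps)
  moreover have "c * g v v + t * (q v * q v) > 0" if "v \<noteq> 0" for v
    using that g c t by (auto simp: positive_inner_def intro!: add_pos_nonneg)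
  ultimately show ?thesis
    using positive_inner_sym[OF g] by (auto simp: positive_inner_def mult.commute)
qed

text \<open>
  The Sherman--Morrison formula. The metric induced on a graph is such a rank one perturbation,
  $\lambda^2g_N+du\otimes du$, of the metric of the base.
\<close>

lemma sharp_rank_one:
  assumes g: "positive_inner g" and q: "linear q" and c: "c > 0" and t: "t \<ge> 0" and l: "linear l"
  defines "z \<equiv> sharp g q"
  shows "sharp (\<lambda>v w. c * g v w + t * (q v * q w)) l = (1 / c) *\<^sub>R (sharp g l - (t * l z / (c + t * q z)) *\<^sub>R z)"
proof (rule sharp_eqI[OF positive_inner_rank_one[OF g q c t]])
  fix x
  note lin = positive_inner_linear[OF g]
  let ?w = "(1 / c) *\<^sub>R (sharp g l - (t * l z / (c + t * q z)) *\<^sub>R z)"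
  have qz: "q z \<ge> 0"
    using positive_inner_nonneg[OF g, of z] sharp_apply[OF g q, of z] by (simp add: z_def)
  then have ne: "c + t * q z > 0"
    using c t by (simp add: add_pos_nonneg)
  have ql: "q (sharp g l) = l z"
    using sharp_apply[OF g q, of "sharp g l"] sharp_apply[OF g l, of z] positive_inner_sym[OF g]
    by (simp add: z_def)
  have gw: "g ?w x = (1 / c) * (l x - (t * l z / (c + t * q z)) * q x)"
    using sharp_apply[OF g q, of x] sharp_apply[OF g l, of x]
    by (simp add: linear_cmul[OF lin(2)] linear_diff[OF lin(2)] z_def)
  have qw: "q ?w = l z / (c + t * q z)"
  proof -
    have "l z - (t * l z / (c + t * q z)) * q z = (l z * (c + t * q z) - t * l z * q z) / (c + t * q z)"
      using ne by (simp add: diff_divide_distrib)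
    also have "l z * (c + t * q z) - t * l z * q z = c * l z"
      by (simp add: algebra_simps)
    finally show ?thesis
      using c by (simp add: linear_cmul[OF q] linear_diff[OF q] ql)
  qed
  show "c * g ?w x + t * (q ?w * q x) = l x"
    using c by (simp add: gw qw)
qed

lemma gtrace_rank_one_perturbation:
  assumes g: "positive_inner g" and q: "linear q" and c: "c > 0" and t: "t \<ge> 0" and b: "bilinear \<beta>"
  defines "z \<equiv> sharp g q"
  shows "gtrace (\<lambda>v w. c * g v w + t * (q v * q w)) \<beta> = (gtrace g \<beta> - t * \<beta> z z / (c + t * q z)) / c"
proof -
  have "(\<Sum>b\<in>Basis. (t * \<beta> b z / (c + t * q z)) * (z \<bullet> b)) = t / (c + t * q z) * \<beta> (\<Sum>b\<in>Basis. (z \<bullet> b) *\<^sub>R b) z"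
    by (simp only: linear_sum[OF bilinear_linear2[OF b]] linear_cmul[OF bilinear_linear2[OF b]] sum_distrib_left)
       (simp add: mult_ac)
  then have s: "(\<Sum>b\<in>Basis. (t * \<beta> b z / (c + t * q z)) * (z \<bullet> b)) = t * \<beta> z z / (c + t * q z)"
    by (simp add: euclidean_representation)
  have "gtrace (\<lambda>v w. c * g v w + t * (q v * q w)) \<beta>
      = (\<Sum>b\<in>Basis. (1 / c) * (sharp g (\<beta> b) \<bullet> b - (t * \<beta> b z / (c + t * q z)) * (z \<bullet> b)))"
    unfolding gtrace_def trace_map_def
    by (simp add: sharp_rank_one[OF g q c t bilinear_linear1[OF b]] z_def inner_diff_left)
  also have "\<dots> = (1 / c) * (gtrace g \<beta> - t * \<beta> z z / (c + t * q z))"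
    by (simp only: sum_distrib_left[symmetric] sum_subtractf s gtrace_def trace_map_def)
  finally show ?thesis by simp
qed

lemma gram_det_nonzero:
  assumes g: "positive_inner g"
  shows "gram_det g \<noteq> 0"
proof -
  have "bgram g *v x = 0 \<Longrightarrow> x = 0" for x
  proof -
    assume 0: "bgram g *v x = 0"
    note lin = positive_inner_linear[OF g]
    have "g (unbvec x) (unbvec x) = (\<Sum>i\<in>UNIV. x $ i * g (Rep_bidx i) (unbvec x))"
      by (subst unbvec_def) (simp add: linear_sum[OF lin(2)] linear_cmul[OF lin(2)])
    also have "\<dots> = (\<Sum>i\<in>UNIV. x $ i * (bgram g *v x) $ i)"
      by (simp add: unbvec_def linear_sum[OF lin(1)] linear_cmul[OF lin(1)] matrix_vector_mult_def bgram_def mult.commute)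
    finally have "unbvec x = 0"
      using 0 positive_inner_pos[OF g, of "unbvec x"] by auto
    then show "x = 0"
      using bvec_unbvec[of x] by (simp add: linear_0[OF linear_bvec])
  qed
  then have "invertible (bgram g)"
    by (metis invertible_left_inverse matrix_left_invertible_ker)
  then show ?thesis
    by (simp add: gram_det_eq_det invertible_det_nz)
qed

section \<open>The derivative of the Gram determinant\<close>

text \<open>
  Jacobi's formula. By multilinearity of the determinant in the rows, the derivative is the sum over
  $i$ of determinants with the $i$-th row replaced by a row of the derivative; expanding that row in
  the rows of the Gram matrix itself, only the coefficient of the $i$-th one survives (Cramer).
\<close>

lemma gram_det_has_derivative:
  fixes g :: "'x::real_normed_vector \<Rightarrow> 'p::euclidean_space \<Rightarrow> 'p \<Rightarrow> real"
  assumes g: "positive_inner (g x)"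
    and der: "\<And>b c. b \<in> Basis \<Longrightarrow> c \<in> Basis \<Longrightarrow> ((\<lambda>y. g y b c) has_derivative (\<lambda>h. g' h b c)) (at x within S)"
    and lin: "\<And>h. bilinear (g' h)"
  shows "((\<lambda>y. gram_det (g y)) has_derivative (\<lambda>h. gram_det (g x) * gtrace (g x) (g' h))) (at x within S)"
proof -
  let ?R = "Rep_bidx :: 'p bidx \<Rightarrow> 'p"
  have D: "((\<lambda>y. gram_det (g y)) has_derivative
      (\<lambda>h. \<Sum>p | p permutes (UNIV :: 'p bidx set). of_int (sign p) *
        (\<Sum>i\<in>UNIV. g' h (?R i) (?R (p i)) * (\<Prod>j\<in>UNIV - {i}. g x (?R j) (?R (p j)))))) (at x within S)"
    unfolding gram_det_eq_det det_def bgram_def vec_lambda_beta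
    by (intro has_derivative_sum has_derivative_mult_right has_derivative_prod der) auto
  have "(\<Sum>p | p permutes (UNIV :: 'p bidx set). of_int (sign p) *
        (\<Sum>i\<in>UNIV. g' h (?R i) (?R (p i)) * (\<Prod>j\<in>UNIV - {i}. g x (?R j) (?R (p j)))))
      = gram_det (g x) * gtrace (g x) (g' h)" for h
  proof -
    let ?A = "bgram (g x)"
    define X where "X i = bvec (sharp (g x) (g' h (?R i)))" for i
    have X: "g' h (?R i) (?R k) = (\<Sum>j\<in>UNIV. X i $ j *s row j ?A) $ k" for i k
    proof -
      have "g' h (?R i) (?R k) = g x (unbvec (X i)) (?R k)"
        using sharp_apply[OF g bilinear_linear1[OF lin]] by (simp add: X_def)
      also have "\<dots> = (\<Sum>j\<in>UNIV. X i $ j * g x (?R j) (?R k))"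
        by (simp add: unbvec_def linear_sum[OF positive_inner_linear(2)[OF g]] linear_cmul[OF positive_inner_linear(2)[OF g]])
      finally show ?thesis
        by (simp add: row_def bgram_def vector_scalar_mult_def)
    qed
    have prod: "g' h (?R i) (?R (p i)) * (\<Prod>j\<in>UNIV - {i}. g x (?R j) (?R (p j)))
        = (\<Prod>j\<in>UNIV. (if j = i then (\<Sum>l\<in>UNIV. X i $ l *s row l ?A) else row j ?A) $ p j)" for i p
    proof -
      have "(\<Prod>j\<in>UNIV. (if j = i then (\<Sum>l\<in>UNIV. X i $ l *s row l ?A) else row j ?A) $ p j)
         = (\<Sum>l\<in>UNIV. X i $ l *s row l ?A) $ p i * (\<Prod>j\<in>UNIV - {i}. (if j = i then (\<Sum>l\<in>UNIV. X i $ l *s row l ?A) else row j ?A) $ p j)"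
        by (subst prod.remove[of _ i]) auto
      also have "(\<Prod>j\<in>UNIV - {i}. (if j = i then (\<Sum>l\<in>UNIV. X i $ l *s row l ?A) else row j ?A) $ p j)
          = (\<Prod>j\<in>UNIV - {i}. g x (?R j) (?R (p j)))"
        by (rule prod.cong) (auto simp: row_def bgram_def)
      finally show ?thesis
        by (simp add: X)
    qed
    have "(\<Sum>p | p permutes (UNIV :: 'p bidx set). of_int (sign p) *
        (\<Sum>i\<in>UNIV. g' h (?R i) (?R (p i)) * (\<Prod>j\<in>UNIV - {i}. g x (?R j) (?R (p j)))))
      = (\<Sum>i\<in>UNIV. det (\<chi> j. if j = i then (\<Sum>l\<in>UNIV. X i $ l *s row l ?A) else row j ?A))"
      unfolding det_def prod sum_distrib_left by (subst sum.swap) simp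
    also have "\<dots> = (\<Sum>i\<in>UNIV. X i $ i * det ?A)"
      by (simp add: cramer_lemma_transpose)
    also have "\<dots> = gram_det (g x) * gtrace (g x) (g' h)"
      by (simp add: X_def bvec_def gtrace_def trace_map_def gram_det_eq_det sum_distrib_left mult.commute
          sum_bidx[where f = "\<lambda>b. det (bgram (g x)) * (b \<bullet> sharp (g x) (g' h b))", symmetric] inner_commute)
    finally show ?thesis .
  qed
  with D show ?thesis by simp
qed

lemma derivative_zero_constant_unit:
  fixes h :: "real \<Rightarrow> real"
  assumes "\<And>t. t \<in> {0..1} \<Longrightarrow> (h has_derivative (\<lambda>_. 0)) (at t within {0..1})"
  shows "h 1 = h 0"
  using has_derivative_zero_constant[of "{0..1}" h] assms by fastforce

text \<open>
  The matrix determinant lemma, $\det(cG+qq^{\mathsf T})=c^{n-1}(c+|q|_g^2)\det G$. Along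
  $cg+t\,q\otimes q$ Jacobi's formula is a linear differential equation, which
  $c+t|q|_g^2$ solves as well.
\<close>

lemma gram_det_rank_one:
  fixes g :: "'p::euclidean_space \<Rightarrow> 'p \<Rightarrow> real"
  assumes g: "positive_inner g" and q: "linear q" and c: "c > 0"
  shows "gram_det (\<lambda>v w. c * g v w + q v * q w) = c ^ (DIM('p) - 1) * (c + q (sharp g q)) * gram_det g"
proof -
  define Q where "Q = q (sharp g q)"
  define F where "F t = (\<lambda>v w. c * g v w + t * (q v * q w))" for t
  define f where "f t = gram_det (F t)" for t
  have Q: "Q \<ge> 0"
    using positive_inner_nonneg[OF g, of "sharp g q"] sharp_apply[OF g q, of "sharp g q"] by (simp add: Q_def)
  have D: "c + t * Q > 0" if "t \<in> {0..1}" for t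
    using c Q that by (simp add: add_pos_nonneg)
  have P: "positive_inner (F t)" if "t \<in> {0..1}" for t
    unfolding F_def using that by (intro positive_inner_rank_one g q c) auto
  have bil: "bilinear (\<lambda>v w. q v * q w)"
    by (auto simp: bilinear_def linear_add[OF q] linear_cmul[OF q] algebra_simps intro!: linearI)
  have bil': "bilinear (\<lambda>v w. h * (q v * q w))" for h :: real
    by (auto simp: bilinear_def linear_add[OF q] linear_cmul[OF q] algebra_simps intro!: linearI)
  have tr: "gtrace (F t) (\<lambda>v w. h * (q v * q w)) = h * (Q / (c + t * Q))" if t: "t \<in> {0..1}" for t h
  proof -
    have "gtrace (F t) (\<lambda>v w. h * (q v * q w)) = h * q (sharp (F t) q)"
      by (simp add: gtrace_scale[OF P[OF t] bil] gtrace_rank_one[OF P[OF t] q q])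
    also have "q (sharp (F t) q) = (1 / c) * (Q - t * Q / (c + t * Q) * Q)"
      unfolding F_def using sharp_rank_one[OF g q c, of t q] t q
      by (simp add: linear_cmul[OF q] linear_diff[OF q] Q_def)
    also have "Q - t * Q / (c + t * Q) * Q = (Q * (c + t * Q) - t * Q * Q) / (c + t * Q)"
      using D[OF t] by (simp add: diff_divide_distrib)
    also have "Q * (c + t * Q) - t * Q * Q = c * Q"
      by (simp add: algebra_simps)
    finally show ?thesis
      using c by simp
  qed
  have df: "(f has_derivative (\<lambda>h. f t * (h * (Q / (c + t * Q))))) (at t within {0..1})" if t: "t \<in> {0..1}" for t
  proof -
    have "(f has_derivative (\<lambda>h. gram_det (F t) * gtrace (F t) (\<lambda>v w. h * (q v * q w)))) (at t within {0..1})"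
      unfolding f_def by (rule gram_det_has_derivative[where g = F and x = t, OF P[OF t] _ bil'])
        (auto simp: F_def intro!: derivative_eq_intros)
    then show ?thesis
      by (simp add: tr[OF t] f_def)
  qed
  \<comment> \<open>\<open>f\<close> and $c+tQ$ have the same logarithmic derivative.\<close>
  have "((\<lambda>t. f t / (c + t * Q)) has_derivative (\<lambda>_. 0)) (at t within {0..1})" if t: "t \<in> {0..1}" for t
    using df[OF t] D[OF t] by (auto intro!: derivative_eq_intros simp: fun_eq_iff field_simps)
  then have "f 1 / (c + 1 * Q) = f 0 / (c + 0 * Q)"
    by (rule derivative_zero_constant_unit)
  then have "f 1 = (c + Q) * f 0 / c"
    using D[of 1] c by (simp add: field_simps)
  moreover have "f 0 = c ^ DIM('p) * gram_det g"
    by (simp add: f_def F_def gram_det_scale)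
  moreover have "c ^ DIM('p) = c * c ^ (DIM('p) - 1)"
    by (metis DIM_positive power_eq_if less_numeral_extra(3))
  ultimately show ?thesis
    using c by (simp add: f_def F_def Q_def)
qed

lemma positive_inner_inner: "positive_inner (\<lambda>v w :: 'p::euclidean_space. v \<bullet> w)"
  by (auto simp: positive_inner_def bilinear_def inner_commute inner_simps intro!: linearI)

lemma bilinear_combination:
  assumes "bilinear B" "bilinear C"
  shows "bilinear (\<lambda>v w. s * B v w + t * C v w :: real)"
  using assms by (auto simp: bilinear_def linear_iff algebra_simps)

lemma positive_inner_convex:
  assumes B: "positive_inner B" and C: "positive_inner C" and t: "t \<in> {0..1}"
  shows "positive_inner (\<lambda>v w. (1 - t) * B v w + t * C v w)"
proof -
  have "(1 - t) * B v v + t * C v v > 0" if "v \<noteq> 0" for v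
  proof (cases "t = 1")
    case False
    then have "(1 - t) * B v v > 0"
      using t positive_inner_pos[OF B that] by simp
    moreover have "t * C v v \<ge> 0"
      using t positive_inner_pos[OF C that] by (simp add: mult_nonneg_nonneg)
    ultimately show ?thesis by linarith
  qed (use positive_inner_pos[OF C that] in simp)
  then show ?thesis
    using bilinear_combination[OF positive_inner_bilinear[OF B] positive_inner_bilinear[OF C]]
      positive_inner_sym[OF B] positive_inner_sym[OF C] by (simp add: positive_inner_def)
qed

lemma gram_det_convex_derivative:
  fixes B C :: "'p::euclidean_space \<Rightarrow> 'p \<Rightarrow> real"
  assumes B: "positive_inner B" and C: "positive_inner C" and t: "t \<in> {0..1}"
  defines "F \<equiv> \<lambda>t v w. (1 - t) * B v w + t * C v w"
  shows "((\<lambda>t. gram_det (F t)) has_derivative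
      (\<lambda>h. gram_det (F t) * gtrace (F t) (\<lambda>v w. h * C v w + (-h) * B v w))) (at t within {0..1})"
  unfolding F_def
proof (rule gram_det_has_derivative[where g = "\<lambda>t v w. (1 - t) * B v w + t * C v w" and x = t, OF positive_inner_convex[OF B C t]])
  show "bilinear (\<lambda>v w. h * C v w + - h * B v w)" for h
    by (intro bilinear_combination positive_inner_bilinear B C)
qed (auto intro!: derivative_eq_intros simp: algebra_simps)

text \<open>
  Inner products form a convex set, on which the Gram determinant is continuous and never zero; at the
  standard inner product it is $1$.
\<close>

lemma gram_det_pos:
  fixes g :: "'p::euclidean_space \<Rightarrow> 'p \<Rightarrow> real"
  assumes g: "positive_inner g"
  shows "gram_det g > 0"
proof (rule ccontr)
  assume "\<not> gram_det g > 0"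
  define F where "F t = (\<lambda>v w. (1 - t) * (v \<bullet> w) + t * g v w)" for t
  have "continuous_on {0..1} (\<lambda>t. gram_det (F t))"
    unfolding F_def
    by (rule has_derivative_continuous_on) (rule gram_det_convex_derivative[OF positive_inner_inner g])
  moreover have "gram_det (F 1) \<le> 0" "0 \<le> gram_det (F 0)"
    using \<open>\<not> gram_det g > 0\<close> by (simp_all add: F_def gram_det_inner)
  ultimately obtain t where t: "0 \<le> t" "t \<le> 1" "gram_det (F t) = 0"
    using IVT2'[of "\<lambda>t. gram_det (F t)" 1 0 0] by auto
  then have "positive_inner (F t)"
    unfolding F_def by (intro positive_inner_convex positive_inner_inner g) auto
  with t show False
    using gram_det_nonzero by blast
qed

text \<open>
  The orthogonal sum $c\,dr^2+g$ on a product with the real line. The value $c=1$ gives the metric of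
  the warped product, $c=0$ a variation that leaves $dr^2$ alone.
\<close>

definition block :: "real \<Rightarrow> ('p \<Rightarrow> 'p \<Rightarrow> real) \<Rightarrow> real \<times> 'p \<Rightarrow> real \<times> 'p \<Rightarrow> real" where
  "block c g = (\<lambda>x y. c * (fst x * fst y) + g (snd x) (snd y))"

lemma bilinear_block: "bilinear \<beta> \<Longrightarrow> bilinear (block c \<beta>)"
  by (auto simp: bilinear_def block_def linear_iff algebra_simps)

lemma positive_inner_block:
  assumes g: "positive_inner g"
  shows "positive_inner (block 1 g)"
proof -
  have "block 1 g x x > 0" if "x \<noteq> 0" for x
  proof (cases "snd x = 0")
    case True
    then have "fst x \<noteq> 0"
      using that by (simp add: prod_eq_iff)
    then show ?thesis
      using True positive_inner_nonneg[OF g, of "snd x"] by (auto simp: block_def not_sum_power2_lt_zero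
        intro!: add_pos_nonneg simp flip: power2_eq_square)
  next
    case False
    then show ?thesis
      using positive_inner_pos[OF g] by (auto simp: block_def intro!: add_nonneg_pos)
  qed
  then show ?thesis
    using bilinear_block[OF positive_inner_bilinear[OF g], of 1] positive_inner_sym[OF g]
    by (auto simp: positive_inner_def block_def mult.commute)
qed

lemma gtrace_block:
  assumes g: "positive_inner (g :: 'p::euclidean_space \<Rightarrow> _)" and b: "bilinear \<beta>"
  shows "gtrace (block 1 g) (block 0 \<beta>) = gtrace g \<beta>"
proof -
  have s: "sharp (block 1 g) (block 0 \<beta> x) = (0, sharp g (\<beta> (snd x)))" for x
    by (rule sharp_eqI[OF positive_inner_block[OF g]])
      (simp add: block_def sharp_apply[OF g bilinear_linear1[OF b]])
  have "gtrace (block 1 g) (block 0 \<beta>) = (\<Sum>x\<in>Basis. (0::real, sharp g (\<beta> (snd x))) \<bullet> x)"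
    by (simp add: gtrace_def trace_map_def s)
  also have "\<dots> = (\<Sum>x\<in>(\<lambda>v. (0, v)) ` (Basis :: 'p set). (0::real, sharp g (\<beta> (snd x))) \<bullet> x)"
    by (rule sum.mono_neutral_right) (auto simp: Basis_prod_def)
  also have "\<dots> = gtrace g \<beta>"
    by (subst sum.reindex) (auto simp: inj_on_def gtrace_def trace_map_def)
  finally show ?thesis .
qed

text \<open>
  Deform $g$ into the standard inner product. By Jacobi's formula both determinants have the same
  logarithmic derivative, so their quotient is constant, and it is $1$ at the standard inner product.
\<close>

lemma gram_det_block:
  fixes g :: "'p::euclidean_space \<Rightarrow> 'p \<Rightarrow> real"
  assumes g: "positive_inner g"
  shows "gram_det (block 1 g) = gram_det g"
proof -
  let ?I = "(\<bullet>) :: 'p \<Rightarrow> 'p \<Rightarrow> real"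
  define F where "F t = (\<lambda>v w. (1 - t) * ?I v w + t * g v w)" for t
  define G where "G t = (\<lambda>v w. (1 - t) * block 1 ?I v w + t * block 1 g v w)" for t
  have G: "G t = block 1 (F t)" for t
    by (auto simp: G_def F_def block_def fun_eq_iff algebra_simps)
  have P: "positive_inner (F t)" if "t \<in> {0..1}" for t
    unfolding F_def by (intro positive_inner_convex positive_inner_inner g that)
  have "((\<lambda>t. gram_det (G t) / gram_det (F t)) has_derivative (\<lambda>_. 0)) (at t within {0..1})" if t: "t \<in> {0..1}" for t
  proof -
    define \<beta> where "\<beta> h = (\<lambda>v w. h * g v w + (-h) * ?I v w)" for h
    have b: "bilinear (\<beta> h)" for h
      unfolding \<beta>_def by (intro bilinear_combination positive_inner_bilinear positive_inner_inner g)
    have e: "(\<lambda>v w. h * block 1 g v w + (-h) * block 1 ?I v w) = block 0 (\<beta> h)" for h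
      by (auto simp: \<beta>_def block_def fun_eq_iff algebra_simps)
    have "((\<lambda>t. gram_det (G t)) has_derivative (\<lambda>h. gram_det (G t) * gtrace (G t) (block 0 (\<beta> h)))) (at t within {0..1})"
      unfolding G_def e[symmetric]
      by (rule gram_det_convex_derivative) (intro positive_inner_block positive_inner_inner g t)+
    then have 1: "((\<lambda>t. gram_det (G t)) has_derivative (\<lambda>h. gram_det (G t) * gtrace (F t) (\<beta> h))) (at t within {0..1})"
      by (simp add: G gtrace_block[OF P[OF t] b])
    have 2: "((\<lambda>t. gram_det (F t)) has_derivative (\<lambda>h. gram_det (F t) * gtrace (F t) (\<beta> h))) (at t within {0..1})"
      unfolding F_def \<beta>_def by (intro gram_det_convex_derivative positive_inner_inner g t)
    show ?thesis
      using has_derivative_divide[OF 1 2] gram_det_nonzero[OF P[OF t]] by (simp add: field_simps)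
  qed
  then have "gram_det (G 1) / gram_det (F 1) = gram_det (G 0) / gram_det (F 0)"
    by (rule derivative_zero_constant_unit)
  moreover have "gram_det (G 0) = 1"
  proof -
    have "G 0 = (\<lambda>x y. x \<bullet> y)"
      by (auto simp: G_def block_def fun_eq_iff inner_prod_def)
    then show ?thesis
      by (simp add: gram_det_inner)
  qed
  ultimately show ?thesis
    using gram_det_nonzero[OF g] by (simp add: F_def G_def gram_det_inner)
qed

section \<open>Change of variables\<close>

text \<open>
  The change of variables theorem for sets of finite measure, extended to all Borel sets by exhaustion.
\<close>

lemma emeasure_differentiable_image:
  fixes \<tau> :: "real ^ 'm::{finite,wellorder} \<Rightarrow> real ^ 'm::_"
  assumes S: "S \<in> sets borel"
    and der: "\<And>x. x \<in> S \<Longrightarrow> (\<tau> has_derivative \<tau>' x) (at x within S)"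
    and inj: "inj_on \<tau> S"
    and meas: "(\<lambda>x. \<bar>det (matrix (\<tau>' x))\<bar> * indicator S x) \<in> borel_measurable borel"
  shows "emeasure lebesgue (\<tau> ` S) = (\<integral>\<^sup>+x. ennreal (\<bar>det (matrix (\<tau>' x))\<bar> * indicator S x) \<partial>lborel)"
proof -
  define d where "d x = \<bar>det (matrix (\<tau>' x))\<bar> * indicator S x" for x
  \<comment> \<open>On \<open>T k\<close> the integrand is bounded with bounded support, so that the image has finite measure.\<close>
  define T where "T k = S \<inter> {x. d x \<le> real k} \<inter> cball 0 (real k)" for k :: nat
  have d: "d \<in> borel_measurable borel" "\<And>x. d x \<ge> 0"
    using meas by (auto simp: d_def[abs_def])
  have T: "T k \<in> sets borel" for k
    using d(1) S by (auto simp: T_def)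
  have TS: "T k \<subseteq> S" for k
    by (auto simp: T_def)
  have union: "(\<Union>k. T k) = S"
  proof -
    have "x \<in> (\<Union>k. T k)" if "x \<in> S" for x
    proof -
      obtain k :: nat where "real k \<ge> max (d x) (norm x)"
        using real_arch_simple by blast
      with that show ?thesis
        by (auto simp: T_def)
    qed
    then show ?thesis
      using TS by blast
  qed
  have mono: "incseq T"
    by (rule incseq_SucI) (auto simp: T_def)
  have eq: "emeasure lebesgue (\<tau> ` T k) = (\<integral>\<^sup>+x. ennreal (d x * indicator (T k) x) \<partial>lborel) \<and> \<tau> ` T k \<in> sets lebesgue" for k
  proof -
    let ?f = "\<lambda>x. d x * indicator (T k) x"
    have fin: "(\<integral>\<^sup>+x. ennreal (?f x) \<partial>lborel) < \<infinity>"
    proof -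
      have "(\<integral>\<^sup>+x. ennreal (?f x) \<partial>lborel) \<le> (\<integral>\<^sup>+x. ennreal (real k) * indicator (cball (0 :: real ^ 'm::_) (real k)) x \<partial>lborel)"
        by (intro nn_integral_mono) (auto simp: T_def indicator_def intro: ennreal_leI)
      also have "\<dots> = ennreal (real k) * emeasure lborel (cball (0 :: real ^ 'm::_) (real k))"
        by (simp add: nn_integral_cmult_indicator)
      also have "\<dots> < \<infinity>"
        using emeasure_lborel_cball_finite[of "0 :: real ^ 'm::_" "real k"] by (simp add: ennreal_mult_less_top)
      finally show ?thesis .
    qed
    then obtain r where r: "(\<integral>\<^sup>+x. ennreal (?f x) \<partial>lborel) = ennreal r" "0 \<le> r"
      by (cases "\<integral>\<^sup>+x. ennreal (?f x) \<partial>lborel" rule: ennreal_cases) auto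
    have "(?f has_integral r) UNIV"
      using d T by (intro nn_integral_has_integral r) auto
    moreover have "?f = (\<lambda>x. if x \<in> T k then \<bar>det (matrix (\<tau>' x))\<bar> else 0)"
      using TS by (auto simp: d_def fun_eq_iff indicator_def)
    ultimately have "((\<lambda>x. \<bar>det (matrix (\<tau>' x))\<bar>) has_integral r) (T k)"
      by (simp add: has_integral_restrict_UNIV)
    moreover have "(\<tau> has_derivative \<tau>' x) (at x within T k)" if "x \<in> T k" for x
      using der that TS has_derivative_subset by blast
    moreover have "T k \<in> sets lebesgue"
      using T by simp
    moreover have "inj_on \<tau> (T k)"
      using inj TS inj_on_subset by blast
    ultimately have "\<tau> ` T k \<in> lmeasurable \<and> measure lebesgue (\<tau> ` T k) = r"
      using has_measure_differentiable_image by blast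
    then show ?thesis
      using r by (auto simp: emeasure_eq_measure2 dest: fmeasurableD)
  qed
  have "emeasure lebesgue (\<tau> ` S) = emeasure lebesgue (\<Union>k. \<tau> ` T k)"
    by (simp add: union[symmetric] image_UN)
  also have "\<dots> = (SUP k. emeasure lebesgue (\<tau> ` T k))"
    using eq mono by (intro SUP_emeasure_incseq[symmetric]) (auto simp: incseq_def image_mono)
  also have "\<dots> = (SUP k. \<integral>\<^sup>+x. ennreal (d x * indicator (T k) x) \<partial>lborel)"
    using eq by simp
  also have "\<dots> = (\<integral>\<^sup>+x. (SUP k. ennreal (d x * indicator (T k) x)) \<partial>lborel)"
  proof (rule nn_integral_monotone_convergence_SUP[symmetric])
    show "incseq (\<lambda>k x. ennreal (d x * indicator (T k) x))"
      using mono d(2) by (auto simp: incseq_def le_fun_def indicator_def intro!: ennreal_leI)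
  qed (use d T in auto)
  also have "\<dots> = (\<integral>\<^sup>+x. ennreal (d x) \<partial>lborel)"
  proof (rule nn_integral_cong)
    fix x
    show "(SUP k. ennreal (d x * indicator (T k) x)) = ennreal (d x)"
    proof (cases "x \<in> S")
      case True
      then obtain k where "x \<in> T k"
        using union by blast
      then have "ennreal (d x) \<le> (SUP k. ennreal (d x * indicator (T k) x))"
        by (intro SUP_upper2[of k]) auto
      moreover have "(SUP k. ennreal (d x * indicator (T k) x)) \<le> ennreal (d x)"
        using d(2) by (intro SUP_least) (auto simp: indicator_def)
      ultimately show ?thesis by (rule antisym[rotated])
    qed (use TS in \<open>auto simp: d_def\<close>)
  qed
  finally show ?thesis
    by (simp add: d_def)
qed

text \<open>
  Coordinates with respect to an orthonormal basis map boxes to boxes of the same volume, so they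
  preserve Lebesgue measure.
\<close>

lemma distr_bvec: "distr lborel borel (bvec :: 'p::euclidean_space \<Rightarrow> _) = lborel"
proof (rule lborel_eqI[symmetric])
  fix l u :: "real ^ 'p bidx"
  assume lu: "\<And>b. b \<in> Basis \<Longrightarrow> l \<bullet> b \<le> u \<bullet> b"
  have meas: "bvec \<in> borel_measurable (borel :: 'p measure)"
    by (intro borel_measurable_continuous_onI linear_continuous_on linear_conv_bounded_linear[THEN iffD1] linear_bvec)
  have c: "unbvec x \<bullet> Rep_bidx i = x $ i" for x :: "real ^ 'p bidx" and i
    using bvec_unbvec[of x] by (metis bvec_def vec_lambda_beta)
  have ball: "(\<forall>b\<in>Basis. Q b) \<longleftrightarrow> (\<forall>i. Q (Rep_bidx i :: 'p))" for Q
  proof -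
    have "Basis = range (Rep_bidx :: 'p bidx \<Rightarrow> 'p)"
      using bij_Rep_bidx[where 'p = 'p] by (simp add: bij_betw_def)
    then show ?thesis
      by (metis rangeE rangeI)
  qed
  have box: "bvec -` box l u = box (unbvec l) (unbvec u :: 'p)"
    by (auto simp: box_def Basis_vec_def inner_axis bvec_def ball c)
  have le: "unbvec l \<bullet> b \<le> unbvec u \<bullet> b" if "b \<in> Basis" for b :: 'p
  proof -
    have "l $ i \<le> u $ i" for i
      using lu[of "axis i 1"] by (auto simp: Basis_vec_def inner_axis)
    then show ?thesis
      using that ball[of "\<lambda>b. unbvec l \<bullet> b \<le> unbvec u \<bullet> b"] c by auto
  qed
  have "emeasure (distr lborel borel bvec) (box l u) = emeasure lborel (box (unbvec l) (unbvec u :: 'p))"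
    by (subst emeasure_distr) (use meas in \<open>auto simp: box\<close>)
  also have "\<dots> = ennreal (\<Prod>b\<in>Basis. (unbvec u - unbvec l :: 'p) \<bullet> b)"
    by (rule emeasure_lborel_box[OF le])
  also have "(\<Prod>b\<in>Basis. (unbvec u - unbvec l :: 'p) \<bullet> b) = (\<Prod>i\<in>UNIV. (u - l) $ i)"
    by (subst prod.reindex_bij_betw[OF bij_Rep_bidx, symmetric]) (simp add: inner_diff_left c)
  also have "\<dots> = (\<Prod>b\<in>Basis. (u - l) \<bullet> b)"
  proof -
    have "bij_betw (\<lambda>i. axis i 1) UNIV (Basis :: (real ^ 'p bidx) set)"
      by (auto simp: bij_betw_def inj_on_def Basis_vec_def axis_eq_axis)
    from prod.reindex_bij_betw[OF this, of "\<lambda>b. (u - l) \<bullet> b"] show ?thesis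
      by (simp add: inner_axis)
  qed
  finally show "emeasure (distr lborel borel bvec) (box l u) = ennreal (\<Prod>b\<in>Basis. (u - l) \<bullet> b)" .
qed simp

lemma borel_measurable_bvec [measurable]: "bvec \<in> borel_measurable borel"
  and borel_measurable_unbvec [measurable]: "unbvec \<in> borel_measurable borel"
  by (auto intro!: borel_measurable_continuous_onI linear_continuous_on linear_conv_bounded_linear[THEN iffD1] linear_bvec linear_unbvec)

lemma emeasure_lborel_bvec:
  assumes "A \<in> sets borel"
  shows "emeasure lborel (bvec ` A) = emeasure lborel A" "bvec ` A \<in> sets borel"
proof -
  have e: "bvec ` A = unbvec -` A"
    by (auto simp: image_iff) (metis bvec_unbvec)
  have e': "bvec -` (bvec ` A) = A"
    by (metis inj_on_inverseI inj_vimage_image_eq unbvec_bvec)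
  show *: "bvec ` A \<in> sets borel"
    unfolding e using assms measurable_sets[OF borel_measurable_unbvec, of A] by simp
  have "emeasure lborel (bvec ` A) = emeasure (distr lborel borel bvec) (bvec ` A)"
    by (simp add: distr_bvec)
  then show "emeasure lborel (bvec ` A) = emeasure lborel A"
    by (subst (asm) emeasure_distr) (use * in \<open>auto simp: e'\<close>)
qed

lemma continuous_on_bdet:
  assumes "\<And>v. continuous_on S (\<lambda>x. \<tau>' x v)"
  shows "continuous_on S (\<lambda>x. bdet (\<tau>' x))"
  unfolding bdet_def det_def matrix_def
  by (intro continuous_intros) (simp add: bvec_def unbvec_axis, intro continuous_intros assms)

lemma borel_measurable_open_if:
  fixes f :: "'x::topological_space \<Rightarrow> 'y::topological_space"
  assumes "open S" "continuous_on S f"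
  shows "(\<lambda>x. if x \<in> S then f x else c) \<in> borel_measurable borel"
  using borel_measurable_continuous_on_if[of S f "\<lambda>_. c"] assms by (simp add: borel_open)

lemma borel_measurable_open_indicator:
  fixes f :: "'x::topological_space \<Rightarrow> real"
  assumes "open S" "continuous_on S f"
  shows "(\<lambda>x. f x * indicator S x) \<in> borel_measurable borel"
proof -
  have "(\<lambda>x. f x * indicator S x) = (\<lambda>x. if x \<in> S then f x else 0)"
    by auto
  then show ?thesis
    using borel_measurable_open_if[OF assms, of 0] by simp
qed

lemma emeasure_diffeomorphism_image:
  fixes \<tau> :: "'p::euclidean_space \<Rightarrow> 'p"
  assumes "open S" and der: "\<And>x. x \<in> S \<Longrightarrow> (\<tau> has_derivative \<tau>' x) (at x)"
    and cont: "\<And>v. continuous_on S (\<lambda>x. \<tau>' x v)"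
    and inj: "inj_on \<tau> S" and A: "A \<in> sets borel" "A \<subseteq> S" "\<tau> ` A \<in> sets borel"
  shows "emeasure lborel (\<tau> ` A) = (\<integral>\<^sup>+x. ennreal \<bar>bdet (\<tau>' x)\<bar> * indicator A x \<partial>lborel)"
proof -
  let ?\<sigma> = "bvec \<circ> \<tau> \<circ> unbvec" and ?\<sigma>' = "\<lambda>x. bvec \<circ> \<tau>' (unbvec x) \<circ> unbvec"
  let ?B = "bvec ` A"
  have bl: "bounded_linear bvec" "bounded_linear unbvec"
    using linear_bvec linear_unbvec linear_conv_bounded_linear by blast+
  have B: "?B \<in> sets borel"
    using A by (rule_tac emeasure_lborel_bvec)
  have im: "?\<sigma> ` ?B = bvec ` (\<tau> ` A)"
    by (auto simp: image_image)
  have meas: "(\<lambda>x. \<bar>bdet (\<tau>' x)\<bar> * indicator A x) \<in> borel_measurable borel"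
  proof -
    have "(\<lambda>x. \<bar>bdet (\<tau>' x)\<bar> * indicator S x) \<in> borel_measurable borel"
      by (intro borel_measurable_open_indicator assms continuous_on_rabs continuous_on_bdet)
    then have "(\<lambda>x. \<bar>bdet (\<tau>' x)\<bar> * indicator S x * indicator A x) \<in> borel_measurable borel"
      using A by measurable
    also have "(\<lambda>x. \<bar>bdet (\<tau>' x)\<bar> * indicator S x * indicator A x) = (\<lambda>x. \<bar>bdet (\<tau>' x)\<bar> * indicator A x)"
      using A(2) by (auto simp: fun_eq_iff indicator_def)
    finally show ?thesis .
  qed
  have det: "\<bar>det (matrix (?\<sigma>' x))\<bar> * indicator ?B x = (\<lambda>x. \<bar>bdet (\<tau>' x)\<bar> * indicator A x) (unbvec x)" for x
  proof -
    have "x \<in> ?B \<longleftrightarrow> unbvec x \<in> A"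
      by (metis bvec_unbvec imageE image_eqI unbvec_bvec)
    then show ?thesis
      by (simp add: bdet_def indicator_def)
  qed
  have "emeasure lebesgue (?\<sigma> ` ?B) = (\<integral>\<^sup>+x. ennreal (\<bar>det (matrix (?\<sigma>' x))\<bar> * indicator ?B x) \<partial>lborel)"
  proof (rule emeasure_differentiable_image[OF B])
    fix x assume "x \<in> ?B"
    then have "unbvec x \<in> S"
      using A by auto
    then have "(\<tau> has_derivative \<tau>' (unbvec x)) (at (unbvec x) within UNIV)"
      using der by simp
    then have "((\<lambda>x. \<tau> (unbvec x)) has_derivative (\<lambda>h. \<tau>' (unbvec x) (unbvec h))) (at x)"
      using has_derivative_compose[OF bounded_linear_imp_has_derivative[OF bl(2)], of \<tau> "\<tau>' (unbvec x)" x UNIV] by simp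
    then have "(?\<sigma> has_derivative ?\<sigma>' x) (at x)"
      using bounded_linear.has_derivative[OF bl(1)] by (simp add: comp_def)
    then show "(?\<sigma> has_derivative ?\<sigma>' x) (at x within ?B)"
      by (rule has_derivative_at_withinI)
  next
    show "inj_on ?\<sigma> ?B"
    proof (rule inj_onI)
      fix x y assume "x \<in> ?B" "y \<in> ?B" "?\<sigma> x = ?\<sigma> y"
      then have "\<tau> (unbvec x) = \<tau> (unbvec y)" "unbvec x \<in> S" "unbvec y \<in> S"
        using A by (auto dest!: arg_cong[where f = unbvec])
      then have "unbvec x = unbvec y"
        using inj by (auto dest: inj_onD)
      then show "x = y"
        by (metis bvec_unbvec)
    qed
  next
    show "(\<lambda>x. \<bar>det (matrix (?\<sigma>' x))\<bar> * indicator ?B x) \<in> borel_measurable borel"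
      unfolding det by (rule measurable_compose[OF borel_measurable_unbvec meas])
  qed
  also have "\<dots> = (\<integral>\<^sup>+x. ennreal (\<bar>bdet (\<tau>' (unbvec x))\<bar> * indicator A (unbvec x)) \<partial>distr lborel borel bvec)"
    unfolding det by (simp add: distr_bvec)
  also have "\<dots> = (\<integral>\<^sup>+x. ennreal (\<bar>bdet (\<tau>' x)\<bar> * indicator A x) \<partial>lborel)"
    by (subst nn_integral_distr)
      (auto intro!: measurable_compose[OF _ measurable_ennreal] measurable_compose[OF borel_measurable_unbvec meas])
  also have "\<dots> = (\<integral>\<^sup>+x. ennreal \<bar>bdet (\<tau>' x)\<bar> * indicator A x \<partial>lborel)"
    by (intro nn_integral_cong) (auto simp: indicator_def)
  finally show ?thesis
    unfolding im using emeasure_lborel_bvec[OF A(3)] by simp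
qed

text \<open>
  The formula for Borel sets says that two measures on the target agree; integrating \<open>h\<close> against both
  gives the formula for functions.
\<close>

theorem nn_integral_diffeomorphism:
  fixes \<tau> :: "'p::euclidean_space \<Rightarrow> 'p"
  assumes S: "open S" and der: "\<And>x. x \<in> S \<Longrightarrow> (\<tau> has_derivative \<tau>' x) (at x)"
    and cont: "\<And>v. continuous_on S (\<lambda>x. \<tau>' x v)"
    and hom: "homeomorphism S T \<tau> \<sigma>" and T: "open T"
    and h: "h \<in> borel_measurable borel"
  shows "(\<integral>\<^sup>+y. h y * indicator T y \<partial>lborel) = (\<integral>\<^sup>+x. h (\<tau> x) * (ennreal \<bar>bdet (\<tau>' x)\<bar> * indicator S x) \<partial>lborel)"
proof -
  note hom' = homeomorphism_apply1[OF hom] homeomorphism_apply2[OF hom]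
    homeomorphism_image1[OF hom] homeomorphism_image2[OF hom] homeomorphism_cont1[OF hom] homeomorphism_cont2[OF hom]
  define \<tau>0 where "\<tau>0 x = (if x \<in> S then \<tau> x else 0)" for x
  define \<sigma>0 where "\<sigma>0 x = (if x \<in> T then \<sigma> x else 0)" for x
  define d where "d x = ennreal \<bar>bdet (\<tau>' x)\<bar> * indicator S x" for x
  have \<tau>0 [measurable]: "\<tau>0 \<in> borel_measurable borel" and \<sigma>0 [measurable]: "\<sigma>0 \<in> borel_measurable borel"
    unfolding \<tau>0_def \<sigma>0_def by (intro borel_measurable_open_if S T hom')+
  have [measurable]: "S \<in> sets borel" "T \<in> sets borel"
    using S T by auto
  have d [measurable]: "d \<in> borel_measurable borel"
  proof -
    have "d = (\<lambda>x. ennreal (\<bar>bdet (\<tau>' x)\<bar> * indicator S x))"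
      by (auto simp: d_def fun_eq_iff indicator_def)
    then show ?thesis
      by (simp add: borel_measurable_open_indicator[OF S] continuous_on_rabs continuous_on_bdet[OF cont])
  qed
  have inj: "inj_on \<tau> S"
    by (metis hom'(1) inj_on_inverseI)
  have "density lborel (indicator T) = distr (density lborel d) borel \<tau>0" (is "?M = ?N")
  proof (rule measure_eqI)
    fix A assume "A \<in> sets ?M"
    then have A [measurable]: "A \<in> sets borel" by simp
    let ?A = "S \<inter> \<tau>0 -` A"
    have A': "?A \<in> sets borel"
      using measurable_sets[OF \<tau>0 A] by simp
    have im: "\<tau> ` ?A = A \<inter> T"
      using hom' by (auto simp: \<tau>0_def)
    have "emeasure ?N A = (\<integral>\<^sup>+x. d x * indicator (\<tau>0 -` A) x \<partial>lborel)"
      using measurable_sets[OF \<tau>0 A] by (simp add: emeasure_distr emeasure_density)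
    also have "\<dots> = (\<integral>\<^sup>+x. ennreal \<bar>bdet (\<tau>' x)\<bar> * indicator ?A x \<partial>lborel)"
      by (intro nn_integral_cong) (auto simp: d_def indicator_def)
    also have "\<dots> = emeasure lborel (\<tau> ` ?A)"
      by (rule emeasure_diffeomorphism_image[OF S der cont inj A', symmetric]) (auto simp: im)
    also have "\<dots> = (\<integral>\<^sup>+x. indicator (A \<inter> T) x \<partial>lborel)"
      by (simp add: im)
    also have "\<dots> = (\<integral>\<^sup>+x. indicator T x * indicator A x \<partial>lborel)"
      by (intro nn_integral_cong) (auto simp: indicator_def)
    also have "\<dots> = emeasure ?M A"
      by (subst emeasure_density) auto
    finally show "emeasure ?M A = emeasure ?N A" ..
  qed simp
  then have "(\<integral>\<^sup>+y. h y \<partial>?M) = (\<integral>\<^sup>+y. h y \<partial>?N)"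
    by simp
  also have "\<dots> = (\<integral>\<^sup>+x. d x * h (\<tau>0 x) \<partial>lborel)"
    using h by (simp add: nn_integral_distr nn_integral_density)
  also have "\<dots> = (\<integral>\<^sup>+x. h (\<tau> x) * d x \<partial>lborel)"
    by (intro nn_integral_cong) (auto simp: d_def \<tau>0_def indicator_def mult.commute)
  finally show ?thesis
    using h by (simp add: nn_integral_density d_def mult.commute)
qed

section \<open>The volume measure of a submanifold\<close>

lemma image_borel_homeomorphism:
  assumes hom: "homeomorphism W V \<psi> \<phi>" and V: "openin (top_of_set S) V"
    and B: "B \<in> sets borel" "B \<subseteq> W"
  shows "\<psi> ` B \<in> sets (restrict_space borel S)"
proof -
  obtain U where U: "open U" "V = S \<inter> U"
    using V by (auto simp: openin_open)
  have "\<phi> \<in> borel_measurable (restrict_space borel V)"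
    by (rule borel_measurable_continuous_on_restrict[OF homeomorphism_cont2[OF hom]])
  from measurable_sets[OF this B(1)] obtain E where E: "E \<in> sets borel" "\<phi> -` B \<inter> V = V \<inter> E"
    by (auto simp: space_restrict_space sets_restrict_space)
  have "\<psi> ` B = \<phi> -` B \<inter> V"
    using B(2) homeomorphism_apply1[OF hom] homeomorphism_apply2[OF hom] homeomorphism_image1[OF hom]
    by (auto simp: image_iff)
  then have "\<psi> ` B = S \<inter> (U \<inter> E)"
    using E U by auto
  moreover have "U \<inter> E \<in> sets borel"
    using U E by auto
  ultimately show ?thesis
    by (auto simp: sets_restrict_space)
qed

definition param :: "('a, 'e) rchart \<Rightarrow> ('p \<Rightarrow> 'e) \<Rightarrow> 'p \<Rightarrow> 'a" where
  "param c X = rinv c \<circ> X"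

definition area_density :: "('a, 'e::euclidean_space) rchart \<Rightarrow> ('p::euclidean_space \<Rightarrow> 'e) \<Rightarrow> 'p \<Rightarrow> real" where
  "area_density c X y = sqrt (gram_det (induced_metric (rmet c) X y))"

text \<open>
  The property by which \<open>volume_measure\<close> singles out its value; the existence and uniqueness of
  such a measure have to be proved before anything can be computed with it.
\<close>

definition is_volume :: "'p::euclidean_space itself \<Rightarrow> ('a::topological_space, 'e::euclidean_space) rchart set \<Rightarrow>
    'a set \<Rightarrow> 'a measure \<Rightarrow> bool" where
  "is_volume T P S \<mu> \<longleftrightarrow> sets \<mu> = sets (restrict_space borel S) \<and>
     (\<forall>c\<in>P. \<forall>(W::'p set) X. local_param c S W X \<longrightarrow>
        (\<forall>B\<in>sets borel. B \<subseteq> W \<longrightarrow>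
           emeasure \<mu> (param c X ` B) = (\<integral>\<^sup>+ y. ennreal (area_density c X y) * indicator B y \<partial>lborel)))"

lemma volume_measure_eq_The: "volume_measure T P S = (THE \<mu>. is_volume T P S \<mu>)"
  by (simp add: volume_measure_def is_volume_def param_def area_density_def)

lemma local_paramD:
  assumes "local_param c S W X"
  shows "open W" "openin (top_of_set S) (param c X ` W)"
    "homeomorphism W (param c X ` W) (param c X) (inv_into W (param c X))"
    "inj_on (param c X) W" "continuous_on W (param c X)" "param c X ` W \<subseteq> S"
proof -
  show *: "open W" "openin (top_of_set S) (param c X ` W)"
    and h: "homeomorphism W (param c X ` W) (param c X) (inv_into W (param c X))"
    using assms by (auto simp: local_param_def param_def)
  show "inj_on (param c X) W" "continuous_on W (param c X)"
    using homeomorphism_apply1[OF h] homeomorphism_cont1[OF h] by (auto intro: inj_on_inverseI)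
  show "param c X ` W \<subseteq> S"
    using openin_imp_subset[OF *(2)] .
qed

lemma open_param_preimage:
  assumes "local_param c S W X" "openin (top_of_set S) V"
  shows "open {y \<in> W. param c X y \<in> V}"
proof -
  note lp = local_paramD[OF assms(1)]
  obtain U where U: "open U" "V = S \<inter> U"
    using assms(2) by (auto simp: openin_open)
  have "{y \<in> W. param c X y \<in> V} = W \<inter> param c X -` U"
    using lp(6) U by auto
  then show ?thesis
    using continuous_openin_preimage_gen[OF lp(5) U(1)] lp(1) by (simp add: openin_open_eq)
qed

text \<open>
  The change of parametrization from \<open>X\<close> to \<open>Y\<close> is continuously differentiable and respects the induced
  metrics on the part of the submanifold that both describe. This is all that the consistency of the
  volume densities requires, and it does not mention whether the submanifold is the base, a graph or a
  product.
\<close>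

definition smooth_transition where
  "smooth_transition c W X d D Y \<longleftrightarrow>
     (\<exists>\<tau> \<tau>'. (\<forall>y\<in>W. param c X y \<in> param d Y ` D \<longrightarrow>
          \<tau> y \<in> D \<and> param d Y (\<tau> y) = param c X y \<and> (\<tau> has_derivative \<tau>' y) (at y) \<and>
          (\<forall>v w. induced_metric (rmet c) X y v w = induced_metric (rmet d) Y (\<tau> y) (\<tau>' y v) (\<tau>' y w))) \<and>
        (\<forall>v. continuous_on {y \<in> W. param c X y \<in> param d Y ` D} (\<lambda>y. \<tau>' y v)))"

text \<open>
  The base, the graph over it and the interior of the warped product are the instances.
\<close>

locale chart_cover =
  fixes P :: "('a::topological_space, 'e::euclidean_space) rchart set" and S :: "'a set"
    and m :: nat and cc :: "nat \<Rightarrow> ('a, 'e) rchart" and D :: "nat \<Rightarrow> 'p::euclidean_space set"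
    and Y :: "nat \<Rightarrow> 'p \<Rightarrow> 'e"
  assumes chart: "j < m \<Longrightarrow> cc j \<in> P" and lp: "j < m \<Longrightarrow> local_param (cc j) S (D j) (Y j)"
    and cover: "S = (\<Union>j<m. param (cc j) (Y j) ` D j)"
    and dens: "j < m \<Longrightarrow> continuous_on (D j) (area_density (cc j) (Y j))"
    and bil: "j < m \<Longrightarrow> y \<in> D j \<Longrightarrow> bilinear (induced_metric (rmet (cc j)) (Y j) y)"
    and trans: "j < m \<Longrightarrow> c \<in> P \<Longrightarrow> local_param c S (W :: 'p set) X \<Longrightarrow> smooth_transition c W X (cc j) (D j) (Y j)"
begin

abbreviation \<psi> where "\<psi> j \<equiv> param (cc j) (Y j)"
abbreviation \<rho> where "\<rho> j \<equiv> area_density (cc j) (Y j)"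

text \<open>
  Cutting from the \<open>j\<close>-th parametrized set what earlier ones describe makes the cover disjoint.
  \<open>piece\<close> lies in parameter space, \<open>part\<close> in the submanifold, and \<open>M j\<close> is the candidate for the volume
  measure on \<open>part j\<close>.
\<close>

definition piece where "piece j = {y \<in> D j. \<forall>i<j. \<psi> j y \<notin> \<psi> i ` D i}"

definition part where "part j = \<psi> j ` piece j"

definition M where
  "M j = distr (density (restrict_space lborel (piece j)) (\<lambda>y. ennreal (\<rho> j y))) (restrict_space borel S) (\<psi> j)"

lemma part_eq: "part j = {x \<in> \<psi> j ` D j. \<forall>i<j. x \<notin> \<psi> i ` D i}"
  by (auto simp: part_def piece_def)

lemma open_image: "j < m \<Longrightarrow> openin (top_of_set S) (\<psi> j ` D j)"
  using local_paramD(2)[OF lp] .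

lemma borel_preimage_part:
  assumes "local_param c S W X" "j < m"
  shows "{y \<in> W. param c X y \<in> part j} \<in> sets borel"
proof -
  have o: "open {y \<in> W. param c X y \<in> \<psi> i ` D i}" if "i < m" for i
    using open_param_preimage[OF assms(1) open_image[OF that]] .
  have "{y \<in> W. param c X y \<in> part j} = {y \<in> W. param c X y \<in> \<psi> j ` D j} - (\<Union>i<j. {y \<in> W. param c X y \<in> \<psi> i ` D i})"
    by (auto simp: part_eq)
  moreover have "open (\<Union>i<j. {y \<in> W. param c X y \<in> \<psi> i ` D i})"
    using o assms(2) by (intro open_UN) auto
  ultimately show ?thesis
    using o[OF assms(2)] by (auto intro!: sets.Diff)
qed

lemma piece_borel: "j < m \<Longrightarrow> piece j \<in> sets borel"
proof -
  assume j: "j < m"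
  have "piece j = {y \<in> D j. \<psi> j y \<in> part j}"
    using local_paramD(4)[OF lp[OF j]] by (auto simp: part_def piece_def inj_on_def)
  then show ?thesis
    using borel_preimage_part[OF lp[OF j] j] by simp
qed

lemma piece_subset: "piece j \<subseteq> D j"
  by (auto simp: piece_def)

lemma part_borel: "j < m \<Longrightarrow> part j \<in> sets (restrict_space borel S)"
  unfolding part_def
  by (rule image_borel_homeomorphism[OF local_paramD(3)[OF lp] open_image piece_borel piece_subset]) auto

lemma part_disjoint: "i \<noteq> j \<Longrightarrow> part i \<inter> part j = {}"
  by (cases i j rule: linorder_cases) (auto simp: part_eq)

lemma part_cover: "S = (\<Union>j<m. part j)"
proof -
  have "\<exists>j<m. x \<in> part j" if "x \<in> S" for x
  proof -
    define j where "j = (LEAST j. j < m \<and> x \<in> \<psi> j ` D j)"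
    have ex: "\<exists>j. j < m \<and> x \<in> \<psi> j ` D j"
      using that cover by auto
    have "j < m \<and> x \<in> \<psi> j ` D j"
      unfolding j_def by (rule LeastI_ex[OF ex])
    moreover have "x \<notin> \<psi> i ` D i" if "i < j" for i
      using not_less_Least[of i "\<lambda>j. j < m \<and> x \<in> \<psi> j ` D j"] that \<open>j < m \<and> _\<close> by (auto simp: j_def[symmetric])
    ultimately show ?thesis
      by (auto simp: part_eq)
  qed
  moreover have "part j \<subseteq> S" if "j < m" for j
    using that cover by (auto simp: part_eq)
  ultimately show ?thesis by blast
qed

lemma \<psi>_measurable:
  assumes j: "j < m"
  shows "\<psi> j \<in> measurable (restrict_space borel (piece j)) (restrict_space borel S)"
proof (rule measurable_restrict_space2)
  show "\<psi> j \<in> space (restrict_space borel (piece j)) \<rightarrow> S"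
    using local_paramD(6)[OF lp[OF j]] piece_subset[of j] by (auto simp: space_restrict_space)
  show "\<psi> j \<in> borel_measurable (restrict_space borel (piece j))"
    by (rule borel_measurable_continuous_on_restrict[OF continuous_on_subset[OF local_paramD(5)[OF lp[OF j]] piece_subset]])
qed

lemma \<rho>_measurable:
  assumes j: "j < m"
  shows "\<rho> j \<in> borel_measurable (restrict_space borel (piece j))"
  by (rule borel_measurable_continuous_on_restrict[OF continuous_on_subset[OF dens[OF j] piece_subset]])

lemma nn_integral_M:
  assumes j: "j < m" and F: "F \<in> borel_measurable (restrict_space borel S)"
  shows "(\<integral>\<^sup>+x. F x \<partial>M j) = (\<integral>\<^sup>+y. F (\<psi> j y) * (ennreal (\<rho> j y) * indicator (piece j) y) \<partial>lborel)"
proof -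
  have s: "sets (restrict_space lborel (piece j)) = sets (restrict_space borel (piece j))"
    by (simp add: sets_restrict_space)
  have m1: "(\<lambda>y. ennreal (\<rho> j y)) \<in> borel_measurable (restrict_space lborel (piece j))"
    using \<rho>_measurable[OF j] by (simp add: measurable_cong_sets[OF s refl])
  have m2: "\<psi> j \<in> measurable (restrict_space lborel (piece j)) (restrict_space borel S)"
    using \<psi>_measurable[OF j] by (simp add: measurable_cong_sets[OF s refl])
  have m3: "\<psi> j \<in> measurable (density (restrict_space lborel (piece j)) (\<lambda>y. ennreal (\<rho> j y))) (restrict_space borel S)"
    using m2 by simp
  have "(\<integral>\<^sup>+x. F x \<partial>M j) = (\<integral>\<^sup>+y. ennreal (\<rho> j y) * F (\<psi> j y) \<partial>restrict_space lborel (piece j))"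
    unfolding M_def using F m1 measurable_compose[OF m2 F]
    by (simp add: nn_integral_distr[OF m3] nn_integral_density)
  also have "\<dots> = (\<integral>\<^sup>+y. F (\<psi> j y) * (ennreal (\<rho> j y) * indicator (piece j) y) \<partial>lborel)"
    using piece_borel[OF j] by (subst nn_integral_restrict_space) (auto simp: mult_ac)
  finally show ?thesis .
qed

lemma sets_M: "sets (M j) = sets (restrict_space borel S)"
  by (simp add: M_def)

lemma emeasure_M:
  assumes j: "j < m" and A: "A \<in> sets (restrict_space borel S)"
  shows "emeasure (M j) A = (\<integral>\<^sup>+y. ennreal (\<rho> j y) * indicator {y \<in> piece j. \<psi> j y \<in> A} y \<partial>lborel)"
proof -
  have "emeasure (M j) A = (\<integral>\<^sup>+x. indicator A x \<partial>M j)"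
    using A by (simp add: sets_M)
  also have "\<dots> = (\<integral>\<^sup>+y. indicator A (\<psi> j y) * (ennreal (\<rho> j y) * indicator (piece j) y) \<partial>lborel)"
    by (rule nn_integral_M[OF j]) (use A in auto)
  also have "\<dots> = (\<integral>\<^sup>+y. ennreal (\<rho> j y) * indicator {y \<in> piece j. \<psi> j y \<in> A} y \<partial>lborel)"
    by (intro nn_integral_cong) (auto simp: indicator_def)
  finally show ?thesis .
qed

lemma is_volume_part:
  assumes v: "is_volume TYPE('p) P S \<mu>" and j: "j < m" and A: "A \<in> sets (restrict_space borel S)"
  shows "emeasure \<mu> (part j \<inter> A) = emeasure (M j) A"
proof -
  let ?B = "{y \<in> piece j. \<psi> j y \<in> A}"
  have "?B = piece j \<inter> \<psi> j -` A"
    by auto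
  have B: "?B \<in> sets borel"
  proof -
    have "\<psi> j -` A \<inter> space (restrict_space borel (piece j)) \<in> sets (restrict_space borel (piece j))"
      using measurable_sets[OF \<psi>_measurable[OF j] A] .
    then have "?B \<in> sets (restrict_space borel (piece j))"
      by (simp add: space_restrict_space Int_commute \<open>?B = _\<close>)
    then show ?thesis
      using piece_borel[OF j] by (auto simp: sets_restrict_space)
  qed
  have BD: "?B \<subseteq> D j"
    using piece_subset by auto
  have "part j \<inter> A = \<psi> j ` ?B"
    by (auto simp: part_def)
  then have "emeasure \<mu> (part j \<inter> A) = (\<integral>\<^sup>+ y. ennreal (\<rho> j y) * indicator ?B y \<partial>lborel)"
    using v chart[OF j] lp[OF j] B BD unfolding is_volume_def by simp
  then show ?thesis
    using emeasure_M[OF j A] by simp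
qed

lemma is_volume_sum:
  assumes v: "is_volume TYPE('p) P S \<mu>" and A: "A \<in> sets (restrict_space borel S)"
  shows "emeasure \<mu> A = (\<Sum>j<m. emeasure (M j) A)"
proof -
  have sm: "sets \<mu> = sets (restrict_space borel S)"
    using v by (simp add: is_volume_def)
  have AS: "A \<subseteq> S"
    using sets.sets_into_space[OF A] by (simp add: space_restrict_space)
  have "A = (\<Union>j<m. part j \<inter> A)"
    using AS part_cover by auto
  then have "emeasure \<mu> A = emeasure \<mu> (\<Union>j<m. part j \<inter> A)"
    by simp
  also have "\<dots> = (\<Sum>j<m. emeasure \<mu> (part j \<inter> A))"
  proof (rule sum_emeasure[symmetric])
    show "(\<lambda>j. part j \<inter> A) ` {..<m} \<subseteq> sets \<mu>"
      using part_borel A by (auto simp: sm)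
    show "disjoint_family_on (\<lambda>j. part j \<inter> A) {..<m}"
      using part_disjoint by (auto simp: disjoint_family_on_def)
  qed simp
  also have "\<dots> = (\<Sum>j<m. emeasure (M j) A)"
    using is_volume_part[OF v _ A] by simp
  finally show ?thesis .
qed

text \<open>
  A volume measure is determined on each part, and there are finitely many disjoint parts.
\<close>

lemma is_volume_unique:
  assumes "is_volume TYPE('p) P S \<mu>" "is_volume TYPE('p) P S \<mu>'"
  shows "\<mu> = \<mu>'"
proof (rule measure_eqI)
  show "sets \<mu> = sets \<mu>'"
    using assms by (simp add: is_volume_def)
  fix A assume "A \<in> sets \<mu>"
  then have "A \<in> sets (restrict_space borel S)"
    using assms by (simp add: is_volume_def)
  then show "emeasure \<mu> A = emeasure \<mu>' A"
    using assms is_volume_sum by metis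
qed

definition vol where
  "vol = measure_of S (sets (restrict_space borel S)) (\<lambda>A. \<Sum>j<m. emeasure (M j) A)"

lemma sets_vol: "sets vol = sets (restrict_space borel S)"
proof -
  have "sigma_sets S (sets (restrict_space borel S)) = sets (restrict_space borel S)"
    using sets.sigma_sets_eq[of "restrict_space borel S"] by (simp add: space_restrict_space)
  moreover have "sets (restrict_space borel S) \<subseteq> Pow S"
    using sets.space_closed[of "restrict_space borel S"] by (simp add: space_restrict_space)
  ultimately show ?thesis
    by (simp add: vol_def)
qed

lemma emeasure_vol:
  assumes A: "A \<in> sets (restrict_space borel S)"
  shows "emeasure vol A = (\<Sum>j<m. emeasure (M j) A)"
proof (rule emeasure_measure_of[OF vol_def])
  show "sets (restrict_space borel S) \<subseteq> Pow S"
    using sets.space_closed[of "restrict_space borel S"] by (simp add: space_restrict_space)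
  show "A \<in> sets vol"
    using A by (simp add: sets_vol)
  show "positive (sets vol) (\<lambda>A. \<Sum>j<m. emeasure (M j) A)"
    by (simp add: positive_def)
  show "countably_additive (sets vol) (\<lambda>A. \<Sum>j<m. emeasure (M j) A)"
  proof (rule countably_additiveI)
    fix A :: "nat \<Rightarrow> 'a set"
    assume A: "range A \<subseteq> sets vol" "disjoint_family A"
    have "(\<Sum>i. \<Sum>j<m. emeasure (M j) (A i)) = (\<Sum>j<m. \<Sum>i. emeasure (M j) (A i))"
      by (rule suminf_sum) auto
    also have "\<dots> = (\<Sum>j<m. emeasure (M j) (\<Union>i. A i))"
      using A by (intro sum.cong refl suminf_emeasure) (auto simp: sets_vol sets_M)
    finally show "(\<Sum>i. \<Sum>j<m. emeasure (M j) (A i)) = (\<Sum>j<m. emeasure (M j) (\<Union>i. A i))" .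
  qed
qed

text \<open>
  On each part the glued measure has the right density in an arbitrary local parametrization:
  transport the integral by the change of parametrization, whose Jacobian is exactly the quotient of
  the two densities by \<open>gram_det_pullback\<close>.
\<close>

lemma M_param_image:
  assumes j: "j < m" and c: "c \<in> P" and lpX: "local_param c S (W :: 'p set) X" and B: "B \<in> sets borel" "B \<subseteq> W"
  defines "E \<equiv> {y \<in> B. param c X y \<in> part j}"
  shows "emeasure (M j) (param c X ` B) = (\<integral>\<^sup>+y. ennreal (area_density c X y) * indicator E y \<partial>lborel)"
    and "(\<lambda>y. ennreal (area_density c X y) * indicator E y) \<in> borel_measurable borel"
proof -
  let ?\<psi> = "param c X"
  \<comment> \<open>\<open>S1\<close> and \<open>T1\<close> are the parameters, with respect to \<open>X\<close> and to \<open>Y j\<close>, of the common part of the two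
    parametrized sets; \<open>\<sigma>\<close> will be the inverse of the change of parametrization \<open>\<tau>\<close>.\<close>
  define S1 where "S1 = {y \<in> W. ?\<psi> y \<in> \<psi> j ` D j}"
  define T1 where "T1 = {y \<in> D j. \<psi> j y \<in> ?\<psi> ` W}"
  define \<sigma> where "\<sigma> y = inv_into W ?\<psi> (\<psi> j y)" for y
  note X = local_paramD[OF lpX] and L = local_paramD[OF lp[OF j]]
  from trans[OF j c lpX] obtain \<tau> \<tau>' where
    \<tau>: "\<And>y. y \<in> S1 \<Longrightarrow> \<tau> y \<in> D j" "\<And>y. y \<in> S1 \<Longrightarrow> \<psi> j (\<tau> y) = ?\<psi> y"
      "\<And>y. y \<in> S1 \<Longrightarrow> (\<tau> has_derivative \<tau>' y) (at y)"
      "\<And>y v w. y \<in> S1 \<Longrightarrow> induced_metric (rmet c) X y v w = induced_metric (rmet (cc j)) (Y j) (\<tau> y) (\<tau>' y v) (\<tau>' y w)"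
    and \<tau>': "\<And>v. continuous_on S1 (\<lambda>y. \<tau>' y v)"
    unfolding smooth_transition_def S1_def by blast
  have S1: "open S1" and T1: "open T1"
    unfolding S1_def T1_def
    using open_param_preimage[OF lpX open_image[OF j]] open_param_preimage[OF lp[OF j] X(2)] by auto
  have E: "E \<in> sets borel"
  proof -
    have "E = B \<inter> {y \<in> W. ?\<psi> y \<in> part j}"
      using B(2) by (auto simp: E_def)
    then show ?thesis
      using borel_preimage_part[OF lpX j] B(1) by auto
  qed
  have \<sigma>: "\<sigma> y \<in> W" "?\<psi> (\<sigma> y) = \<psi> j y" if "y \<in> T1" for y
    using that f_inv_into_f[of "\<psi> j y" ?\<psi> W] inv_into_into[of "\<psi> j y" ?\<psi> W]
    by (auto simp: T1_def \<sigma>_def)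
  have st: "\<sigma> (\<tau> x) = x" "\<tau> x \<in> T1" if "x \<in> S1" for x
    using that \<tau>(1,2)[OF that] inv_into_f_f[OF X(4), of x] by (auto simp: S1_def T1_def \<sigma>_def)
  have ts: "\<tau> (\<sigma> y) = y" "\<sigma> y \<in> S1" if "y \<in> T1" for y
  proof -
    show *: "\<sigma> y \<in> S1"
      using \<sigma>[OF that] that by (auto simp: S1_def T1_def)
    show "\<tau> (\<sigma> y) = y"
      using \<tau>(1,2)[OF *] \<sigma>[OF that] that L(4) by (auto simp: T1_def dest: inj_onD)
  qed
  have c\<sigma>: "continuous_on T1 \<sigma>"
    unfolding \<sigma>_def
    by (rule continuous_on_compose2[OF homeomorphism_cont2[OF X(3)] continuous_on_subset[OF L(5)]])
       (auto simp: T1_def)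
  have c\<tau>: "continuous_on S1 \<tau>"
    using \<tau>(3) by (meson continuous_at_imp_continuous_on has_derivative_continuous)
  have hom: "homeomorphism S1 T1 \<tau> \<sigma>"
    unfolding homeomorphism_def using st ts c\<sigma> c\<tau> by (auto simp: image_iff) metis+
  have \<rho>: "area_density c X x = \<bar>bdet (\<tau>' x)\<bar> * \<rho> j (\<tau> x)" if "x \<in> S1" for x
  proof -
    have "induced_metric (rmet c) X x = (\<lambda>v w. induced_metric (rmet (cc j)) (Y j) (\<tau> x) (\<tau>' x v) (\<tau>' x w))"
      using \<tau>(4)[OF that] by (simp add: fun_eq_iff)
    then show ?thesis
      unfolding area_density_def
      by (simp only: gram_det_pullback[OF bil[OF j \<tau>(1)[OF that]], of "\<tau>' x"] real_sqrt_mult real_sqrt_abs)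
  qed
  have ES: "E \<subseteq> S1"
    using B(2) by (auto simp: E_def S1_def part_eq)
  show meas: "(\<lambda>y. ennreal (area_density c X y) * indicator E y) \<in> borel_measurable borel"
  proof -
    have "continuous_on S1 (\<lambda>x. \<bar>bdet (\<tau>' x)\<bar> * \<rho> j (\<tau> x))"
      by (intro continuous_intros continuous_on_bdet \<tau>' continuous_on_compose2[OF dens[OF j] c\<tau>]) (use \<tau>(1) in auto)
    then have "continuous_on S1 (area_density c X)"
      using \<rho> by (simp cong: continuous_on_cong)
    then have "(\<lambda>y. area_density c X y * indicator S1 y) \<in> borel_measurable borel"
      by (rule borel_measurable_open_indicator[OF S1])
    then have "(\<lambda>y. ennreal (area_density c X y * indicator S1 y) * indicator E y) \<in> borel_measurable borel"
      using E by measurable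
    also have "(\<lambda>y. ennreal (area_density c X y * indicator S1 y) * indicator E y) = (\<lambda>y. ennreal (area_density c X y) * indicator E y)"
      using ES by (auto simp: fun_eq_iff indicator_def)
    finally show ?thesis .
  qed
  define G where "G = {y \<in> T1. \<sigma> y \<in> E}"
  have G: "G \<in> sets borel"
  proof -
    have "(\<lambda>x. if x \<in> T1 then \<sigma> x else 0) \<in> borel_measurable borel"
      by (rule borel_measurable_open_if[OF T1 c\<sigma>])
    from measurable_sets[OF this E] have "T1 \<inter> (\<lambda>x. if x \<in> T1 then \<sigma> x else 0) -` E \<in> sets borel"
      using T1 by auto
    also have "T1 \<inter> (\<lambda>x. if x \<in> T1 then \<sigma> x else 0) -` E = G"
      by (auto simp: G_def)
    finally show ?thesis .
  qed
  have GD: "G \<subseteq> D j"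
    by (auto simp: G_def T1_def)
  define h where "h y = ennreal (\<rho> j y) * indicator G y" for y
  have h: "h \<in> borel_measurable borel"
  proof -
    have "(\<lambda>y. \<rho> j y * indicator (D j) y) \<in> borel_measurable borel"
      by (rule borel_measurable_open_indicator[OF L(1) dens[OF j]])
    then have "(\<lambda>y. ennreal (\<rho> j y * indicator (D j) y) * indicator G y) \<in> borel_measurable borel"
      using G by measurable
    also have "(\<lambda>y. ennreal (\<rho> j y * indicator (D j) y) * indicator G y) = h"
      using GD by (auto simp: fun_eq_iff h_def indicator_def)
    finally show ?thesis .
  qed
  have PB: "?\<psi> ` B \<in> sets (restrict_space borel S)"
    by (rule image_borel_homeomorphism[OF X(3) X(2) B])
  have Geq: "{y \<in> piece j. \<psi> j y \<in> ?\<psi> ` B} = G"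
  proof (intro set_eqI iffI)
    fix y assume y: "y \<in> {y \<in> piece j. \<psi> j y \<in> ?\<psi> ` B}"
    then have yT: "y \<in> T1"
      using B(2) by (auto simp: T1_def piece_def)
    have "\<sigma> y \<in> B"
      using y B(2) inv_into_f_f[OF X(4)] by (auto simp: \<sigma>_def)
    moreover have "?\<psi> (\<sigma> y) \<in> part j"
      using y \<sigma>[OF yT] by (auto simp: part_def)
    ultimately show "y \<in> G"
      using yT by (auto simp: G_def E_def)
  next
    fix y assume "y \<in> G"
    then have y: "y \<in> T1" "\<sigma> y \<in> B" "?\<psi> (\<sigma> y) \<in> part j"
      by (auto simp: G_def E_def)
    then have "\<psi> j y \<in> part j" "\<psi> j y \<in> ?\<psi> ` B"
      using \<sigma>[OF y(1)] by (auto simp: image_iff) metis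
    then show "y \<in> {y \<in> piece j. \<psi> j y \<in> ?\<psi> ` B}"
      using y(1) by (auto simp: piece_def part_eq T1_def)
  qed
  have "emeasure (M j) (?\<psi> ` B) = (\<integral>\<^sup>+y. h y \<partial>lborel)"
    using emeasure_M[OF j PB] by (simp add: Geq h_def)
  also have "\<dots> = (\<integral>\<^sup>+y. h y * indicator T1 y \<partial>lborel)"
    by (intro nn_integral_cong) (auto simp: h_def G_def indicator_def)
  also have "\<dots> = (\<integral>\<^sup>+x. h (\<tau> x) * (ennreal \<bar>bdet (\<tau>' x)\<bar> * indicator S1 x) \<partial>lborel)"
    by (rule nn_integral_diffeomorphism[OF S1 \<tau>(3) \<tau>' hom T1 h])
  also have "\<dots> = (\<integral>\<^sup>+y. ennreal (area_density c X y) * indicator E y \<partial>lborel)"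
  proof (rule nn_integral_cong)
    fix x
    show "h (\<tau> x) * (ennreal \<bar>bdet (\<tau>' x)\<bar> * indicator S1 x) = ennreal (area_density c X x) * indicator E x"
    proof (cases "x \<in> S1")
      case True
      have "\<tau> x \<in> G \<longleftrightarrow> x \<in> E"
        using st[OF True] by (auto simp: G_def)
      then show ?thesis
        using True by (auto simp: h_def \<rho>[OF True] indicator_def ennreal_mult' mult.commute)
    next
      case False
      then show ?thesis
        using ES by (auto simp: indicator_def)
    qed
  qed
  finally show "emeasure (M j) (?\<psi> ` B) = (\<integral>\<^sup>+y. ennreal (area_density c X y) * indicator E y \<partial>lborel)" .
qed

lemma is_volume_vol: "is_volume TYPE('p) P S vol"
  unfolding is_volume_def
proof (intro conjI ballI allI impI sets_vol)
  fix c and W :: "'p set" and X B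
  assume c: "c \<in> P" and lpX: "local_param c S W X" and B: "B \<in> sets borel" "B \<subseteq> W"
  note X = local_paramD[OF lpX]
  let ?E = "\<lambda>j. {y \<in> B. param c X y \<in> part j}"
  have PB: "param c X ` B \<in> sets (restrict_space borel S)"
    by (rule image_borel_homeomorphism[OF X(3) X(2) B])
  have "emeasure vol (param c X ` B) = (\<Sum>j<m. \<integral>\<^sup>+y. ennreal (area_density c X y) * indicator (?E j) y \<partial>lborel)"
    using M_param_image(1)[OF _ c lpX B] by (simp add: emeasure_vol[OF PB])
  also have "\<dots> = (\<integral>\<^sup>+y. (\<Sum>j<m. ennreal (area_density c X y) * indicator (?E j) y) \<partial>lborel)"
    using M_param_image(2)[OF _ c lpX B] by (intro nn_integral_sum[symmetric]) auto
  also have "\<dots> = (\<integral>\<^sup>+y. ennreal (area_density c X y) * indicator B y \<partial>lborel)"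
  proof (rule nn_integral_cong)
    fix y
    have "(\<Sum>j<m. indicator (?E j) y :: ennreal) = indicator (\<Union>j<m. ?E j) y"
      using part_disjoint by (intro indicator_UN_disjoint[symmetric]) (auto simp: disjoint_family_on_def)
    also have "(\<Union>j<m. ?E j) = B"
      using B(2) X(6) part_cover by auto
    finally show "(\<Sum>j<m. ennreal (area_density c X y) * indicator (?E j) y) = ennreal (area_density c X y) * indicator B y"
      by (simp add: sum_distrib_left[symmetric])
  qed
  finally show "emeasure vol (param c X ` B) = (\<integral>\<^sup>+ y. ennreal (area_density c X y) * indicator B y \<partial>lborel)" .
qed

lemma volume_measure_eq: "volume_measure TYPE('p) P S = vol"
  unfolding volume_measure_eq_The
  by (rule the_equality[of "is_volume TYPE('p) P S"]) (auto intro: is_volume_vol is_volume_unique)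

lemma sets_volume_measure: "sets (volume_measure TYPE('p) P S) = sets (restrict_space borel S)"
  by (simp add: volume_measure_eq sets_vol)

lemma space_volume_measure: "space (volume_measure TYPE('p) P S) = S"
  using sets_eq_imp_space_eq[OF sets_volume_measure] by (simp add: space_restrict_space)

theorem nn_integral_volume_measure:
  assumes F: "F \<in> borel_measurable (restrict_space borel S)"
  shows "(\<integral>\<^sup>+x. F x \<partial>volume_measure TYPE('p) P S) =
    (\<Sum>j<m. \<integral>\<^sup>+y. F (\<psi> j y) * (ennreal (\<rho> j y) * indicator (piece j) y) \<partial>lborel)"
proof -
  have F': "F \<in> borel_measurable vol"
    using F by (simp add: measurable_cong_sets[OF sets_vol refl])
  have pv: "part j \<in> sets vol" if "j < m" for j
    using part_borel[OF that] by (simp add: sets_vol)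
  have d: "density vol (indicator (part j)) = M j" if j: "j < m" for j
  proof (rule measure_eqI)
    fix A assume "A \<in> sets (density vol (indicator (part j)))"
    then have A: "A \<in> sets vol" by simp
    then have A': "A \<in> sets (restrict_space borel S)" by (simp add: sets_vol)
    have "emeasure (density vol (indicator (part j))) A = (\<integral>\<^sup>+x. indicator (part j) x * indicator A x \<partial>vol)"
      using A pv[OF j] by (simp add: emeasure_density)
    also have "\<dots> = (\<integral>\<^sup>+x. indicator (part j \<inter> A) x \<partial>vol)"
      by (simp add: indicator_inter_arith)
    also have "\<dots> = emeasure vol (part j \<inter> A)"
      using A pv[OF j] by simp
    also have "\<dots> = emeasure (M j) A"
      by (rule is_volume_part[OF is_volume_vol j A'])
    finally show "emeasure (density vol (indicator (part j))) A = emeasure (M j) A" .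
  qed (simp add: sets_vol sets_M)
  have "(\<integral>\<^sup>+x. F x \<partial>vol) = (\<integral>\<^sup>+x. (\<Sum>j<m. indicator (part j) x * F x) \<partial>vol)"
  proof (rule nn_integral_cong)
    fix x assume "x \<in> space vol"
    then have "x \<in> S"
      using sets_eq_imp_space_eq[OF sets_vol] by (simp add: space_restrict_space)
    have "(\<Sum>j<m. indicator (part j) x :: ennreal) = indicator (\<Union>j<m. part j) x"
      using part_disjoint by (intro indicator_UN_disjoint[symmetric]) (auto simp: disjoint_family_on_def)
    also have "\<dots> = 1"
      using \<open>x \<in> S\<close> part_cover by auto
    finally show "F x = (\<Sum>j<m. indicator (part j) x * F x)"
      by (simp add: sum_distrib_right[symmetric])
  qed
  also have "\<dots> = (\<Sum>j<m. \<integral>\<^sup>+x. indicator (part j) x * F x \<partial>vol)"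
    using F' pv by (intro nn_integral_sum) auto
  also have "\<dots> = (\<Sum>j<m. \<integral>\<^sup>+x. F x \<partial>M j)"
    using F' pv by (intro sum.cong refl) (simp add: nn_integral_density[symmetric] d)
  also have "\<dots> = (\<Sum>j<m. \<integral>\<^sup>+y. F (\<psi> j y) * (ennreal (\<rho> j y) * indicator (piece j) y) \<partial>lborel)"
    using nn_integral_M[OF _ F] by simp
  finally show ?thesis
    by (simp add: volume_measure_eq)
qed

end

section \<open>Continuously differentiable functions\<close>

text \<open>
  Continuity of the derivative is required in each fixed direction, which in finite dimension is
  equivalent to continuity in operator norm and matches the recursion in \<open>cont_diff_on\<close>.
\<close>

definition C1 :: "'e::euclidean_space set \<Rightarrow> ('e \<Rightarrow> 'b::real_normed_vector) \<Rightarrow> bool" where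
  "C1 S f \<longleftrightarrow> (\<forall>x\<in>S. f differentiable (at x)) \<and> (\<forall>v. continuous_on S (\<lambda>x. frechet_derivative f (at x) v))"

lemma C1I:
  assumes "\<And>x. x \<in> S \<Longrightarrow> (f has_derivative f' x) (at x)" "\<And>v. continuous_on S (\<lambda>x. f' x v)"
  shows "C1 S f"
proof -
  have "frechet_derivative f (at x) = f' x" if "x \<in> S" for x
    using frechet_derivative_at[OF assms(1)[OF that]] by simp
  then have "continuous_on S (\<lambda>x. frechet_derivative f (at x) v)" for v
    using assms(2)[of v] by (simp cong: continuous_on_cong)
  then show ?thesis
    using assms(1) by (auto simp: C1_def differentiable_def)
qed

lemma C1_has_derivative: "C1 S f \<Longrightarrow> x \<in> S \<Longrightarrow> (f has_derivative frechet_derivative f (at x)) (at x)"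
  by (simp add: C1_def frechet_derivative_works[symmetric])

lemma C1_continuous_derivative: "C1 S f \<Longrightarrow> continuous_on S (\<lambda>x. frechet_derivative f (at x) v)"
  by (simp add: C1_def)

lemma C1_continuous_on: "C1 S f \<Longrightarrow> continuous_on S f"
  by (meson C1_has_derivative continuous_at_imp_continuous_on has_derivative_continuous)

lemma C1_subset: "C1 S f \<Longrightarrow> T \<subseteq> S \<Longrightarrow> C1 T f"
  by (auto simp: C1_def intro: continuous_on_subset)

lemma C1_cong:
  assumes "open S" "\<And>x. x \<in> S \<Longrightarrow> f x = g x" "C1 S f"
  shows "C1 S g"
proof (rule C1I[where f' = "\<lambda>x. frechet_derivative f (at x)"])
  fix x assume x: "x \<in> S"
  show "(g has_derivative frechet_derivative f (at x)) (at x)"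
    by (rule has_derivative_transform_within_open[OF C1_has_derivative[OF assms(3) x] assms(1) x]) (rule assms(2))
qed (rule C1_continuous_derivative[OF assms(3)])

lemma C1_Un:
  assumes "open S" "open T" "C1 S f" "C1 T f"
  shows "C1 (S \<union> T) f"
  using assms by (auto simp: C1_def intro!: continuous_on_open_Un)

lemma C1_const: "C1 S (\<lambda>x. c)"
  by (rule C1I[where f' = "\<lambda>_ _. 0"]) auto

lemma C1_add: "C1 S f \<Longrightarrow> C1 S g \<Longrightarrow> C1 S (\<lambda>x. f x + g x)"
  by (rule C1I[where f' = "\<lambda>x v. frechet_derivative f (at x) v + frechet_derivative g (at x) v"])
    (auto intro!: has_derivative_add C1_has_derivative continuous_on_add C1_continuous_derivative)

lemma C1_linear: "bounded_linear h \<Longrightarrow> C1 S f \<Longrightarrow> C1 S (\<lambda>x. h (f x))"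
  by (rule C1I[where f' = "\<lambda>x v. h (frechet_derivative f (at x) v)"])
    (auto intro!: bounded_linear.has_derivative[of h] C1_has_derivative bounded_linear.continuous_on[of h] C1_continuous_derivative)

lemma C1_scaleR:
  assumes "C1 S (f :: _ \<Rightarrow> real)" "C1 S g" shows "C1 S (\<lambda>x. f x *\<^sub>R g x)"
  by (rule C1I[where f' = "\<lambda>x v. f x *\<^sub>R frechet_derivative g (at x) v + frechet_derivative f (at x) v *\<^sub>R g x"])
    (use assms in \<open>auto intro!: has_derivative_scaleR C1_has_derivative continuous_on_add continuous_on_scaleR
      C1_continuous_derivative C1_continuous_on[OF assms(1)] C1_continuous_on[OF assms(2)]\<close>)

lemma C1_mult: "C1 S f \<Longrightarrow> C1 S g \<Longrightarrow> C1 S (\<lambda>x. f x * g x :: real)"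
  using C1_scaleR[of S f g] by simp

lemma C1_sum: "(\<And>i. i \<in> I \<Longrightarrow> C1 S (f i)) \<Longrightarrow> C1 S (\<lambda>x. \<Sum>i\<in>I. f i x)"
  by (induction I rule: infinite_finite_induct) (auto intro: C1_const C1_add)

lemma C1_prod: "(\<And>i. i \<in> I \<Longrightarrow> C1 S (f i)) \<Longrightarrow> C1 S (\<lambda>x. \<Prod>i\<in>I. f i x :: real)"
  by (induction I rule: infinite_finite_induct) (auto intro: C1_const C1_mult)

lemma C1_compose:
  fixes f :: "'e::euclidean_space \<Rightarrow> 'f::euclidean_space"
  assumes g: "C1 T g" and f: "C1 S f" and fS: "\<And>x. x \<in> S \<Longrightarrow> f x \<in> T"
  shows "C1 S (\<lambda>x. g (f x))"
proof (rule C1I[where f' = "\<lambda>x v. frechet_derivative g (at (f x)) (frechet_derivative f (at x) v)"])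
  fix x assume x: "x \<in> S"
  show "((\<lambda>x. g (f x)) has_derivative (\<lambda>v. frechet_derivative g (at (f x)) (frechet_derivative f (at x) v))) (at x)"
    by (rule has_derivative_compose[OF C1_has_derivative[OF f x] C1_has_derivative[OF g fS[OF x]]])
next
  fix v
  have "frechet_derivative g (at (f x)) (frechet_derivative f (at x) v)
      = (\<Sum>b\<in>Basis. (frechet_derivative f (at x) v \<bullet> b) *\<^sub>R frechet_derivative g (at (f x)) b)" if "x \<in> S" for x
  proof -
    have lin: "linear (frechet_derivative g (at (f x)))"
      using C1_has_derivative[OF g fS[OF that]] has_derivative_linear by blast
    have "frechet_derivative g (at (f x)) (frechet_derivative f (at x) v)
       = frechet_derivative g (at (f x)) (\<Sum>b\<in>Basis. (frechet_derivative f (at x) v \<bullet> b) *\<^sub>R b)"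
      by (simp add: euclidean_representation)
    then show ?thesis
      by (simp add: linear_sum[OF lin] linear_cmul[OF lin])
  qed
  moreover have "continuous_on S (\<lambda>x. \<Sum>b\<in>Basis. (frechet_derivative f (at x) v \<bullet> b) *\<^sub>R frechet_derivative g (at (f x)) b)"
    by (intro continuous_intros C1_continuous_derivative[OF f]
        continuous_on_compose2[OF C1_continuous_derivative[OF g] C1_continuous_on[OF f]]) (use fS in auto)
  ultimately show "continuous_on S (\<lambda>x. frechet_derivative g (at (f x)) (frechet_derivative f (at x) v))"
    by (simp cong: continuous_on_cong)
qed

lemma C1_real:
  assumes "\<And>r. r \<in> T \<Longrightarrow> (\<phi> has_real_derivative \<phi>' r) (at r)" "continuous_on T \<phi>'"
  shows "C1 T \<phi>"
  by (rule C1I[where f' = "\<lambda>r h. \<phi>' r * h"])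
    (use assms in \<open>auto simp: has_field_derivative_def intro!: continuous_intros\<close>)

lemma C1_inverse:
  assumes "C1 S f" "\<And>x. x \<in> S \<Longrightarrow> f x \<noteq> (0::real)"
  shows "C1 S (\<lambda>x. inverse (f x))"
  by (rule C1_compose[where g = inverse and T = "- {0}" , OF C1_real[where \<phi>' = "\<lambda>x. - inverse (x\<^sup>2)"] assms(1)])
    (use assms(2) in \<open>auto intro!: derivative_eq_intros continuous_intros simp: power2_eq_square\<close>)

lemma C1_divide:
  "C1 S f \<Longrightarrow> C1 S g \<Longrightarrow> (\<And>x. x \<in> S \<Longrightarrow> g x \<noteq> (0::real)) \<Longrightarrow> C1 S (\<lambda>x. f x / g x)"
  unfolding divide_inverse by (intro C1_mult C1_inverse)

lemma C1_sqrt: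
  assumes "C1 S f" "\<And>x. x \<in> S \<Longrightarrow> f x > 0"
  shows "C1 S (\<lambda>x. sqrt (f x))"
  by (rule C1_compose[where g = sqrt and T = "{0<..}", OF C1_real[where \<phi>' = "\<lambda>x. inverse (sqrt x) / 2"] assms(1)])
    (use assms(2) in \<open>auto intro!: DERIV_real_sqrt continuous_intros simp: power2_eq_square\<close>)

lemma C1_power: "C1 S f \<Longrightarrow> C1 S (\<lambda>x. f x ^ k :: real)"
  by (induction k) (auto intro: C1_const C1_mult)

lemma C1_gram_det:
  assumes "\<And>b c. b \<in> Basis \<Longrightarrow> c \<in> Basis \<Longrightarrow> C1 S (\<lambda>x. g x b c)"
  shows "C1 S (\<lambda>x. gram_det (g x :: 'p::euclidean_space \<Rightarrow> _))"
  unfolding gram_det_def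
  by (intro C1_sum C1_mult C1_const C1_prod assms) (auto simp: permutes_in_image)

lemma C1_det:
  assumes "\<And>i j. C1 S (\<lambda>x. A x $ i $ j)"
  shows "C1 S (\<lambda>x. det (A x :: real ^ 'n ^ 'n))"
  unfolding det_def by (intro C1_sum C1_mult C1_const C1_prod assms)

lemma C1_vec:
  assumes "\<And>k. C1 S (\<lambda>x. f x $ k)"
  shows "C1 S (f :: _ \<Rightarrow> real ^ 'n)"
proof -
  have "f = (\<lambda>x. \<Sum>k\<in>UNIV. f x $ k *\<^sub>R axis k 1)"
    by (auto simp: vec_eq_iff axis_def fun_eq_iff if_distrib cong: if_cong)
  moreover have "C1 S (\<lambda>x. \<Sum>k\<in>UNIV. f x $ k *\<^sub>R (axis k 1 :: real ^ 'n))"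
    by (intro C1_sum C1_scaleR assms C1_const)
  ultimately show ?thesis by simp
qed

lemma smooth_on_C1:
  assumes "smooth_on S f"
  shows "C1 S f" "C1 S (\<lambda>x. frechet_derivative f (at x) v)"
proof -
  have c: "cont_diff_on (Suc 0) S f" "cont_diff_on (Suc (Suc 0)) S f"
    using assms by (auto simp: smooth_on_def)
  then show "C1 S f"
    by (simp add: C1_def)
  from c(2) have "cont_diff_on (Suc 0) S (\<lambda>x. frechet_derivative f (at x) v)"
    by (simp only: cont_diff_on.simps) blast
  then show "C1 S (\<lambda>x. frechet_derivative f (at x) v)"
    by (simp add: C1_def)
qed

section \<open>The divergence theorem for compactly supported fields\<close>

lemma compact_support_integrable:
  fixes f :: "'p::euclidean_space \<Rightarrow> real"
  assumes "continuous_on UNIV f" "compact K" "\<And>x. x \<notin> K \<Longrightarrow> f x = 0"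
  shows "integrable lborel f"
proof -
  have "integrable lborel (\<lambda>x. indicator K x *\<^sub>R f x)"
    by (rule borel_integrable_compact[OF assms(2) continuous_on_subset[OF assms(1)]]) auto
  moreover have "(\<lambda>x. indicator K x *\<^sub>R f x) = f"
    using assms(3) by (auto simp: fun_eq_iff indicator_def)
  ultimately show ?thesis by simp
qed

text \<open>
  Difference quotients of $f$ have integral zero by translation invariance, and they converge
  dominatedly to the derivative. This treats all directions alike and avoids iterated integrals.
\<close>

lemma integral_directional_derivative_zero:
  fixes f :: "'p::euclidean_space \<Rightarrow> real"
  assumes f: "C1 UNIV f" and K: "compact K" and zero: "\<And>x. x \<notin> K \<Longrightarrow> f x = 0"
  shows "integrable lborel (\<lambda>x. frechet_derivative f (at x) v)"
    and "(\<integral>x. frechet_derivative f (at x) v \<partial>lborel) = 0"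
proof -
  define d where "d x = frechet_derivative f (at x) v" for x
  have dc: "continuous_on UNIV d"
    unfolding d_def by (rule C1_continuous_derivative[OF f])
  have fc: "continuous_on UNIV f"
    by (rule C1_continuous_on[OF f])
  have der: "(f has_derivative frechet_derivative f (at x)) (at x)" for x
    by (rule C1_has_derivative[OF f]) simp
  have d0: "d x = 0" if "x \<notin> K" for x
  proof -
    have "(f has_derivative (\<lambda>_. 0)) (at x)"
      by (rule has_derivative_transform_within_open[of "\<lambda>_. 0" _ x UNIV "- K"])
        (use that zero K in \<open>auto simp: compact_imp_closed\<close>)
    from frechet_derivative_at[OF this] show ?thesis
      by (simp add: d_def fun_eq_iff)
  qed
  show "integrable lborel (\<lambda>x. frechet_derivative f (at x) v)"
    using compact_support_integrable[OF dc K d0] by (simp add: d_def[abs_def])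
  have fi: "integrable lborel f"
    by (rule compact_support_integrable[OF fc K zero])
  obtain C where C: "\<And>x. \<bar>d x\<bar> \<le> C" "C \<ge> 0"
  proof -
    have "bounded (d ` K)"
      by (intro compact_imp_bounded compact_continuous_image continuous_on_subset[OF dc] K) auto
    then obtain C where "\<And>x. x \<in> K \<Longrightarrow> \<bar>d x\<bar> \<le> C"
      by (auto simp: bounded_iff)
    then have "\<bar>d x\<bar> \<le> max C 0" for x
      using d0[of x] by (cases "x \<in> K") (auto simp: le_max_iff_disj)
    then show ?thesis
      using that[of "max C 0"] by auto
  qed
  obtain R where R: "\<And>x. x \<in> K \<Longrightarrow> norm x \<le> R"
    using compact_imp_bounded[OF K] by (auto simp: bounded_iff)
  define h where "h k x = (f (x + (1 / real (Suc k)) *\<^sub>R v) - f x) * real (Suc k)" for k x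
  have line: "((\<lambda>s. f (x + s *\<^sub>R v)) has_real_derivative d (x + s *\<^sub>R v)) (at s)" for x s
  proof -
    have "((\<lambda>s. x + s *\<^sub>R v) has_derivative (\<lambda>h. h *\<^sub>R v)) (at s)"
      by (auto intro!: derivative_eq_intros)
    from has_derivative_compose[OF this der]
    have "((\<lambda>s. f (x + s *\<^sub>R v)) has_derivative (\<lambda>h. frechet_derivative f (at (x + s *\<^sub>R v)) (h *\<^sub>R v))) (at s)" .
    moreover have "frechet_derivative f (at (x + s *\<^sub>R v)) (h *\<^sub>R v) = d (x + s *\<^sub>R v) * h" for h
      using linear_cmul[OF has_derivative_linear[OF der]] by (simp add: d_def)
    ultimately show ?thesis
      by (simp add: has_field_derivative_def)
  qed
  have lim: "(\<lambda>k. h k x) \<longlonglongrightarrow> d x" for x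
  proof -
    have "((\<lambda>s. (f (x + s *\<^sub>R v) - f x) / s) \<longlongrightarrow> d x) (at 0)"
      using line[of x 0] by (simp add: has_field_derivative_iff)
    moreover have "filterlim (\<lambda>k. 1 / real (Suc k)) (at 0) sequentially"
      unfolding filterlim_at using LIMSEQ_inverse_real_of_nat by (simp add: divide_inverse)
    ultimately have "(\<lambda>k. (f (x + (1 / real (Suc k)) *\<^sub>R v) - f x) / (1 / real (Suc k))) \<longlonglongrightarrow> d x"
      by (rule filterlim_compose)
    then show ?thesis
      by (simp add: h_def)
  qed
  have bound: "\<bar>h k x\<bar> \<le> C * indicator (cball 0 (R + norm v)) x" for k x
  proof -
    let ?t = "1 / real (Suc k)"
    have t: "0 < ?t" "?t \<le> 1" by auto
    show ?thesis
    proof (cases "x \<in> cball 0 (R + norm v)")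
      case True
      obtain s where "f (x + ?t *\<^sub>R v) - f (x + 0 *\<^sub>R v) = (?t - 0) * d (x + s *\<^sub>R v)"
        using MVT2[of 0 ?t "\<lambda>s. f (x + s *\<^sub>R v)" "\<lambda>s. d (x + s *\<^sub>R v)"] line t by auto
      then have "h k x = d (x + s *\<^sub>R v)"
        by (simp add: h_def)
      then show ?thesis
        using True C by simp
    next
      case False
      have "x \<notin> K"
        using False R[of x] by (auto simp: add.commute intro: order_trans add_increasing)
      moreover have "x + ?t *\<^sub>R v \<notin> K"
      proof
        assume "x + ?t *\<^sub>R v \<in> K"
        then have "norm (x + ?t *\<^sub>R v) \<le> R" by (rule R)
        moreover have "norm x \<le> norm (x + ?t *\<^sub>R v) + norm (?t *\<^sub>R v)"
          using norm_triangle_ineq4[of "x + ?t *\<^sub>R v" "?t *\<^sub>R v"] by simp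
        moreover have "norm (?t *\<^sub>R v) \<le> norm v"
          using t mult_right_mono[of ?t 1 "norm v"] by simp
        ultimately show False
          using False by (simp del: of_nat_Suc)
      qed
      ultimately show ?thesis
        using zero False by (simp add: h_def)
    qed
  qed
  have int0: "(\<integral>x. h k x \<partial>lborel) = 0" for k
  proof -
    let ?w = "(1 / real (Suc k)) *\<^sub>R v"
    have m: "(+) ?w \<in> measurable lborel borel"
      by simp
    have fb: "f \<in> borel_measurable borel"
      using fc by (rule borel_measurable_continuous_onI)
    have "integrable (distr lborel borel ((+) ?w)) f"
      using fi by (simp add: lborel_distr_plus)
    then have i: "integrable lborel (\<lambda>x. f (?w + x))"
      by (subst (asm) integrable_distr_eq[OF m fb])
    have "(\<integral>x. f x \<partial>lborel) = (\<integral>x. f x \<partial>distr lborel borel ((+) ?w))"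
      by (simp add: lborel_distr_plus)
    also have "\<dots> = (\<integral>x. f (?w + x) \<partial>lborel)"
      by (rule integral_distr[OF m fb])
    finally have "(\<integral>x. f (?w + x) \<partial>lborel) = (\<integral>x. f x \<partial>lborel)" ..
    then show ?thesis
      using i fi by (simp add: h_def add.commute del: of_nat_Suc)
  qed
  have "(\<lambda>k. \<integral>x. h k x \<partial>lborel) \<longlonglongrightarrow> (\<integral>x. d x \<partial>lborel)"
  proof (rule integral_dominated_convergence[where w = "\<lambda>x. C * indicator (cball 0 (R + norm v)) x"])
    show "h k \<in> borel_measurable lborel" for k
    proof -
      have "continuous_on UNIV (h k)"
        unfolding h_def by (intro continuous_intros continuous_on_compose2[OF fc]) auto
      then show ?thesis
        using borel_measurable_continuous_onI by simp
    qed
    show "d \<in> borel_measurable lborel"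
      using borel_measurable_continuous_onI[OF dc] by simp
    show "integrable lborel (\<lambda>x. C * indicator (cball 0 (R + norm v)) (x :: 'p))"
      using emeasure_lborel_cball_finite[of "0 :: 'p" "R + norm v"] by (intro integrable_mult_right) auto
  qed (use lim bound in auto)
  then show "(\<integral>x. frechet_derivative f (at x) v \<partial>lborel) = 0"
    by (simp add: int0 LIMSEQ_const_iff d_def)
qed

text \<open>
  The open set and the complement of the compact set cover the space, and the extension is of class
  $C^1$ on each of them.
\<close>

lemma C1_extend_zero:
  assumes "open U" "compact K" "K \<subseteq> U" "C1 U f" "\<And>x. x \<in> U - K \<Longrightarrow> f x = 0"
  shows "C1 UNIV (\<lambda>x. if x \<in> U then f x else 0)"
proof -
  have "C1 U (\<lambda>x. if x \<in> U then f x else 0)"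
    by (rule C1_cong[OF assms(1) _ assms(4)]) simp
  moreover have "C1 (- K) (\<lambda>x. if x \<in> U then f x else 0)"
    by (rule C1_cong[OF _ _ C1_const[of _ 0]]) (use assms in \<open>auto simp: compact_imp_closed\<close>)
  moreover have "U \<union> - K = UNIV"
    using assms(3) by auto
  ultimately show ?thesis
    using C1_Un[of U "- K"] assms by (metis compact_imp_closed open_Compl)
qed

theorem integral_divergence_zero:
  fixes Z :: "'p::euclidean_space \<Rightarrow> 'p \<Rightarrow> real"
  assumes U: "open U" and K: "compact K" "K \<subseteq> U"
    and Z: "\<And>b. b \<in> Basis \<Longrightarrow> C1 U (Z b)" "\<And>b x. b \<in> Basis \<Longrightarrow> x \<in> U - K \<Longrightarrow> Z b x = 0"
  shows "integrable lborel (\<lambda>x. indicator U x * (\<Sum>b\<in>Basis. frechet_derivative (Z b) (at x) b))"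
    and "(\<integral>x. indicator U x * (\<Sum>b\<in>Basis. frechet_derivative (Z b) (at x) b) \<partial>lborel) = 0"
proof -
  define E where "E b x = (if x \<in> U then Z b x else 0)" for b x
  have E: "C1 UNIV (E b)" if "b \<in> Basis" for b
    unfolding E_def by (rule C1_extend_zero[OF U K Z(1)[OF that]]) (use Z(2)[OF that] in auto)
  have E0: "E b x = 0" if "b \<in> Basis" "x \<notin> K" for b x
    using Z(2)[of b x] that by (auto simp: E_def)
  have eq: "frechet_derivative (E b) (at x) b = indicator U x * frechet_derivative (Z b) (at x) b" if b: "b \<in> Basis" for b x
  proof (cases "x \<in> U")
    case True
    have "(E b has_derivative frechet_derivative (Z b) (at x)) (at x)"
      by (rule has_derivative_transform_within_open[OF C1_has_derivative[OF Z(1)[OF b] True] U True]) (simp add: E_def)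
    from frechet_derivative_at[OF this, symmetric] show ?thesis
      using True by simp
  next
    case False
    have "(E b has_derivative (\<lambda>_. 0)) (at x)"
      by (rule has_derivative_transform_within_open[of "\<lambda>_. 0" _ x UNIV "- K"])
        (use False K E0[OF b] in \<open>auto simp: compact_imp_closed\<close>)
    from frechet_derivative_at[OF this, symmetric] show ?thesis
      using False by simp
  qed
  have "(\<lambda>x. indicator U x * (\<Sum>b\<in>Basis. frechet_derivative (Z b) (at x) b))
      = (\<lambda>x. \<Sum>b\<in>Basis. frechet_derivative (E b) (at x) b)"
    by (simp add: eq sum_distrib_left)
  then show "integrable lborel (\<lambda>x. indicator U x * (\<Sum>b\<in>Basis. frechet_derivative (Z b) (at x) b))"
    and "(\<integral>x. indicator U x * (\<Sum>b\<in>Basis. frechet_derivative (Z b) (at x) b) \<partial>lborel) = 0"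
    using integral_directional_derivative_zero[OF E K(1) E0] by simp_all
qed

section \<open>The graph of a function in one chart\<close>

lemma deriv_eq_frechet:
  fixes f :: "real \<Rightarrow> real"
  assumes "f differentiable (at x)"
  shows "frechet_derivative f (at x) h = deriv f x * h" "(f has_real_derivative deriv f x) (at x)"
proof -
  have d: "(f has_derivative frechet_derivative f (at x)) (at x)"
    using assms frechet_derivative_works by blast
  have lin: "frechet_derivative f (at x) h = frechet_derivative f (at x) 1 * h" for h
    using linear_cmul[OF has_derivative_linear[OF d], of h 1] by (simp add: mult.commute)
  have "(f has_real_derivative frechet_derivative f (at x) 1) (at x)"
    using d unfolding has_field_derivative_def
    by (metis (no_types, lifting) ext lin)
  then have *: "deriv f x = frechet_derivative f (at x) 1"
    by (rule DERIV_imp_deriv)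
  show "frechet_derivative f (at x) h = deriv f x * h"
    using lin[of h] * by simp
  show "(f has_real_derivative deriv f x) (at x)"
    using * \<open>(f has_real_derivative frechet_derivative f (at x) 1) (at x)\<close> by simp
qed

text \<open>
  The graph of \<open>U\<close> over the image \<open>O'\<close> of one chart of the base, in which the metric of the base is \<open>g\<close>.
\<close>

locale graph_in_chart =
  fixes O' :: "(real ^ 'n) set" and g :: "real ^ 'n \<Rightarrow> real ^ 'n \<Rightarrow> real ^ 'n \<Rightarrow> real"
    and U :: "real ^ 'n \<Rightarrow> real" and lam :: "real \<Rightarrow> real" and a :: real
  assumes O': "open O'" and gpos: "\<And>y. y \<in> O' \<Longrightarrow> positive_inner (g y)"
    and gsm: "\<And>v w. smooth_on O' (\<lambda>y. g y v w)" and Usm: "smooth_on O' U"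
    and Ua: "\<And>y. y \<in> O' \<Longrightarrow> a < U y" and lsm: "smooth_on {a<..} lam"
    and lpos: "\<And>r. a < r \<Longrightarrow> lam r > 0"
begin

text \<open>
  \<open>z\<close> is the gradient of \<open>U\<close> and \<open>Q\<close> its squared length; \<open>Gm\<close> is the metric of the warped product,
  \<open>X\<close> the graph, \<open>\<nu>\<close> its unit normal with positive \<open>r\<close>-component and \<open>H\<close> its mean curvature. The normal is
  proportional to $\partial_r-\lambda^{-2}z$, since the product of this vector with a tangent vector
  $(dU(v),v)$ is $dU(v)-g(z,v)=0$.
\<close>

definition "dU y v = frechet_derivative U (at y) v"
definition "D2U y v w = frechet_derivative (\<lambda>y. dU y w) (at y) v"
definition "Dg y v w1 w2 = frechet_derivative (\<lambda>y. g y w1 w2) (at y) v"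
definition "z y = sharp (g y) (dU y)"
definition "Dz y v = frechet_derivative z (at y) v"
definition "Q y = dU y (z y)"
definition "s y = (lam (U y))\<^sup>2 + Q y"
definition "G y = gram_det (g y)"

definition Gm :: "real \<times> (real ^ 'n) \<Rightarrow> real \<times> (real ^ 'n) \<Rightarrow> real \<times> (real ^ 'n) \<Rightarrow> real" where
  "Gm = (\<lambda>(r, x) (s, v) (t, w). s * t + (lam r)\<^sup>2 * g x v w)"
definition "X y = (U y, y)"
definition "\<nu> y = (lam (U y) / sqrt (s y)) *\<^sub>R (1::real, - (1 / (lam (U y))\<^sup>2) *\<^sub>R z y)"
definition "H y = mean_curvature Gm X (\<nu> y) y"

lemma C1_g: "C1 O' (\<lambda>y. g y v w)" and C1_U: "C1 O' U" and C1_dU: "C1 O' (\<lambda>y. dU y v)"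
  and C1_lam: "C1 {a<..} lam"
  unfolding dU_def using smooth_on_C1 gsm Usm lsm by blast+

lemma glin: "y \<in> O' \<Longrightarrow> linear (g y v)" "y \<in> O' \<Longrightarrow> linear (\<lambda>v. g y v w)"
  using positive_inner_linear[OF gpos] by auto

lemma gsym: "y \<in> O' \<Longrightarrow> g y v w = g y w v"
  using positive_inner_sym[OF gpos] .

lemma dU_has: "y \<in> O' \<Longrightarrow> (U has_derivative dU y) (at y)"
  using C1_has_derivative[OF C1_U] by (simp add: dU_def[abs_def])

lemma dU_lin: "y \<in> O' \<Longrightarrow> linear (dU y)"
  using dU_has has_derivative_linear by blast

lemma D2U_has: "y \<in> O' \<Longrightarrow> ((\<lambda>y. dU y w) has_derivative (\<lambda>v. D2U y v w)) (at y)"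
  using C1_has_derivative[OF C1_dU] by (simp add: D2U_def[abs_def])

lemma Dg_has: "y \<in> O' \<Longrightarrow> ((\<lambda>y. g y w1 w2) has_derivative (\<lambda>v. Dg y v w1 w2)) (at y)"
  using C1_has_derivative[OF C1_g] by (simp add: Dg_def[abs_def])

lemma Dg_lin1: "y \<in> O' \<Longrightarrow> linear (\<lambda>v. Dg y v w1 w2)"
  using Dg_has has_derivative_linear by blast

lemma Dg_eqI:
  assumes y: "y \<in> O'" and eq: "\<And>x. x \<in> O' \<Longrightarrow> f x = g x w1 w2" and f: "(f has_derivative f') (at y)"
  shows "Dg y v w1 w2 = f' v"
proof -
  have "((\<lambda>y. g y w1 w2) has_derivative f') (at y)"
    by (rule has_derivative_transform_within_open[OF f O' y eq])
  from fun_cong[OF has_derivative_unique[OF Dg_has[OF y] this], of v] show ?thesis .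
qed

lemma Dg_sym: "y \<in> O' \<Longrightarrow> Dg y v w1 w2 = Dg y v w2 w1"
  by (rule Dg_eqI[OF _ gsym Dg_has])

lemma Dg_lin2: "y \<in> O' \<Longrightarrow> linear (\<lambda>w1. Dg y v w1 w2)"
proof (rule linearI)
  fix w w' and c :: real assume y: "y \<in> O'"
  show "Dg y v (w + w') w2 = Dg y v w w2 + Dg y v w' w2"
    by (rule Dg_eqI[OF y _ has_derivative_add[OF Dg_has Dg_has]]) (use y in \<open>auto simp: linear_add[OF glin(2)]\<close>)
  show "Dg y v (c *\<^sub>R w) w2 = c *\<^sub>R Dg y v w w2"
    unfolding real_scaleR_def
    by (rule Dg_eqI[OF y _ has_derivative_mult_right[OF Dg_has]]) (use y in \<open>auto simp: linear_cmul[OF glin(2)]\<close>)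
qed

lemma Dg_lin3:
  assumes y: "y \<in> O'"
  shows "linear (\<lambda>w2. Dg y v w1 w2)"
proof -
  have "(\<lambda>w2. Dg y v w1 w2) = (\<lambda>w2. Dg y v w2 w1)"
    by (rule ext) (rule Dg_sym[OF y])
  then show ?thesis
    using Dg_lin2[OF y] by simp
qed

lemma Dg_bilinear: "y \<in> O' \<Longrightarrow> bilinear (Dg y v)"
  and Dg_bilinear': "y \<in> O' \<Longrightarrow> bilinear (\<lambda>v w. Dg y v w u)"
  using Dg_lin1 Dg_lin2 Dg_lin3 by (auto simp: bilinear_def)

lemma sharp_z: "y \<in> O' \<Longrightarrow> g y (z y) w = dU y w"
  unfolding z_def by (rule sharp_apply[OF gpos dU_lin])

lemma Q_eq: "y \<in> O' \<Longrightarrow> Q y = g y (z y) (z y)"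
  by (simp add: Q_def sharp_z)

lemma Q_nonneg: "y \<in> O' \<Longrightarrow> Q y \<ge> 0"
  by (simp add: Q_eq positive_inner_nonneg[OF gpos])

lemma s_pos: "y \<in> O' \<Longrightarrow> s y > 0"
  using lpos[OF Ua] Q_nonneg by (auto simp: s_def intro!: add_pos_nonneg zero_less_power)

lemma G_pos: "y \<in> O' \<Longrightarrow> G y > 0"
  unfolding G_def by (rule gram_det_pos[OF gpos])

text \<open>
  The components of the gradient solve a linear system whose coefficients are the components of the
  metric, and right side the derivatives of \<open>U\<close>; Cramer's rule exhibits them as quotients of determinants.
\<close>

lemma C1_z: "C1 O' z"
proof (rule C1_vec)
  fix k
  define A where "A y = (\<chi> i j. g y (axis i 1) (axis j 1))" for y
  define B where "B y = (\<chi> i j. if j = k then dU y (axis i 1) else A y $ i $ j)" for y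
  have bij: "bij_betw (\<lambda>i. axis i 1) UNIV (Basis :: (real ^ 'n) set)"
    by (auto simp: bij_betw_def inj_on_def Basis_vec_def axis_eq_axis)
  have det: "det (A y) = G y" for y
    unfolding G_def A_def by (rule gram_det_reindex[OF bij, symmetric])
  have eq: "det (B y) / det (A y) = z y $ k" if y: "y \<in> O'" for y
  proof -
    have "(A y *v z y) $ i = dU y (axis i 1)" for i
    proof -
      have "(A y *v z y) $ i = g y (axis i 1) (\<Sum>j\<in>UNIV. z y $ j *\<^sub>R axis j 1)"
        by (simp add: A_def matrix_vector_mult_def linear_sum[OF glin(1)[OF y]] linear_cmul[OF glin(1)[OF y]] mult.commute)
      also have "(\<Sum>j\<in>UNIV. z y $ j *\<^sub>R axis j 1) = z y"
        using basis_expansion[of "z y"] by (simp add: scalar_mult_eq_scaleR)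
      finally show ?thesis
        using sharp_z[OF y] gsym[OF y] by simp
    qed
    then have "A y *v z y = (\<chi> i. dU y (axis i 1))"
      by (simp add: vec_eq_iff)
    moreover have "det (A y) \<noteq> 0"
      using G_pos[OF y] det by simp
    ultimately have "z y = (\<chi> k. det (\<chi> i j. if j = k then (\<chi> i. dU y (axis i 1)) $ i else A y $ i $ j) / det (A y))"
      using cramer by blast
    from arg_cong[OF this, of "\<lambda>x. x $ k"] show ?thesis
      unfolding B_def by (simp only: vec_lambda_beta)
  qed
  have "C1 O' (\<lambda>y. det (B y) / det (A y))"
  proof (intro C1_divide C1_det)
    show "C1 O' (\<lambda>x. B x $ i $ j)" for i j
      by (cases "j = k") (simp_all add: B_def A_def C1_dU C1_g)
  qed (use G_pos det in \<open>auto simp: A_def C1_g less_imp_neq[symmetric]\<close>)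
  then show "C1 O' (\<lambda>x. z x $ k)"
    by (intro C1_cong[where f = "\<lambda>y. det (B y) / det (A y)" and g = "\<lambda>y. z y $ k", OF O' eq])
qed

lemma Dz_has: "y \<in> O' \<Longrightarrow> (z has_derivative Dz y) (at y)"
  using C1_has_derivative[OF C1_z] by (simp add: Dz_def[abs_def])

lemma Dz_lin: "y \<in> O' \<Longrightarrow> linear (Dz y)"
  using Dz_has has_derivative_linear by blast

lemma linear_expand: "linear l \<Longrightarrow> l v = (\<Sum>b\<in>Basis. (v \<bullet> b) * l b)" for l :: "real ^ 'n \<Rightarrow> real"
  using linear_sum[of l "\<lambda>b. (v \<bullet> b) *\<^sub>R b" Basis] by (simp add: euclidean_representation linear_cmul)

text \<open>
  Differentiate $g(z,w)=dU(w)$ for a constant vector $w$. This replaces the Hessian of \<open>U\<close> by the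
  derivative of the gradient field, whose trace is the divergence.
\<close>

lemma gradient_derivative:
  assumes y: "y \<in> O'"
  shows "D2U y v w = g y (Dz y v) w + Dg y v (z y) w"
proof -
  have "((\<lambda>x. \<Sum>b\<in>Basis. (z x \<bullet> b) * g x b w) has_derivative
      (\<lambda>v. \<Sum>b\<in>Basis. (z y \<bullet> b) * Dg y v b w + (Dz y v \<bullet> b) * g y b w)) (at y)"
    by (intro has_derivative_sum has_derivative_mult has_derivative_inner_left Dz_has Dg_has y)
  then have "((\<lambda>y. dU y w) has_derivative (\<lambda>v. \<Sum>b\<in>Basis. (z y \<bullet> b) * Dg y v b w + (Dz y v \<bullet> b) * g y b w)) (at y)"
    by (rule has_derivative_transform_within_open[OF _ O' y])
      (simp add: sharp_z[symmetric] linear_expand[OF glin(2), symmetric])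
  from fun_cong[OF has_derivative_unique[OF D2U_has[OF y] this], of v]
  have "D2U y v w = (\<Sum>b\<in>Basis. (z y \<bullet> b) * Dg y v b w + (Dz y v \<bullet> b) * g y b w)" .
  then show ?thesis
    by (simp add: sum.distrib linear_expand[OF glin(2)[OF y], symmetric] linear_expand[OF Dg_lin2[OF y], symmetric])
qed

lemma Q_has:
  assumes y: "y \<in> O'"
  shows "(Q has_derivative (\<lambda>v. dU y (Dz y v) + D2U y v (z y))) (at y)"
proof -
  have "((\<lambda>x. \<Sum>b\<in>Basis. (z x \<bullet> b) * dU x b) has_derivative
      (\<lambda>v. \<Sum>b\<in>Basis. (z y \<bullet> b) * D2U y v b + (Dz y v \<bullet> b) * dU y b)) (at y)"
    by (intro has_derivative_sum has_derivative_mult has_derivative_inner_left Dz_has D2U_has y)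
  then have "(Q has_derivative (\<lambda>v. \<Sum>b\<in>Basis. (z y \<bullet> b) * D2U y v b + (Dz y v \<bullet> b) * dU y b)) (at y)"
    by (rule has_derivative_transform_within_open[OF _ O' y])
      (simp add: Q_def linear_expand[OF dU_lin, symmetric])
  moreover have "linear (D2U y v)" for v
    unfolding gradient_derivative[OF y, abs_def]
    by (intro linear_compose_add glin Dg_lin3 y)
  ultimately show ?thesis
    by (simp add: sum.distrib linear_expand[OF dU_lin[OF y], symmetric] linear_expand[symmetric] add.commute)
qed

abbreviation "L0 y \<equiv> lam (U y)"
abbreviation "L1 y \<equiv> deriv lam (U y)"

lemma lam_has: "a < r \<Longrightarrow> (lam has_real_derivative deriv lam r) (at r)"
  using deriv_eq_frechet(2) C1_lam by (auto simp: C1_def)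

lemma s_has:
  assumes y: "y \<in> O'"
  shows "(s has_derivative (\<lambda>v. 2 * L0 y * L1 y * dU y v + (dU y (Dz y v) + D2U y v (z y)))) (at y)"
proof -
  have "((\<lambda>y. (lam (U y))\<^sup>2) has_derivative (\<lambda>v. 2 * L0 y * L1 y * dU y v)) (at y)"
    using has_derivative_compose[OF dU_has[OF y] lam_has[OF Ua[OF y], unfolded has_field_derivative_def]]
    by (auto intro!: derivative_eq_intros)
  from has_derivative_add[OF this Q_has[OF y]] show ?thesis
    by (simp add: s_def[abs_def])
qed

lemma C1_Q: "C1 O' Q"
proof -
  have "C1 O' (\<lambda>x. \<Sum>b\<in>Basis. (z x \<bullet> b) * dU x b)"
    by (rule C1_sum, rule C1_mult[OF C1_linear[OF bounded_linear_inner_left C1_z] C1_dU])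
  moreover have "(\<Sum>b\<in>Basis. (z x \<bullet> b) * dU x b) = Q x" if "x \<in> O'" for x
    using linear_expand[OF dU_lin[OF that], of "z x"] by (simp add: Q_def)
  ultimately show ?thesis
    by (intro C1_cong[where f = "\<lambda>x. \<Sum>b\<in>Basis. (z x \<bullet> b) * dU x b" and g = Q, OF O'])
qed

lemma C1_s: "C1 O' s"
proof -
  have "C1 O' (\<lambda>x. lam (U x))"
    by (rule C1_compose[OF C1_lam C1_U]) (simp add: Ua)
  from C1_add[OF C1_power[OF this, of 2] C1_Q] show ?thesis
    by (simp add: s_def[abs_def])
qed

lemma C1_G: "C1 O' G"
  unfolding G_def[abs_def] by (rule C1_gram_det) (rule C1_g)

lemma G_has: "y \<in> O' \<Longrightarrow> (G has_derivative (\<lambda>v. G y * gtrace (g y) (Dg y v))) (at y)"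
  unfolding G_def[abs_def]
  by (rule gram_det_has_derivative[where g = g and x = y, OF gpos Dg_has Dg_bilinear])

text \<open>
  $\sqrt s\,\mathrm{div}(z/\sqrt s)$, expanded by Jacobi's formula for the derivative of $\sqrt{\det g}$.
\<close>

definition "divz y = trace_map (Dz y) + gtrace (g y) (Dg y (z y)) / 2
   - (2 * L0 y * L1 y * Q y + (dU y (Dz y (z y)) + D2U y (z y) (z y))) / (2 * s y)"

text \<open>
  The left side is the Euclidean divergence of $f\sqrt{\det g}\,z/\sqrt s$, that is, $\sqrt{\det g}$
  times the Riemannian divergence of $f\,z/\sqrt s$.
\<close>

lemma divergence_formula:
  assumes f: "C1 O' f" and y: "y \<in> O'"
  shows "(\<Sum>b\<in>Basis. frechet_derivative (\<lambda>y. f y * sqrt (G y) / sqrt (s y) * (z y \<bullet> b)) (at y) b)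
    = sqrt (G y) / sqrt (s y) * (frechet_derivative f (at y) (z y) + f y * divz y)"
proof -
  let ?f' = "frechet_derivative f (at y)"
  define Ds where "Ds v = 2 * L0 y * L1 y * dU y v + (dU y (Dz y v) + D2U y v (z y))" for v
  define m where "m y = sqrt (G y) * inverse (sqrt (s y))" for y
  define m' where "m' v = m y * (gtrace (g y) (Dg y v) / 2 - Ds v / (2 * s y))" for v
  note pos = G_pos[OF y] s_pos[OF y]
  have sD: "(s has_derivative Ds) (at y)"
    using s_has[OF y] by (simp add: Ds_def[abs_def])
  have 1: "((\<lambda>y. sqrt (G y)) has_derivative (\<lambda>v. sqrt (G y) * (gtrace (g y) (Dg y v) / 2))) (at y)"
  proof -
    have "G y * t * (inverse (sqrt (G y)) / 2) = sqrt (G y) * (t / 2)" for t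
      using pos(1) real_sqrt_mult_self[of "G y"] by (simp add: field_simps)
    with has_derivative_real_sqrt[OF pos(1) G_has[OF y]] show ?thesis
      by (simp only:)
  qed
  have 2: "((\<lambda>y. inverse (sqrt (s y))) has_derivative (\<lambda>v. - (inverse (sqrt (s y)) * (Ds v / (2 * s y))))) (at y)"
  proof -
    let ?r = "sqrt (s y)"
    have r: "?r \<noteq> 0" using pos by simp
    have "inverse ?r * (t * (inverse ?r / 2)) * inverse ?r = inverse ?r * (t / (2 * s y))" for t
      using pos(2) real_sqrt_mult_self[of "s y"] r by (simp add: field_simps)
    with Deriv.has_derivative_inverse[OF r has_derivative_real_sqrt[OF pos(2) sD]] show ?thesis
      by (simp only:)
  qed
  have m: "(m has_derivative m') (at y)"
    using has_derivative_mult[OF 1 2] by (simp add: m_def[abs_def] m'_def[abs_def] algebra_simps)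
  have f: "(f has_derivative ?f') (at y)"
    by (rule C1_has_derivative[OF assms])
  have "frechet_derivative (\<lambda>y. f y * sqrt (G y) / sqrt (s y) * (z y \<bullet> b)) (at y)
      = (\<lambda>v. (f y * m y) * (Dz y v \<bullet> b) + (f y * m' v + ?f' v * m y) * (z y \<bullet> b))" for b
  proof -
    have "((\<lambda>y. (f y * m y) * (z y \<bullet> b)) has_derivative
        (\<lambda>v. (f y * m y) * (Dz y v \<bullet> b) + (f y * m' v + ?f' v * m y) * (z y \<bullet> b))) (at y)"
      by (intro has_derivative_mult has_derivative_inner_left Dz_has f m y)
    from frechet_derivative_at[OF this, symmetric] show ?thesis
      by (simp add: m_def divide_inverse mult.assoc)
  qed
  then have "(\<Sum>b\<in>Basis. frechet_derivative (\<lambda>y. f y * sqrt (G y) / sqrt (s y) * (z y \<bullet> b)) (at y) b)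
    = (f y * m y) * trace_map (Dz y) + f y * (\<Sum>b\<in>Basis. (z y \<bullet> b) * m' b) + m y * (\<Sum>b\<in>Basis. (z y \<bullet> b) * ?f' b)"
    by (simp add: trace_map_def sum_distrib_left sum.distrib[symmetric] algebra_simps)
  also have "\<dots> = (f y * m y) * trace_map (Dz y) + f y * m' (z y) + m y * ?f' (z y)"
    by (simp add: linear_expand[OF has_derivative_linear[OF m], symmetric] linear_expand[OF has_derivative_linear[OF f], symmetric])
  also have "\<dots> = m y * (?f' (z y) + f y * divz y)"
    by (simp add: m'_def divz_def Ds_def Q_def algebra_simps)
  finally show ?thesis
    by (simp add: m_def divide_inverse)
qed

section \<open>The mean curvature of the graph\<close>

text \<open>
  The derivative of the warped metric, as it enters the Koszul formula for the Christoffel symbols.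
\<close>

definition "KG p A B C = frechet_derivative (\<lambda>p. Gm p B C) (at p) A"

lemma Gm_apply: "Gm (r, y) (h, v) (t, w) = h * t + (lam r)\<^sup>2 * g y v w"
  by (simp add: Gm_def)

lemma Gm_positive:
  assumes y: "y \<in> O'" and r: "a < r"
  shows "positive_inner (Gm (r, y))"
proof -
  have "positive_inner (\<lambda>v w. (lam r)\<^sup>2 * g y v w + 0 * (0 * 0))"
    using lpos[OF r] positive_inner_rank_one[OF gpos[OF y], of "\<lambda>_. 0" "(lam r)\<^sup>2" 0] by (simp add: linear_zero)
  from positive_inner_block[OF this] show ?thesis
    by (simp add: block_def Gm_def case_prod_beta')
qed

lemma KG_eq:
  assumes y: "y \<in> O'" and r: "a < r"
  shows "KG (r, y) (s1, v) (t1, w1) (t2, w2) = 2 * lam r * deriv lam r * s1 * g y w1 w2 + (lam r)\<^sup>2 * Dg y v w1 w2"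
proof -
  have 1: "((\<lambda>p. lam (fst p)) has_derivative (\<lambda>A. deriv lam r * fst A)) (at (r, y))"
    using has_derivative_compose[OF has_derivative_fst[OF has_derivative_ident], of lam "\<lambda>h. deriv lam r * h" "(r, y)" UNIV]
      lam_has[OF r] by (simp add: has_field_derivative_def)
  have 2: "((\<lambda>p. g (snd p) w1 w2) has_derivative (\<lambda>A. Dg y (snd A) w1 w2)) (at (r, y))"
    using has_derivative_compose[OF has_derivative_snd[OF has_derivative_ident], of "\<lambda>y. g y w1 w2" "\<lambda>v. Dg y v w1 w2" "(r, y)" UNIV]
      Dg_has[OF y] by simp
  have "((\<lambda>p. t1 * t2 + (lam (fst p))\<^sup>2 * g (snd p) w1 w2) has_derivative
     (\<lambda>A. 2 * lam r * deriv lam r * fst A * g y w1 w2 + (lam r)\<^sup>2 * Dg y (snd A) w1 w2)) (at (r, y))"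
    using 1 2 by (auto intro!: derivative_eq_intros simp: algebra_simps)
  from frechet_derivative_at[OF this, symmetric] show ?thesis
    by (simp add: KG_def Gm_def case_prod_beta')
qed

lemma christoffel_Gm:
  assumes y: "y \<in> O'" and r: "a < r"
  shows "Gm (r, y) (christoffel Gm (r, y) A B) C = (KG (r, y) A B C + KG (r, y) B A C - KG (r, y) C A B) / 2"
proof -
  have lin: "linear (\<lambda>C. (KG (r, y) A B C + KG (r, y) B A C - KG (r, y) C A B) / 2)"
  proof (rule linearI)
    fix C C' :: "real \<times> (real ^ 'n)" and c :: real
    obtain s1 v s2 w t x t' x' where e: "A = (s1, v)" "B = (s2, w)" "C = (t, x)" "C' = (t', x')"
      by (cases A, cases B, cases C, cases C') auto
    note l = linear_add[OF glin(1)[OF y]] linear_cmul[OF glin(1)[OF y]] linear_add[OF Dg_lin3[OF y]] linear_cmul[OF Dg_lin3[OF y]]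
      linear_add[OF Dg_lin1[OF y]] linear_cmul[OF Dg_lin1[OF y]]
    show "(KG (r, y) A B (C + C') + KG (r, y) B A (C + C') - KG (r, y) (C + C') A B) / 2 =
       (KG (r, y) A B C + KG (r, y) B A C - KG (r, y) C A B) / 2 + (KG (r, y) A B C' + KG (r, y) B A C' - KG (r, y) C' A B) / 2"
      by (simp add: e KG_eq[OF y r] l field_simps)
    show "(KG (r, y) A B (c *\<^sub>R C) + KG (r, y) B A (c *\<^sub>R C) - KG (r, y) (c *\<^sub>R C) A B) / 2 =
       c *\<^sub>R ((KG (r, y) A B C + KG (r, y) B A C - KG (r, y) C A B) / 2)"
      by (simp add: e KG_eq[OF y r] l field_simps)
  qed
  have "christoffel Gm (r, y) A B = sharp (Gm (r, y)) (\<lambda>C. (KG (r, y) A B C + KG (r, y) B A C - KG (r, y) C A B) / 2)"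
    by (simp add: christoffel_def KG_def)
  then show ?thesis
    using sharp_apply[OF Gm_positive[OF y r] lin] by simp
qed

lemma X_has: "y \<in> O' \<Longrightarrow> (X has_derivative (\<lambda>v. (dU y v, v))) (at y)"
  unfolding X_def[abs_def] by (intro has_derivative_Pair dU_has has_derivative_ident)

lemma X_frechet: "y \<in> O' \<Longrightarrow> frechet_derivative X (at y) = (\<lambda>v. (dU y v, v))"
  using frechet_derivative_at[OF X_has] by simp

lemma X_frechet2:
  assumes y: "y \<in> O'"
  shows "frechet_derivative (\<lambda>z. frechet_derivative X (at z) w) (at y) v = (D2U y v w, 0)"
proof -
  have "((\<lambda>z. (dU z w, w)) has_derivative (\<lambda>v. (D2U y v w, 0))) (at y)"
    by (intro has_derivative_Pair D2U_has y has_derivative_const)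
  then have "((\<lambda>z. frechet_derivative X (at z) w) has_derivative (\<lambda>v. (D2U y v w, 0))) (at y)"
    by (rule has_derivative_transform_within_open[OF _ O' y]) (simp add: X_frechet)
  from frechet_derivative_at[OF this, symmetric] show ?thesis
    by simp
qed

lemma induced_X:
  assumes y: "y \<in> O'"
  shows "induced_metric Gm X y = (\<lambda>v w. (L0 y)\<^sup>2 * g y v w + 1 * (dU y v * dU y w))"
  using y by (simp add: induced_metric_def X_frechet X_def Gm_apply fun_eq_iff)

lemma unit_normal_\<nu>:
  assumes y: "y \<in> O'"
  shows "unit_normal Gm X y (\<nu> y)" "Gm (X y) (\<nu> y) (1, 0) > 0"
proof -
  note l = lpos[OF Ua[OF y]]
  have s: "sqrt (s y) * sqrt (s y) = s y" "sqrt (s y) > 0"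
    using s_pos[OF y] by auto
  have gz: "g y (z y) (z y) = Q y" "linear (g y v)" "linear (\<lambda>v. g y v w)" for v w
    using Q_eq[OF y] glin[OF y] by auto
  let ?L = "L0 y"
  have nu: "\<nu> y = (?L / sqrt (s y), - ((1 / (?L * sqrt (s y))) *\<^sub>R z y))"
    using l s by (simp add: \<nu>_def power2_eq_square)
  have "Gm (X y) (\<nu> y) (\<nu> y) = (?L / sqrt (s y))\<^sup>2 + ?L\<^sup>2 * ((1 / (?L * sqrt (s y)))\<^sup>2 * Q y)"
    by (simp add: X_def nu Gm_apply linear_neg[OF gz(2)] linear_neg[OF gz(3)] linear_cmul[OF gz(2)] linear_cmul[OF gz(3)] gz(1) power2_eq_square)
  also have "\<dots> = (?L\<^sup>2 + Q y) / s y"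
    using l s by (simp add: power_divide power_mult_distrib add_divide_distrib)
  also have "\<dots> = 1"
    using s_pos[OF y] by (simp add: s_def)
  finally have 1: "Gm (X y) (\<nu> y) (\<nu> y) = 1" .
  have "Gm (X y) (dU y v, v) (\<nu> y) = 0" for v
  proof -
    have "g y v (z y) = dU y v"
      using sharp_z[OF y] gsym[OF y] by simp
    then show ?thesis
      using l s by (simp add: X_def nu Gm_apply linear_neg[OF gz(2)] linear_cmul[OF gz(2)] power2_eq_square)
  qed
  with 1 show "unit_normal Gm X y (\<nu> y)"
    by (simp add: unit_normal_def X_frechet[OF y])
  show "Gm (X y) (\<nu> y) (1, 0) > 0"
    using l s by (simp add: X_def nu Gm_apply linear_0[OF gz(2)])
qed

text \<open>
  $-\nabla^2U+2(\lambda'/\lambda)\,dU\otimes dU+\lambda\lambda'g$, the second fundamental form of the graph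
  up to the factor $\lambda/\sqrt s$. The last three terms and \<open>- D2U\<close> together form $-\nabla^2U$, the
  Christoffel symbols being written out by the Koszul formula. Every summand is of the form
  $c\cdot\gamma(v,w)$ with $\gamma$ bilinear, so that the trace can be taken summand by summand.
\<close>

definition "\<beta> y v w = (-1) * D2U y v w + (2 * L1 y / L0 y * (dU y v * dU y w) + (L0 y * L1 y * g y v w
     + (1 / 2 * Dg y v w (z y) + (1 / 2 * Dg y w v (z y) + (-1 / 2) * Dg y (z y) v w))))"

lemma second_fundamental_form_X:
  assumes y: "y \<in> O'"
  shows "second_fundamental_form Gm X (\<nu> y) y v w = L0 y / sqrt (s y) * \<beta> y v w"
proof -
  let ?L = "L0 y"
  note l = lpos[OF Ua[OF y]]
  note lins = glin[OF y] Dg_lin1[OF y] Dg_lin3[OF y]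
  note P = positive_inner_linear[OF Gm_positive[OF y Ua[OF y]]]
  let ?C = "(1::real, - (1 / ?L\<^sup>2) *\<^sub>R z y)" and ?A = "(dU y v, v)" and ?B = "(dU y w, w)"
  have gz: "g y v (z y) = dU y v" for v
    using sharp_z[OF y] gsym[OF y] by simp
  have "second_fundamental_form Gm X (\<nu> y) y v w
     = - Gm (U y, y) ((D2U y v w, 0) + christoffel Gm (U y, y) ?A ?B) ((?L / sqrt (s y)) *\<^sub>R ?C)"
    unfolding second_fundamental_form_def X_frechet2[OF y] X_frechet[OF y] by (simp add: X_def \<nu>_def)
  also have "\<dots> = - (?L / sqrt (s y)) * (Gm (U y, y) (D2U y v w, 0) ?C
       + (KG (U y, y) ?A ?B ?C + KG (U y, y) ?B ?A ?C - KG (U y, y) ?C ?A ?B) / 2)"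
    by (simp only: linear_cmul[OF P(1)] linear_add[OF P(2)] christoffel_Gm[OF y Ua[OF y]] real_scaleR_def minus_mult_left)
  also have "Gm (U y, y) (D2U y v w, 0) ?C = D2U y v w"
    by (simp only: Gm_apply linear_0[OF lins(2)])
  also have "KG (U y, y) ?A ?B ?C = - 2 * L1 y / ?L * (dU y v * dU y w) - Dg y v w (z y)"
    unfolding KG_eq[OF y Ua[OF y]] linear_cmul[OF lins(1)] linear_cmul[OF lins(4)] gz
    using l by (simp add: power2_eq_square)
  also have "KG (U y, y) ?B ?A ?C = - 2 * L1 y / ?L * (dU y v * dU y w) - Dg y w v (z y)"
    unfolding KG_eq[OF y Ua[OF y]] linear_cmul[OF lins(1)] linear_cmul[OF lins(4)] gz
    using l by (simp add: power2_eq_square)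
  also have "KG (U y, y) ?C ?A ?B = 2 * ?L * L1 y * g y v w - Dg y (z y) v w"
    unfolding KG_eq[OF y Ua[OF y]] linear_cmul[OF lins(3)]
    using l by (simp add: power2_eq_square)
  also have "D2U y v w + ((- 2 * L1 y / ?L * (dU y v * dU y w) - Dg y v w (z y))
      + (- 2 * L1 y / ?L * (dU y v * dU y w) - Dg y w v (z y)) - (2 * ?L * L1 y * g y v w - Dg y (z y) v w)) / 2 = - \<beta> y v w"
    by (simp add: \<beta>_def add_divide_distrib diff_divide_distrib)
  finally show ?thesis
    by simp
qed

lemma D2U_bilinear:
  assumes y: "y \<in> O'"
  shows "bilinear (D2U y)"
proof -
  have "D2U y = (\<lambda>v w. g y (Dz y v) w + Dg y v (z y) w)"
    using gradient_derivative[OF y] by (simp add: fun_eq_iff)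
  then show ?thesis
    using linear_compose[OF Dz_lin[OF y] glin(2)[OF y]] glin(1)[OF y] Dg_lin1[OF y] Dg_lin3[OF y]
    by (auto simp: bilinear_def comp_def intro!: linear_compose_add)
qed

lemma bilinear_scale_add: "bilinear B \<Longrightarrow> bilinear C \<Longrightarrow> bilinear (\<lambda>v w. c * B v w + C v w :: real)"
  using bilinear_combination[of B C c 1] by simp

lemma bilinear_scale: "bilinear B \<Longrightarrow> bilinear (\<lambda>v w. c * B v w :: real)"
  using bilinear_combination[of B B c 0] by simp

lemma gtrace_scale_add:
  "positive_inner h \<Longrightarrow> bilinear B \<Longrightarrow> bilinear C \<Longrightarrow> gtrace h (\<lambda>v w. c * B v w + C v w) = c * gtrace h B + gtrace h C"
  by (simp add: gtrace_add bilinear_scale gtrace_scale)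

text \<open>
  By the Sherman--Morrison formula the trace with respect to the induced metric
  $\lambda^2g+dU\otimes dU$ is $\lambda^{-2}(\mathrm{tr}_g\beta-\beta(z,z)/s)$. Here
  $\mathrm{tr}_g\beta$ contains $-\mathrm{div}\,z$, and $\beta(z,z)/s$ contains
  $-ds(z)/(2s)$, the logarithmic derivative of $1/\sqrt s$ in the direction $z$.
\<close>

theorem divz_eq_mean_curvature:
  assumes y: "y \<in> O'"
  shows "divz y = real CARD('n) * L0 y * L1 y - L0 y * sqrt (s y) * H y"
proof -
  let ?L = "L0 y" and ?L1 = "L1 y" and ?n = "real CARD('n)"
  note l = lpos[OF Ua[OF y]] and P = gpos[OF y]
  have s: "sqrt (s y) * sqrt (s y) = s y" "sqrt (s y) > 0" "s y > 0"
    using s_pos[OF y] by auto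
  define \<tau> where "\<tau> = gtrace (g y) (\<lambda>v w. Dg y v w (z y))"
  define D where "D = D2U y (z y) (z y) - Dg y (z y) (z y) (z y) / 2"
  have bl: "bilinear (\<lambda>v w. Dg y v w (z y))" "bilinear (\<lambda>v w. Dg y w v (z y))" "bilinear (Dg y (z y))"
     "bilinear (g y)" "bilinear (\<lambda>v w. dU y v * dU y w)" "bilinear (D2U y)"
     "bilinear (\<lambda>v w. g y (Dz y v) w)"
    using Dg_bilinear[OF y] Dg_bilinear'[OF y] positive_inner_bilinear[OF P] D2U_bilinear[OF y] dU_lin[OF y]
      linear_compose[OF Dz_lin[OF y] glin(2)[OF y]]
    by (auto simp: bilinear_def comp_def linear_iff algebra_simps)
  have bb: "bilinear (\<beta> y)"
    unfolding \<beta>_def[abs_def] by (intro bilinear_scale_add bilinear_scale bl)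
  have tD: "gtrace (g y) (D2U y) = trace_map (Dz y) + \<tau>"
  proof -
    have "D2U y = (\<lambda>v w. g y (Dz y v) w + Dg y v w (z y))"
      using gradient_derivative[OF y] Dg_sym[OF y] by (simp add: fun_eq_iff)
    then show ?thesis
      by (simp add: gtrace_add[OF P bl(7) bl(1)] gtrace_map[OF P] \<tau>_def)
  qed
  have tb: "gtrace (g y) (\<beta> y) = - trace_map (Dz y) + 2 * ?L1 / ?L * Q y + ?n * ?L * ?L1 - gtrace (g y) (Dg y (z y)) / 2"
    unfolding \<beta>_def[abs_def]
    by (simp only: gtrace_scale_add[OF P] gtrace_scale[OF P] bilinear_scale_add bilinear_scale bl tD
        gtrace_self[OF P] gtrace_rank_one[OF P dU_lin[OF y] dU_lin[OF y]] gtrace_swap[OF P bl(1)] \<tau>_def[symmetric]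
        z_def[symmetric] Q_def[symmetric]) simp
  have dzz: "dU y (Dz y (z y)) + D2U y (z y) (z y) = 2 * D"
  proof -
    have "dU y (Dz y (z y)) = g y (Dz y (z y)) (z y)"
      using sharp_z[OF y, of "Dz y (z y)"] gsym[OF y, of "z y" "Dz y (z y)"] by simp
    then show ?thesis
      using gradient_derivative[OF y, of "z y" "z y"] by (simp add: D_def)
  qed
  have bz: "\<beta> y (z y) (z y) = 2 * ?L1 / ?L * Q y * Q y + ?L * ?L1 * Q y - D"
    by (simp add: \<beta>_def D_def Q_eq[OF y, symmetric] Q_def[symmetric])
  have bz': "\<beta> y (z y) (z y) / s y = 2 * ?L1 / ?L * Q y - (2 * ?L * ?L1 * Q y + 2 * D) / (2 * s y)"
  proof -
    have "2 * ?L1 / ?L * Q y * s y = 2 * ?L1 / ?L * Q y * Q y + 2 * ?L * ?L1 * Q y"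
      using l by (simp add: s_def field_simps power2_eq_square)
    then have "\<beta> y (z y) (z y) = 2 * ?L1 / ?L * Q y * s y - (?L * ?L1 * Q y + D)"
      using bz by (simp add: algebra_simps)
    then have "\<beta> y (z y) (z y) / s y = 2 * ?L1 / ?L * Q y - (?L * ?L1 * Q y + D) / s y"
      using s(3) by (simp add: diff_divide_distrib)
    moreover have "(2 * ?L * ?L1 * Q y + 2 * D) / (2 * s y) = (?L * ?L1 * Q y + D) / s y"
    proof -
      have "2 * ?L * ?L1 * Q y + 2 * D = 2 * (?L * ?L1 * Q y + D)" by simp
      then show ?thesis by (simp only: mult_divide_mult_cancel_left)
    qed
    ultimately show ?thesis by simp
  qed
  have pi: "positive_inner (induced_metric Gm X y)"
    unfolding induced_X[OF y] using l by (intro positive_inner_rank_one[OF P dU_lin[OF y]]) auto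
  have "H y = gtrace (induced_metric Gm X y) (\<lambda>v w. ?L / sqrt (s y) * \<beta> y v w)"
    unfolding H_def mean_curvature_def gtrace_def second_fundamental_form_X[OF y, abs_def] ..
  also have "\<dots> = ?L / sqrt (s y) * gtrace (induced_metric Gm X y) (\<beta> y)"
    by (rule gtrace_scale[OF pi bb])
  also have "gtrace (induced_metric Gm X y) (\<beta> y) = (gtrace (g y) (\<beta> y) - \<beta> y (z y) (z y) / s y) / ?L\<^sup>2"
    unfolding induced_X[OF y] using gtrace_rank_one_perturbation[OF P dU_lin[OF y] _ _ bb, of "?L\<^sup>2" 1] l
    by (simp add: z_def[symmetric] s_def Q_def)
  finally have "?L * sqrt (s y) * H y = gtrace (g y) (\<beta> y) - \<beta> y (z y) (z y) / s y"
    using l s by (simp add: power2_eq_square)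
  then show ?thesis
    unfolding tb bz' divz_def dzz by simp
qed

end

section \<open>Smooth functions\<close>

lemma cont_diff_on_cong:
  assumes "open S"
  shows "(\<And>x. x \<in> S \<Longrightarrow> f x = h x) \<Longrightarrow> cont_diff_on m S f \<Longrightarrow> cont_diff_on m S h"
proof (induction m arbitrary: f h)
  case 0
  then show ?case
    using continuous_on_cong[of S S f h] by simp
next
  case (Suc m)
  have d: "(h has_derivative frechet_derivative f (at x)) (at x)" if "x \<in> S" for x
    by (rule has_derivative_transform_within_open[where f = f, OF _ assms that])
      (use Suc.prems that in \<open>auto simp: frechet_derivative_works[symmetric]\<close>)
  then have e: "frechet_derivative f (at x) v = frechet_derivative h (at x) v" if "x \<in> S" for x v
    using frechet_derivative_at[OF d[OF that]] by simp
  have "cont_diff_on m S (\<lambda>x. frechet_derivative h (at x) v)" for v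
    by (rule Suc.IH[where f = "\<lambda>x. frechet_derivative f (at x) v", OF e]) (use Suc.prems in auto)
  then show ?case
    using d by (auto simp: differentiable_def)
qed

lemma cont_diff_on_const: "cont_diff_on m S (\<lambda>x. c)"
  by (induction m arbitrary: c) (auto simp: frechet_derivative_const)

lemma cont_diff_on_linear:
  assumes "bounded_linear l"
  shows "cont_diff_on m S l"
proof (cases m)
  case (Suc k)
  then show ?thesis
    using assms cont_diff_on_const
    by (auto simp: bounded_linear_imp_differentiable frechet_derivative_at[OF bounded_linear_imp_has_derivative[OF assms], symmetric])
qed (use assms linear_continuous_on in auto)

lemma cont_diff_on_Pair:
  assumes "open S"
  shows "cont_diff_on m S f \<Longrightarrow> cont_diff_on m S h \<Longrightarrow> cont_diff_on m S (\<lambda>x. (f x, h x))"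
proof (induction m arbitrary: f h)
  case 0
  then show ?case by (auto intro: continuous_on_Pair)
next
  case (Suc m)
  have d: "((\<lambda>x. (f x, h x)) has_derivative (\<lambda>v. (frechet_derivative f (at x) v, frechet_derivative h (at x) v))) (at x)"
    if "x \<in> S" for x
    using Suc.prems that by (intro has_derivative_Pair) (auto simp: frechet_derivative_works[symmetric])
  have "cont_diff_on m S (\<lambda>x. frechet_derivative (\<lambda>x. (f x, h x)) (at x) v)" for v
    by (rule cont_diff_on_cong[OF assms, where f = "\<lambda>x. (frechet_derivative f (at x) v, frechet_derivative h (at x) v)"])
      (use Suc frechet_derivative_at[OF d] in \<open>auto simp: fun_eq_iff\<close>)
  then show ?case
    using d by (auto simp: differentiable_def)
qed

lemma smooth_on_ident: "smooth_on S (\<lambda>x. x)" and smooth_on_const: "smooth_on S (\<lambda>x. c)"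
  using cont_diff_on_linear[OF bounded_linear_ident] cont_diff_on_const by (auto simp: smooth_on_def)

lemma smooth_on_Pair: "open S \<Longrightarrow> smooth_on S f \<Longrightarrow> smooth_on S h \<Longrightarrow> smooth_on S (\<lambda>x. (f x, h x))"
  by (simp add: smooth_on_def cont_diff_on_Pair)

lemma cont_diff_on_subset: "cont_diff_on m S f \<Longrightarrow> T \<subseteq> S \<Longrightarrow> cont_diff_on m T f"
  by (induction m arbitrary: f) (auto intro: continuous_on_subset)

lemma smooth_on_subset: "smooth_on S f \<Longrightarrow> T \<subseteq> S \<Longrightarrow> smooth_on T f"
  by (auto simp: smooth_on_def intro: cont_diff_on_subset)

lemma C1_Pair: "C1 S f \<Longrightarrow> C1 S h \<Longrightarrow> C1 S (\<lambda>x. (f x, h x))"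
  by (rule C1I[where f' = "\<lambda>x v. (frechet_derivative f (at x) v, frechet_derivative h (at x) v)"])
    (auto intro!: has_derivative_Pair C1_has_derivative continuous_on_Pair C1_continuous_derivative)

lemma C1_fst: "C1 S f \<Longrightarrow> C1 S (\<lambda>x. fst (f x))" and C1_snd: "C1 S f \<Longrightarrow> C1 S (\<lambda>x. snd (f x))"
  by (rule C1_linear[OF bounded_linear_fst] C1_linear[OF bounded_linear_snd], assumption)+

lemma continuous_on_gram_det:
  assumes "\<And>b c. b \<in> Basis \<Longrightarrow> c \<in> Basis \<Longrightarrow> continuous_on S (\<lambda>x. g x b c)"
  shows "continuous_on S (\<lambda>x. gram_det (g x :: 'p::euclidean_space \<Rightarrow> _))"
  unfolding gram_det_def
  by (intro continuous_intros assms) (auto simp: permutes_in_image)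

text \<open>
  A continuous left inverse agrees with \<open>inv_into\<close> on the image; \<open>local_param\<close> is stated with the latter.
\<close>

lemma homeomorphism_inv_into:
  assumes "continuous_on D f" "continuous_on (f ` D) h" "\<And>y. y \<in> D \<Longrightarrow> h (f y) = y"
  shows "homeomorphism D (f ` D) f (inv_into D f)"
proof -
  have inj: "inj_on f D"
    using assms(3) by (rule inj_on_inverseI)
  have "continuous_on (f ` D) (inv_into D f)"
    by (rule continuous_on_eq[OF assms(2)]) (auto simp: assms(3) inv_into_f_f[OF inj])
  then show ?thesis
    unfolding homeomorphism_def using assms(1) inj
    by (auto simp: inv_into_f_f[OF inj] f_inv_into_f image_iff)
qed

section \<open>Charts of the base and of the warped product\<close>

locale manifold =
  fixes N :: "'a::topological_space set" and P :: "('a, real ^ 'n) rchart set"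
  assumes rm: "riemannian_manifold N P"
begin

lemma atlas: "(\<Union>c\<in>P. rdom c) = N"
  and chart_open: "c \<in> P \<Longrightarrow> openin (top_of_set N) (rdom c)"
  and open_rimg: "c \<in> P \<Longrightarrow> open (rimg c)"
  and chart_hom: "c \<in> P \<Longrightarrow> homeomorphism (rdom c) (rimg c) (rcoord c) (rinv c)"
  and met_pos: "c \<in> P \<Longrightarrow> x \<in> rimg c \<Longrightarrow> positive_inner (rmet c x)"
  and met_smooth: "c \<in> P \<Longrightarrow> smooth_on (rimg c) (\<lambda>x. rmet c x v w)"
  and trans_smooth: "c \<in> P \<Longrightarrow> d \<in> P \<Longrightarrow> smooth_on (rcoord c ` (rdom c \<inter> rdom d)) (transition c d)"
  and met_trans: "c \<in> P \<Longrightarrow> d \<in> P \<Longrightarrow> x \<in> rcoord c ` (rdom c \<inter> rdom d) \<Longrightarrow>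
        rmet c x v w =
          rmet d (transition c d x)
            (frechet_derivative (transition c d) (at x) v)
            (frechet_derivative (transition c d) (at x) w)"
proof -
  have *: "(\<Union>c\<in>P. rdom c) = N"
     "\<forall>c\<in>P. openin (top_of_set N) (rdom c) \<and> open (rimg c) \<and>
        homeomorphism (rdom c) (rimg c) (rcoord c) (rinv c)"
     "\<forall>c\<in>P. (\<forall>x\<in>rimg c. positive_inner (rmet c x)) \<and>
        (\<forall>v w. smooth_on (rimg c) (\<lambda>x. rmet c x v w))"
     "\<forall>c\<in>P. \<forall>d\<in>P. smooth_on (rcoord c ` (rdom c \<inter> rdom d)) (transition c d)"
     "\<forall>c\<in>P. \<forall>d\<in>P. \<forall>x\<in>rcoord c ` (rdom c \<inter> rdom d). \<forall>v w.
        rmet c x v w =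
          rmet d (transition c d x)
            (frechet_derivative (transition c d) (at x) v)
            (frechet_derivative (transition c d) (at x) w)"
    using rm unfolding riemannian_manifold_def by blast+
  show "(\<Union>c\<in>P. rdom c) = N" by (rule *)
  show "c \<in> P \<Longrightarrow> openin (top_of_set N) (rdom c)" "c \<in> P \<Longrightarrow> open (rimg c)"
    "c \<in> P \<Longrightarrow> homeomorphism (rdom c) (rimg c) (rcoord c) (rinv c)"
    using *(2) by blast+
  show "c \<in> P \<Longrightarrow> x \<in> rimg c \<Longrightarrow> positive_inner (rmet c x)"
    "c \<in> P \<Longrightarrow> smooth_on (rimg c) (\<lambda>x. rmet c x v w)"
    using *(3) by blast+
  show "c \<in> P \<Longrightarrow> d \<in> P \<Longrightarrow> smooth_on (rcoord c ` (rdom c \<inter> rdom d)) (transition c d)"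
    using *(4) by blast
  show "c \<in> P \<Longrightarrow> d \<in> P \<Longrightarrow> x \<in> rcoord c ` (rdom c \<inter> rdom d) \<Longrightarrow>
        rmet c x v w =
          rmet d (transition c d x)
            (frechet_derivative (transition c d) (at x) v)
            (frechet_derivative (transition c d) (at x) w)"
    using *(5) by blast
qed

lemma rinv_rcoord: "c \<in> P \<Longrightarrow> x \<in> rdom c \<Longrightarrow> rinv c (rcoord c x) = x"
  and rcoord_rinv: "c \<in> P \<Longrightarrow> y \<in> rimg c \<Longrightarrow> rcoord c (rinv c y) = y"
  and rinv_in: "c \<in> P \<Longrightarrow> y \<in> rimg c \<Longrightarrow> rinv c y \<in> rdom c"
  and rcoord_in: "c \<in> P \<Longrightarrow> x \<in> rdom c \<Longrightarrow> rcoord c x \<in> rimg c"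
  and rinv_cont: "c \<in> P \<Longrightarrow> continuous_on (rimg c) (rinv c)"
  and rcoord_cont: "c \<in> P \<Longrightarrow> continuous_on (rdom c) (rcoord c)"
  using homeomorphism_apply1[OF chart_hom] homeomorphism_apply2[OF chart_hom]
    homeomorphism_image1[OF chart_hom] homeomorphism_image2[OF chart_hom]
    homeomorphism_cont1[OF chart_hom] homeomorphism_cont2[OF chart_hom] by blast+

lemma rdom_sub: "c \<in> P \<Longrightarrow> rdom c \<subseteq> N"
  using atlas by auto

lemma rinv_N: "c \<in> P \<Longrightarrow> y \<in> rimg c \<Longrightarrow> rinv c y \<in> N"
  using rinv_in rdom_sub by blast

lemma openin_rinv_image:
  assumes c: "c \<in> P" and D: "open D" "D \<subseteq> rimg c"
  shows "openin (top_of_set N) (rinv c ` D)"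
proof -
  have "rinv c ` D = rdom c \<inter> rcoord c -` D"
    using D(2) by (auto simp: rcoord_rinv[OF c] rinv_in[OF c] image_iff) (metis rinv_rcoord[OF c])
  moreover have "openin (top_of_set (rdom c)) (rdom c \<inter> rcoord c -` D)"
    by (rule continuous_openin_preimage_gen[OF rcoord_cont[OF c] D(1)])
  ultimately show ?thesis
    using openin_trans chart_open[OF c] by metis
qed

lemma open_overlap:
  assumes c: "c \<in> P" and d: "d \<in> P"
  shows "open (rcoord c ` (rdom c \<inter> rdom d))"
proof -
  have "openin (top_of_set (rdom c)) (rdom c \<inter> rdom d)"
    using chart_open[OF d] openin_subset_trans[of N "rdom c \<inter> rdom d" "rdom c"]
      chart_open[OF c] rdom_sub[OF c] by (auto intro: openin_Int)
  then have "openin (top_of_set (rimg c)) (rcoord c ` (rdom c \<inter> rdom d))"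
    using homeomorphism_imp_open_map[OF chart_hom[OF c]] by blast
  then show ?thesis
    using openin_open_trans open_rimg[OF c] by blast
qed

lemma in_overlap:
  assumes c: "c \<in> P" and d: "d \<in> P" and y: "y \<in> rimg c" "rinv c y \<in> rdom d"
  shows "y \<in> rcoord c ` (rdom c \<inter> rdom d)"
  using y rcoord_rinv[OF c y(1)] rinv_in[OF c y(1)] by (auto simp: image_iff intro!: bexI[of _ "rinv c y"])

lemma transition_facts:
  assumes c: "c \<in> P" and d: "d \<in> P" and y: "y \<in> rcoord c ` (rdom c \<inter> rdom d)"
  shows "transition c d y = rcoord d (rinv c y)" "rinv c y \<in> rdom d" "y \<in> rimg c"
    "transition c d y \<in> rimg d" "rinv d (transition c d y) = rinv c y"
  using y rinv_rcoord[OF c] rcoord_in[OF c] rinv_rcoord[OF d] rcoord_in[OF d] by (auto simp: transition_def)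

text \<open>
  The chain rule together with the invariance of the metric tensor under coordinate changes.
\<close>

lemma change_of_chart:
  fixes \<sigma> :: "'p::euclidean_space \<Rightarrow> real ^ 'n"
  assumes c: "c \<in> P" and d: "d \<in> P" and \<sigma>: "C1 W \<sigma>" and W: "\<And>y. y \<in> W \<Longrightarrow> \<sigma> y \<in> rcoord c ` (rdom c \<inter> rdom d)"
  defines "\<tau> \<equiv> \<lambda>y. transition c d (\<sigma> y)"
  shows "C1 W \<tau>"
    "y \<in> W \<Longrightarrow> rmet c (\<sigma> y) (frechet_derivative \<sigma> (at y) v) (frechet_derivative \<sigma> (at y) w)
       = rmet d (\<tau> y) (frechet_derivative \<tau> (at y) v) (frechet_derivative \<tau> (at y) w)"
proof -
  have t: "C1 (rcoord c ` (rdom c \<inter> rdom d)) (transition c d)"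
    by (rule smooth_on_C1(1)[OF trans_smooth[OF c d]])
  show "C1 W \<tau>"
    unfolding \<tau>_def by (rule C1_compose[OF t \<sigma> W])
  assume y: "y \<in> W"
  have "(\<tau> has_derivative (\<lambda>v. frechet_derivative (transition c d) (at (\<sigma> y)) (frechet_derivative \<sigma> (at y) v))) (at y)"
    unfolding \<tau>_def by (rule has_derivative_compose[OF C1_has_derivative[OF \<sigma> y] C1_has_derivative[OF t W[OF y]]])
  from frechet_derivative_at[OF this, symmetric]
  show "rmet c (\<sigma> y) (frechet_derivative \<sigma> (at y) v) (frechet_derivative \<sigma> (at y) w)
       = rmet d (\<tau> y) (frechet_derivative \<tau> (at y) v) (frechet_derivative \<tau> (at y) w)"
    by (simp add: met_trans[OF c d W[OF y]] \<tau>_def)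
qed

lemma rinv_warped:
  assumes c: "c \<in> P" and r: "r \<ge> a" and y: "y \<in> rimg c"
  shows "rinv (warped_chart a lam c) (r, y) = (r, rinv c y)"
  unfolding rinv_def
proof (rule inv_into_f_eq)
  show "inj_on (rcoord (warped_chart a lam c)) (rdom (warped_chart a lam c))"
    using rinv_rcoord[OF c] by (auto simp: inj_on_def warped_chart_def) metis
  show "(r, inv_into (rdom c) (rcoord c) y) \<in> rdom (warped_chart a lam c)"
    using r rinv_in[OF c y] by (simp add: warped_chart_def rinv_def)
  show "rcoord (warped_chart a lam c) (r, inv_into (rdom c) (rcoord c) y) = (r, y)"
    using rcoord_rinv[OF c y] by (simp add: warped_chart_def rinv_def)
qed

lemma rimg_warped: "rimg (warped_chart a lam c) = {a..} \<times> rimg c"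
  by (force simp: rimg_def warped_chart_def)

lemma rmet_warped: "rmet (warped_chart a lam c) (r, x) (h, v) (t, w) = h * t + (lam r)\<^sup>2 * rmet c x v w"
  by (simp add: warped_chart_def)

lemma continuous_on_N:
  fixes h :: "'a \<Rightarrow> real"
  assumes "\<And>c. c \<in> P \<Longrightarrow> continuous_on (rimg c) (\<lambda>y. h (rinv c y))"
  shows "continuous_on N h"
  unfolding continuous_openin_preimage_eq
proof (intro allI impI)
  fix T :: "real set" assume T: "open T"
  have "N \<inter> h -` T = (\<Union>c\<in>P. rdom c \<inter> h -` T)"
    using atlas by auto
  moreover have "openin (top_of_set N) (rdom c \<inter> h -` T)" if c: "c \<in> P" for c
  proof -
    have "continuous_on (rdom c) (\<lambda>x. h (rinv c (rcoord c x)))"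
      by (rule continuous_on_compose2[OF assms[OF c] rcoord_cont[OF c]]) (auto simp: rcoord_in[OF c])
    then have "continuous_on (rdom c) h"
      by (rule continuous_on_eq) (simp add: rinv_rcoord[OF c])
    then have "openin (top_of_set (rdom c)) (rdom c \<inter> h -` T)"
      using T by (intro continuous_openin_preimage_gen) auto
    then show ?thesis
      using openin_trans chart_open[OF c] by blast
  qed
  ultimately show "openin (top_of_set N) (N \<inter> h -` T)"
    using openin_Union[of "(\<lambda>c. rdom c \<inter> h -` T) ` P"] by (simp only:) blast
qed

lemma local_param_chart:
  assumes c: "c \<in> P" and D: "open D" "D \<subseteq> rimg c"
  shows "local_param c N D (\<lambda>y. y)"
proof -
  have "homeomorphism D ((rinv c \<circ> (\<lambda>y. y)) ` D) (rinv c \<circ> (\<lambda>y. y)) (inv_into D (rinv c \<circ> (\<lambda>y. y)))"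
  proof (rule homeomorphism_inv_into[where h = "rcoord c"])
    show "continuous_on D (rinv c \<circ> (\<lambda>y. y))"
      using continuous_on_subset[OF rinv_cont[OF c] D(2)] by (simp add: comp_def)
    show "continuous_on ((rinv c \<circ> (\<lambda>y. y)) ` D) (rcoord c)"
      by (rule continuous_on_subset[OF rcoord_cont[OF c]]) (use D(2) rinv_in[OF c] in auto)
  qed (use D(2) rcoord_rinv[OF c] in auto)
  then show ?thesis
    unfolding local_param_def using D openin_rinv_image[OF c D]
    by (auto simp: smooth_on_ident comp_def frechet_derivative_ident inj_on_def)
qed

text \<open>
  The graph is parametrized over a chart of the base by $y\mapsto(w(y),y)$; its inverse is the
  projection to the base followed by the coordinate map.
\<close>

lemma local_param_graph:
  assumes c: "c \<in> P" and D: "open D" "D \<subseteq> rimg c"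
    and sm: "smooth_on (rimg c) (\<lambda>y. w (rinv c y))" and wa: "\<And>x. x \<in> N \<Longrightarrow> a \<le> w x"
  shows "local_param (warped_chart a lam c) ((\<lambda>x. (w x, x)) ` N) D (\<lambda>y. (w (rinv c y), y))"
    and "y \<in> D \<Longrightarrow> param (warped_chart a lam c) (\<lambda>y. (w (rinv c y), y)) y = (w (rinv c y), rinv c y)"
proof -
  let ?d = "warped_chart a lam c" and ?X = "\<lambda>y. (w (rinv c y), y)" and ?S = "(\<lambda>x. (w x, x)) ` N"
  have p: "param ?d ?X y = (w (rinv c y), rinv c y)" if "y \<in> D" for y
    using that D(2) wa rinv_N[OF c] by (auto simp: param_def intro!: rinv_warped[OF c])
  then show "y \<in> D \<Longrightarrow> param ?d ?X y = (w (rinv c y), rinv c y)" .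
  have smD: "smooth_on D (\<lambda>y. w (rinv c y))"
    by (rule smooth_on_subset[OF sm D(2)])
  have im: "param ?d ?X ` D = (\<lambda>y. (w (rinv c y), rinv c y)) ` D"
    using p by auto
  have "homeomorphism D (param ?d ?X ` D) (param ?d ?X) (inv_into D (param ?d ?X))"
  proof (rule homeomorphism_inv_into[where h = "\<lambda>q. rcoord c (snd q)"])
    have "continuous_on D (\<lambda>y. (w (rinv c y), rinv c y))"
      by (intro continuous_on_Pair C1_continuous_on[OF smooth_on_C1(1)[OF smD]] continuous_on_subset[OF rinv_cont[OF c] D(2)])
    then show "continuous_on D (param ?d ?X)"
      by (rule continuous_on_eq) (simp add: p)
    show "continuous_on (param ?d ?X ` D) (\<lambda>q. rcoord c (snd q))"
      by (rule continuous_on_compose2[OF rcoord_cont[OF c] continuous_on_snd[OF continuous_on_id]])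
        (use p D(2) rinv_in[OF c] in auto)
  qed (use p D(2) rcoord_rinv[OF c] in auto)
  moreover have "openin (top_of_set ?S) (param ?d ?X ` D)"
  proof -
    obtain T where T: "open T" "rinv c ` D = N \<inter> T"
      using openin_rinv_image[OF c D] by (auto simp: openin_open)
    have "param ?d ?X ` D = (\<lambda>x. (w x, x)) ` (rinv c ` D)"
      unfolding im by auto
    also have "\<dots> = ?S \<inter> (UNIV \<times> T)"
      unfolding T(2) by auto
    finally show ?thesis
      using T(1) by (auto simp: openin_open intro!: exI[of _ "UNIV \<times> T"] open_Times)
  qed
  moreover have "inj (frechet_derivative ?X (at y))" if y: "y \<in> D" for y
  proof -
    have "(?X has_derivative (\<lambda>v. (frechet_derivative (\<lambda>y. w (rinv c y)) (at y) v, v))) (at y)"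
      by (intro has_derivative_Pair C1_has_derivative[OF smooth_on_C1(1)[OF smD] y] has_derivative_ident)
    from frechet_derivative_at[OF this, symmetric] show ?thesis
      by (auto simp: inj_def)
  qed
  ultimately show "local_param ?d ?S D ?X"
    unfolding local_param_def param_def
    using D smooth_on_Pair[OF D(1) smD smooth_on_ident] wa rinv_N[OF c]
    by (auto simp: rimg_warped)
qed

lemma local_param_product:
  assumes c: "c \<in> P" and D: "open D" "D \<subseteq> rimg c"
  shows "local_param (warped_chart a lam c) ({a<..} \<times> N) ({a<..} \<times> D) (\<lambda>p. p)"
    and "p \<in> {a<..} \<times> D \<Longrightarrow> param (warped_chart a lam c) (\<lambda>p. p) p = (fst p, rinv c (snd p))"
proof -
  let ?d = "warped_chart a lam c" and ?S = "{a<..} \<times> N" and ?D = "{a<..} \<times> D"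
  have p: "param ?d (\<lambda>p. p) p = (fst p, rinv c (snd p))" if "p \<in> ?D" for p
    using that D(2) rinv_warped[OF c, of a "fst p" "snd p" lam] by (auto simp: param_def)
  then show "p \<in> {a<..} \<times> D \<Longrightarrow> param (warped_chart a lam c) (\<lambda>p. p) p = (fst p, rinv c (snd p))" .
  have oD: "open ?D"
    by (intro open_Times D) auto
  have im: "param ?d (\<lambda>p. p) ` ?D = {a<..} \<times> rinv c ` D"
    using p by (force simp: image_iff)
  have "homeomorphism ?D (param ?d (\<lambda>p. p) ` ?D) (param ?d (\<lambda>p. p)) (inv_into ?D (param ?d (\<lambda>p. p)))"
  proof (rule homeomorphism_inv_into[where h = "\<lambda>q. (fst q, rcoord c (snd q))"])
    have "continuous_on ?D (\<lambda>p. (fst p, rinv c (snd p)))"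
      by (intro continuous_on_Pair continuous_on_fst continuous_on_id
          continuous_on_compose2[OF rinv_cont[OF c] continuous_on_snd[OF continuous_on_id]]) (use D(2) in auto)
    then show "continuous_on ?D (param ?d (\<lambda>p. p))"
      by (rule continuous_on_eq) (simp add: p)
    show "continuous_on (param ?d (\<lambda>p. p) ` ?D) (\<lambda>q. (fst q, rcoord c (snd q)))"
      by (intro continuous_on_Pair continuous_on_fst continuous_on_id
          continuous_on_compose2[OF rcoord_cont[OF c] continuous_on_snd[OF continuous_on_id]])
        (use im D(2) rinv_in[OF c] in auto)
  qed (use p D(2) rcoord_rinv[OF c] in auto)
  moreover have "openin (top_of_set ?S) (param ?d (\<lambda>p. p) ` ?D)"
  proof -
    obtain T where T: "open T" "rinv c ` D = N \<inter> T"
      using openin_rinv_image[OF c D] by (auto simp: openin_open)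
    have "param ?d (\<lambda>p. p) ` ?D = ?S \<inter> (UNIV \<times> T)"
      unfolding im T(2) by auto
    then show ?thesis
      using T(1) by (auto simp: openin_open intro!: exI[of _ "UNIV \<times> T"] open_Times)
  qed
  ultimately show "local_param ?d ?S ?D (\<lambda>p. p)"
    unfolding local_param_def param_def
    using oD D smooth_on_ident by (auto simp: rimg_warped frechet_derivative_ident inj_def)
qed

end

section \<open>Changes of parametrization\<close>

lemma C1_frechet_eq:
  assumes "open V" "x \<in> V" "\<And>y. y \<in> V \<Longrightarrow> f y = h y"
  shows "frechet_derivative f (at x) = frechet_derivative h (at x)"
  unfolding frechet_derivative_def
  using has_derivative_transform_within_open[of f _ x UNIV V h] has_derivative_transform_within_open[of h _ x UNIV V f] assms
  by (metis (no_types, lifting))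

context manifold
begin

lemma transition_in:
  assumes c: "c \<in> P" and d: "d \<in> P" and D: "D \<subseteq> rimg d" and y: "y \<in> rimg c" "rinv c y \<in> rinv d ` D"
  shows "y \<in> rcoord c ` (rdom c \<inter> rdom d)" "transition c d y \<in> D" "rinv d (transition c d y) = rinv c y"
proof -
  obtain y' where y': "y' \<in> D" "rinv c y = rinv d y'"
    using y(2) by auto
  have "rinv c y \<in> rdom d"
    using y' D rinv_in[OF d] by auto
  then show *: "y \<in> rcoord c ` (rdom c \<inter> rdom d)"
    using in_overlap[OF c d y(1)] by simp
  show "transition c d y \<in> D"
    using transition_facts(1)[OF c d *] y' D rcoord_rinv[OF d] by auto
  show "rinv d (transition c d y) = rinv c y"
    using transition_facts(5)[OF c d *] .
qed

lemma param_warped: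
  assumes c: "c \<in> P" and lp: "local_param (warped_chart a lam c) S W X" and y: "y \<in> W"
  shows "param (warped_chart a lam c) X y = (fst (X y), rinv c (snd (X y)))" "snd (X y) \<in> rimg c" "fst (X y) \<ge> a"
proof -
  have "X y \<in> {a..} \<times> rimg c"
    using lp y by (auto simp: local_param_def rimg_warped)
  then show "param (warped_chart a lam c) X y = (fst (X y), rinv c (snd (X y)))" "snd (X y) \<in> rimg c" "fst (X y) \<ge> a"
    using rinv_warped[OF c, of a "fst (X y)" "snd (X y)" lam] by (auto simp: param_def)
qed

lemma smooth_transition_chart:
  assumes c: "c \<in> P" and d: "d \<in> P" and D: "open D" "D \<subseteq> rimg d" and lp: "local_param c N W X"
  shows "smooth_transition c W X d D (\<lambda>y. y)"
proof -
  define V where "V = {y \<in> W. param c X y \<in> param d (\<lambda>y. y) ` D}"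
  have X: "C1 W X" "X ` W \<subseteq> rimg c"
    using lp smooth_on_C1(1) by (auto simp: local_param_def)
  have V: "X y \<in> rimg c" "rinv c (X y) \<in> rinv d ` D" if "y \<in> V" for y
    using that X(2) by (auto simp: V_def param_def)
  have T: "X y \<in> rcoord c ` (rdom c \<inter> rdom d)" "transition c d (X y) \<in> D"
    "rinv d (transition c d (X y)) = rinv c (X y)" if "y \<in> V" for y
    using transition_in[OF c d D(2) V[OF that]] by auto
  have XV: "C1 V X"
    by (rule C1_subset[OF X(1)]) (auto simp: V_def)
  have ch: "C1 V (\<lambda>y. transition c d (X y))"
    by (rule change_of_chart(1)[OF c d XV T(1)])
  have ch2: "rmet c (X y) (frechet_derivative (\<lambda>y. X y) (at y) v) (frechet_derivative (\<lambda>y. X y) (at y) v')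
     = rmet d (transition c d (X y)) (frechet_derivative (\<lambda>y. transition c d (X y)) (at y) v)
        (frechet_derivative (\<lambda>y. transition c d (X y)) (at y) v')" if "y \<in> V" for y v v'
    by (rule change_of_chart(2)[OF c d XV T(1) that])
  show ?thesis
    unfolding smooth_transition_def
  proof (intro exI[of _ "\<lambda>y. transition c d (X y)"] exI[of _ "\<lambda>y. frechet_derivative (\<lambda>y. transition c d (X y)) (at y)"]
      conjI ballI impI allI)
    fix y v w assume "y \<in> W" "param c X y \<in> param d (\<lambda>y. y) ` D"
    then have y: "y \<in> V"
      by (simp add: V_def)
    show "transition c d (X y) \<in> D"
      by (rule T(2)[OF y])
    show "param d (\<lambda>y. y) (transition c d (X y)) = param c X y"
      using T(3)[OF y] by (simp add: param_def)
    show "((\<lambda>y. transition c d (X y)) has_derivative frechet_derivative (\<lambda>y. transition c d (X y)) (at y)) (at y)"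
      by (rule C1_has_derivative[OF ch y])
    show "induced_metric (rmet c) X y v w = induced_metric (rmet d) (\<lambda>y. y) (transition c d (X y))
       (frechet_derivative (\<lambda>y. transition c d (X y)) (at y) v) (frechet_derivative (\<lambda>y. transition c d (X y)) (at y) w)"
      using ch2[OF y] by (simp add: induced_metric_def frechet_derivative_ident)
  next
    fix v
    show "continuous_on {y \<in> W. param c X y \<in> param d (\<lambda>y. y) ` D}
        (\<lambda>y. frechet_derivative (\<lambda>y. transition c d (X y)) (at y) v)"
      using C1_continuous_derivative[OF ch] by (simp add: V_def)
  qed
qed

text \<open>
  A parametrization of the graph is determined by its projection to the base, because the height is a
  function of the projection. Thus the change of parametrization is that of the projections, and the
  summand of the metric in direction $r$ is taken care of by the chain rule for the height.
\<close>

lemma smooth_transition_graph: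
  assumes c: "c \<in> P" and d: "d \<in> P" and D: "open D" "D \<subseteq> rimg d"
    and sm: "\<And>c. c \<in> P \<Longrightarrow> smooth_on (rimg c) (\<lambda>y. w (rinv c y))" and wa: "\<And>x. x \<in> N \<Longrightarrow> a \<le> w x"
    and lp: "local_param (warped_chart a lam c) ((\<lambda>x. (w x, x)) ` N) (W :: (real ^ 'n) set) X"
  shows "smooth_transition (warped_chart a lam c) W X (warped_chart a lam d) D (\<lambda>y. (w (rinv d y), y))"
proof -
  let ?c = "warped_chart a lam c" and ?d = "warped_chart a lam d" and ?Y = "\<lambda>y. (w (rinv d y), y)" and ?S = "(\<lambda>x. (w x, x)) ` N"
  have lg1: "local_param ?d ?S D ?Y"
    by (rule local_param_graph(1)[OF d D sm[OF d] wa])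
  have lg2: "param ?d ?Y y = (w (rinv d y), rinv d y)" if "y \<in> D" for y
    by (rule local_param_graph(2)[OF d D sm[OF d] wa that])
  define V where "V = {y \<in> W. param ?c X y \<in> param ?d ?Y ` D}"
  have oV: "open V"
    unfolding V_def by (rule open_param_preimage[OF lp local_paramD(2)[OF lg1]])
  have X: "C1 W X"
    using lp smooth_on_C1(1) by (auto simp: local_param_def)
  have VW: "V \<subseteq> W" by (auto simp: V_def)
  have XV: "C1 V X" "C1 V (\<lambda>y. snd (X y))"
    using C1_subset[OF X VW] C1_snd by blast+
  note pw = param_warped[OF c lp]
  have im: "param ?d ?Y ` D = (\<lambda>y. (w (rinv d y), rinv d y)) ` D"
    using lg2 by auto
  have V: "snd (X y) \<in> rimg c" "rinv c (snd (X y)) \<in> rinv d ` D" if "y \<in> V" for y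
    using that pw[of y] by (auto simp: V_def im)
  have T: "snd (X y) \<in> rcoord c ` (rdom c \<inter> rdom d)" "transition c d (snd (X y)) \<in> D"
    "rinv d (transition c d (snd (X y))) = rinv c (snd (X y))" if "y \<in> V" for y
    using transition_in[OF c d D(2) V[OF that]] by auto
  have ch: "C1 V (\<lambda>y. transition c d (snd (X y)))"
    by (rule change_of_chart(1)[OF c d XV(2) T(1)])
  have ch2: "rmet c (snd (X y)) (frechet_derivative (\<lambda>y. snd (X y)) (at y) v) (frechet_derivative (\<lambda>y. snd (X y)) (at y) v')
     = rmet d (transition c d (snd (X y))) (frechet_derivative (\<lambda>y. transition c d (snd (X y))) (at y) v)
        (frechet_derivative (\<lambda>y. transition c d (snd (X y))) (at y) v')" if "y \<in> V" for y v v'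
    by (rule change_of_chart(2)[OF c d XV(2) T(1) that])
  define \<tau> where "\<tau> y = transition c d (snd (X y))" for y
  have \<tau>: "C1 V \<tau>"
    using ch by (simp add: \<tau>_def[abs_def])
  have fst: "fst (X y) = w (rinv d (\<tau> y))" if "y \<in> V" for y
    using that pw[of y] T(3)[OF that] by (auto simp: V_def im \<tau>_def)
  have dX: "frechet_derivative X (at y) v = (frechet_derivative (\<lambda>y. fst (X y)) (at y) v, frechet_derivative (\<lambda>y. snd (X y)) (at y) v)"
    if "y \<in> V" for y v
    using frechet_derivative_at[OF has_derivative_fst[OF C1_has_derivative[OF XV(1) that]], symmetric]
      frechet_derivative_at[OF has_derivative_snd[OF C1_has_derivative[OF XV(1) that]], symmetric] by simp
  have CU: "C1 (rimg d) (\<lambda>y. w (rinv d y))"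
    by (rule smooth_on_C1(1)[OF sm[OF d]])
  have dfst: "frechet_derivative (\<lambda>y. fst (X y)) (at y) v
      = frechet_derivative (\<lambda>y. w (rinv d y)) (at (\<tau> y)) (frechet_derivative \<tau> (at y) v)" if y: "y \<in> V" for y v
  proof -
    have "((\<lambda>y. w (rinv d (\<tau> y))) has_derivative
        (\<lambda>v. frechet_derivative (\<lambda>y. w (rinv d y)) (at (\<tau> y)) (frechet_derivative \<tau> (at y) v))) (at y)"
      using T(2)[OF y] D(2)
      by (intro has_derivative_compose[OF C1_has_derivative[OF \<tau> y] C1_has_derivative[OF CU]]) (auto simp: \<tau>_def)
    from frechet_derivative_at[OF this, symmetric] show ?thesis
      using C1_frechet_eq[OF oV y fst] by simp
  qed
  have dY: "frechet_derivative ?Y (at y) v = (frechet_derivative (\<lambda>y. w (rinv d y)) (at y) v, v)" if "y \<in> D" for y v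
  proof -
    have "(?Y has_derivative (\<lambda>v. (frechet_derivative (\<lambda>y. w (rinv d y)) (at y) v, v))) (at y)"
      using that D(2) by (intro has_derivative_Pair has_derivative_ident C1_has_derivative[OF CU]) auto
    from frechet_derivative_at[OF this, symmetric] show ?thesis by simp
  qed
  show ?thesis
    unfolding smooth_transition_def
  proof (intro exI[of _ \<tau>] exI[of _ "\<lambda>y. frechet_derivative \<tau> (at y)"] conjI ballI impI allI)
    fix y v v' assume "y \<in> W" "param ?c X y \<in> param ?d ?Y ` D"
    then have y: "y \<in> V"
      by (simp add: V_def)
    show yD: "\<tau> y \<in> D"
      using T(2)[OF y] by (simp add: \<tau>_def)
    show "param ?d ?Y (\<tau> y) = param ?c X y"
      using T(3)[OF y] lg2[OF yD] pw(1)[of y] fst[OF y] VW y by (auto simp: \<tau>_def)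
    show "(\<tau> has_derivative frechet_derivative \<tau> (at y)) (at y)"
      by (rule C1_has_derivative[OF \<tau> y])
    have "X y = (w (rinv d (\<tau> y)), snd (X y))"
      using fst[OF y] by (simp add: prod_eq_iff)
    then have "induced_metric (rmet ?c) X y v v' =
        rmet ?c (w (rinv d (\<tau> y)), snd (X y)) (frechet_derivative X (at y) v) (frechet_derivative X (at y) v')"
      by (simp add: induced_metric_def)
    also have "\<dots> = induced_metric (rmet ?d) ?Y (\<tau> y) (frechet_derivative \<tau> (at y) v) (frechet_derivative \<tau> (at y) v')"
      unfolding induced_metric_def dX[OF y] dY[OF yD] rmet_warped dfst[OF y]
      using ch2[OF y, of v v'] by (simp add: \<tau>_def[abs_def])
    finally show "induced_metric (rmet ?c) X y v v' =
      induced_metric (rmet ?d) ?Y (\<tau> y) (frechet_derivative \<tau> (at y) v) (frechet_derivative \<tau> (at y) v')" .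
  next
    fix v
    show "continuous_on {y \<in> W. param ?c X y \<in> param ?d ?Y ` D} (\<lambda>y. frechet_derivative \<tau> (at y) v)"
      using C1_continuous_derivative[OF \<tau>] by (simp add: V_def)
  qed
qed

lemma smooth_transition_product:
  assumes c: "c \<in> P" and d: "d \<in> P" and D: "open D" "D \<subseteq> rimg d"
    and lp: "local_param (warped_chart a lam c) ({a<..} \<times> N) (W :: (real \<times> (real ^ 'n)) set) X"
  shows "smooth_transition (warped_chart a lam c) W X (warped_chart a lam d) ({a<..} \<times> D) (\<lambda>p. p)"
proof -
  let ?c = "warped_chart a lam c" and ?d = "warped_chart a lam d" and ?D = "{a<..} \<times> D"
  note lg = local_param_product[where a = a and lam = lam, OF d D]
  define V where "V = {y \<in> W. param ?c X y \<in> param ?d (\<lambda>p. p) ` ?D}"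
  have X: "C1 W X"
    using lp smooth_on_C1(1) by (auto simp: local_param_def)
  have VW: "V \<subseteq> W" by (auto simp: V_def)
  have XV: "C1 V X" "C1 V (\<lambda>y. snd (X y))" "C1 V (\<lambda>y. fst (X y))"
    using C1_subset[OF X VW] C1_snd C1_fst by blast+
  note pw = param_warped[OF c lp]
  have im: "param ?d (\<lambda>p. p) ` ?D = (\<lambda>p. (fst p, rinv d (snd p))) ` ?D"
    using lg(2) by auto
  have V: "snd (X y) \<in> rimg c" "rinv c (snd (X y)) \<in> rinv d ` D" "fst (X y) > a" if "y \<in> V" for y
    using that pw[of y] by (auto simp: V_def im)
  have T: "snd (X y) \<in> rcoord c ` (rdom c \<inter> rdom d)" "transition c d (snd (X y)) \<in> D"
    "rinv d (transition c d (snd (X y))) = rinv c (snd (X y))" if "y \<in> V" for y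
    using transition_in[OF c d D(2) V(1)[OF that] V(2)[OF that]] by auto
  have ch: "C1 V (\<lambda>y. transition c d (snd (X y)))"
    by (rule change_of_chart(1)[OF c d XV(2) T(1)])
  have ch2: "rmet c (snd (X y)) (frechet_derivative (\<lambda>y. snd (X y)) (at y) v) (frechet_derivative (\<lambda>y. snd (X y)) (at y) v')
     = rmet d (transition c d (snd (X y))) (frechet_derivative (\<lambda>y. transition c d (snd (X y))) (at y) v)
        (frechet_derivative (\<lambda>y. transition c d (snd (X y))) (at y) v')" if "y \<in> V" for y v v'
    by (rule change_of_chart(2)[OF c d XV(2) T(1) that])
  define \<tau>2 where "\<tau>2 y = transition c d (snd (X y))" for y
  define \<tau> where "\<tau> y = (fst (X y), \<tau>2 y)" for y
  have \<tau>2: "C1 V \<tau>2"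
    using ch by (simp add: \<tau>2_def[abs_def])
  have \<tau>: "C1 V \<tau>"
    unfolding \<tau>_def[abs_def] by (rule C1_Pair[OF XV(3) \<tau>2])
  have dX: "frechet_derivative X (at y) v = (frechet_derivative (\<lambda>y. fst (X y)) (at y) v, frechet_derivative (\<lambda>y. snd (X y)) (at y) v)"
    if "y \<in> V" for y v
    using frechet_derivative_at[OF has_derivative_fst[OF C1_has_derivative[OF XV(1) that]], symmetric]
      frechet_derivative_at[OF has_derivative_snd[OF C1_has_derivative[OF XV(1) that]], symmetric] by simp
  have d\<tau>: "frechet_derivative \<tau> (at y) v = (frechet_derivative (\<lambda>y. fst (X y)) (at y) v, frechet_derivative \<tau>2 (at y) v)" if "y \<in> V" for y v
    using frechet_derivative_at[OF has_derivative_Pair[OF C1_has_derivative[OF XV(3) that] C1_has_derivative[OF \<tau>2 that]], symmetric]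
    by (simp add: \<tau>_def[abs_def])
  show ?thesis
    unfolding smooth_transition_def
  proof (intro exI[of _ \<tau>] exI[of _ "\<lambda>y. frechet_derivative \<tau> (at y)"] conjI ballI impI allI)
    fix y v v' assume "y \<in> W" "param ?c X y \<in> param ?d (\<lambda>p. p) ` ?D"
    then have y: "y \<in> V"
      by (simp add: V_def)
    show yD: "\<tau> y \<in> ?D"
      using T(2)[OF y] V(3)[OF y] by (simp add: \<tau>_def \<tau>2_def)
    show "param ?d (\<lambda>p. p) (\<tau> y) = param ?c X y"
      using T(3)[OF y] lg(2)[OF yD] pw(1)[of y] VW y by (auto simp: \<tau>_def \<tau>2_def)
    show "(\<tau> has_derivative frechet_derivative \<tau> (at y)) (at y)"
      by (rule C1_has_derivative[OF \<tau> y])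
    have "induced_metric (rmet ?c) X y v v' =
        rmet ?c (fst (X y), snd (X y)) (frechet_derivative X (at y) v) (frechet_derivative X (at y) v')"
      by (simp add: induced_metric_def)
    also have "\<dots> = rmet ?d (fst (X y), \<tau>2 y) (frechet_derivative \<tau> (at y) v) (frechet_derivative \<tau> (at y) v')"
      unfolding dX[OF y] d\<tau>[OF y] rmet_warped
      using ch2[OF y, of v v'] by (simp add: \<tau>2_def[abs_def])
    also have "\<dots> = induced_metric (rmet ?d) (\<lambda>p. p) (\<tau> y) (frechet_derivative \<tau> (at y) v) (frechet_derivative \<tau> (at y) v')"
      by (simp add: induced_metric_def frechet_derivative_ident \<tau>_def)
    finally show "induced_metric (rmet ?c) X y v v' =
      induced_metric (rmet ?d) (\<lambda>p. p) (\<tau> y) (frechet_derivative \<tau> (at y) v) (frechet_derivative \<tau> (at y) v')" .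
  next
    fix v
    show "continuous_on {y \<in> W. param ?c X y \<in> param ?d (\<lambda>p. p) ` ?D} (\<lambda>y. frechet_derivative \<tau> (at y) v)"
      using C1_continuous_derivative[OF \<tau>] by (simp add: V_def)
  qed
qed

section \<open>Covers by finitely many coordinate balls\<close>

lemma induced_ident: "induced_metric g (\<lambda>y. y) y = g y"
  by (simp add: induced_metric_def frechet_derivative_ident fun_eq_iff)

lemma chart_cover_charts:
  assumes cP: "\<And>j. j < k \<Longrightarrow> ch j \<in> P" and D: "\<And>j. j < k \<Longrightarrow> open (D j)" "\<And>j. j < k \<Longrightarrow> D j \<subseteq> rimg (ch j)"
    and cover: "N = (\<Union>j<k. rinv (ch j) ` D j)"
  shows "chart_cover P N k ch D (\<lambda>_ y. y)"
proof
  fix j assume j: "j < k"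
  show "ch j \<in> P" by (rule cP[OF j])
  show "local_param (ch j) N (D j) (\<lambda>y. y)"
    by (rule local_param_chart[OF cP[OF j] D(1)[OF j] D(2)[OF j]])
  have "continuous_on (D j) (\<lambda>y. rmet (ch j) y v w)" for v w
    by (rule continuous_on_subset[OF C1_continuous_on[OF smooth_on_C1(1)[OF met_smooth[OF cP[OF j]]]] D(2)[OF j]])
  then show "continuous_on (D j) (area_density (ch j) (\<lambda>y. y))"
    unfolding area_density_def induced_ident
    by (intro continuous_on_real_sqrt continuous_on_gram_det)
  show "bilinear (induced_metric (rmet (ch j)) (\<lambda>y. y) y)" if "y \<in> D j" for y
    unfolding induced_ident using positive_inner_bilinear[OF met_pos[OF cP[OF j]]] that D(2)[OF j] by auto
  show "smooth_transition c W X (ch j) (D j) (\<lambda>y. y)" if "c \<in> P" "local_param c N W X" for c and W :: "(real ^ 'n) set" and X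
    by (rule smooth_transition_chart[OF that(1) cP[OF j] D(1)[OF j] D(2)[OF j] that(2)])
qed (simp add: cover param_def comp_def)

text \<open>
  The closed balls still lie in the images of the charts. This gives functions that are supported in
  one of them a compact support inside the chart.
\<close>

lemma finite_ball_cover:
  assumes "compact N"
  shows "\<exists>m cc ctr rad. (\<forall>j<m. cc j \<in> P \<and> rad j > (0::real) \<and> cball (ctr j) (rad j) \<subseteq> rimg (cc j)) \<and>
     N = (\<Union>j<(m::nat). rinv (cc j) ` ball (ctr j) (rad j))"
proof -
  have "\<exists>c e. c \<in> P \<and> x \<in> rdom c \<and> e > 0 \<and> cball (rcoord c x) e \<subseteq> rimg c" if x: "x \<in> N" for x
  proof -
    obtain c where c: "c \<in> P" "x \<in> rdom c"
      using x unfolding atlas[symmetric] by blast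
    then obtain e where "e > 0" "cball (rcoord c x) e \<subseteq> rimg c"
      using open_rimg rcoord_in by (meson open_contains_cball)
    then show ?thesis
      using c by blast
  qed
  then obtain C e where Ce: "\<And>x. x \<in> N \<Longrightarrow> C x \<in> P" "\<And>x. x \<in> N \<Longrightarrow> x \<in> rdom (C x)" "\<And>x. x \<in> N \<Longrightarrow> e x > 0"
      "\<And>x. x \<in> N \<Longrightarrow> cball (rcoord (C x) x) (e x) \<subseteq> rimg (C x)"
    by metis
  define B where "B x = rinv (C x) ` ball (rcoord (C x) x) (e x)" for x
  have "\<exists>T. open T \<and> B x = N \<inter> T" if "x \<in> N" for x
    using openin_rinv_image[OF Ce(1)[OF that], of "ball (rcoord (C x) x) (e x)"] Ce(4)[OF that] ball_subset_cball
    by (force simp: openin_open B_def)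
  then obtain T where T: "\<And>x. x \<in> N \<Longrightarrow> open (T x)" "\<And>x. x \<in> N \<Longrightarrow> B x = N \<inter> T x"
    by metis
  have xB: "x \<in> B x" if "x \<in> N" for x
    unfolding B_def using Ce(3)[OF that] rinv_rcoord[OF Ce(1)[OF that] Ce(2)[OF that]]
    by (intro image_eqI[of _ _ "rcoord (C x) x"]) auto
  have "N \<subseteq> (\<Union>x\<in>N. T x)"
    using xB T(2) by blast
  then obtain C' where C': "C' \<subseteq> N" "finite C'" "N \<subseteq> (\<Union>x\<in>C'. T x)"
    using compactE_image[OF assms, of N T] T(1) by blast
  obtain h k where h: "bij_betw h {..<k :: nat} C'"
    using ex_bij_betw_nat_finite[OF C'(2)] by (auto simp: atLeast0LessThan)
  have hC: "h j \<in> N" if "j < k" for j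
    using h that C'(1) by (auto simp: bij_betw_def)
  have "N = (\<Union>x\<in>C'. B x)"
    using C'(1,3) T(2) by blast
  also have "\<dots> = (\<Union>j<k. B (h j))"
    unfolding bij_betw_imp_surj_on[OF h, symmetric] by simp
  finally have "N = (\<Union>j<k. rinv (C (h j)) ` ball (rcoord (C (h j)) (h j)) (e (h j)))"
    by (simp add: B_def)
  moreover have "\<forall>j<k. C (h j) \<in> P \<and> e (h j) > 0 \<and> cball (rcoord (C (h j)) (h j)) (e (h j)) \<subseteq> rimg (C (h j))"
    using Ce hC by blast
  ultimately show ?thesis
    by (intro exI[of _ "k"] exI[of _ "\<lambda>j. C (h j)"] exI[of _ "\<lambda>j. rcoord (C (h j)) (h j)"] exI[of _ "\<lambda>j. e (h j)"]) simp
qed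

end

text \<open>
  The cover provided by \<open>finite_ball_cover\<close> is a parameter, so that the pieces of the manifold and a
  partition of unity can be defined from it.
\<close>

locale covered_manifold = manifold N P for N :: "'a::topological_space set" and P :: "('a, real ^ 'n) rchart set" +
  fixes m :: nat and cc :: "nat \<Rightarrow> ('a, real ^ 'n) rchart" and ctr :: "nat \<Rightarrow> real ^ 'n" and rad :: "nat \<Rightarrow> real"
  assumes cP: "j < m \<Longrightarrow> cc j \<in> P" and rad: "j < m \<Longrightarrow> rad j > 0" and cb: "j < m \<Longrightarrow> cball (ctr j) (rad j) \<subseteq> rimg (cc j)"
    and Ncover: "N = (\<Union>j<m. rinv (cc j) ` ball (ctr j) (rad j))"
begin

definition "Dj j = ball (ctr j) (rad j)"

lemma Dj: "open (Dj j)" "j < m \<Longrightarrow> Dj j \<subseteq> rimg (cc j)"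
  using cb[of j] ball_subset_cball[of "ctr j" "rad j"] by (auto simp: Dj_def)

lemma continuous_metric: "j < m \<Longrightarrow> continuous_on (Dj j) (\<lambda>y. rmet (cc j) y v w)"
  using continuous_on_subset[OF C1_continuous_on[OF smooth_on_C1(1)[OF met_smooth[OF cP]]] Dj(2)] .

sublocale base: chart_cover P N m cc Dj "\<lambda>_ y. y"
proof (rule chart_cover_charts)
  show "N = (\<Union>j<m. rinv (cc j) ` Dj j)"
    using Ncover by (simp only: Dj_def)
  show "cc j \<in> P" "open (Dj j)" "Dj j \<subseteq> rimg (cc j)" if "j < m" for j
    by (rule cP[OF that] Dj(1) Dj(2)[OF that])+
qed

lemma chart_cover_graph:
  assumes sm: "\<And>c. c \<in> P \<Longrightarrow> smooth_on (rimg c) (\<lambda>y. w (rinv c y))" and wa: "\<And>x. x \<in> N \<Longrightarrow> a \<le> w x"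
    and lam: "continuous_on {a..} lam"
  shows "chart_cover (warped_product a lam P) ((\<lambda>x. (w x, x)) ` N) m (\<lambda>j. warped_chart a lam (cc j)) Dj
    (\<lambda>j y. (w (rinv (cc j) y), y))"
    and "j < m \<Longrightarrow> y \<in> Dj j \<Longrightarrow> induced_metric (rmet (warped_chart a lam (cc j))) (\<lambda>y. (w (rinv (cc j) y), y)) y
      = (\<lambda>v v'. (lam (w (rinv (cc j) y)))\<^sup>2 * rmet (cc j) y v v'
         + frechet_derivative (\<lambda>y. w (rinv (cc j) y)) (at y) v * frechet_derivative (\<lambda>y. w (rinv (cc j) y)) (at y) v')"
proof -
  let ?Y = "\<lambda>j y. (w (rinv (cc j) y), y)" and ?d = "\<lambda>j. warped_chart a lam (cc j)"
  have C: "C1 (rimg (cc j)) (\<lambda>y. w (rinv (cc j) y))" if "j < m" for j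
    by (rule smooth_on_C1(1)[OF sm[OF cP[OF that]]])
  have ind: "induced_metric (rmet (?d j)) (?Y j) y
      = (\<lambda>v v'. (lam (w (rinv (cc j) y)))\<^sup>2 * rmet (cc j) y v v'
         + frechet_derivative (\<lambda>y. w (rinv (cc j) y)) (at y) v * frechet_derivative (\<lambda>y. w (rinv (cc j) y)) (at y) v')"
    if j: "j < m" and y: "y \<in> Dj j" for j y
  proof -
    have "(?Y j has_derivative (\<lambda>v. (frechet_derivative (\<lambda>y. w (rinv (cc j) y)) (at y) v, v))) (at y)"
      using y Dj(2)[OF j] by (intro has_derivative_Pair has_derivative_ident C1_has_derivative[OF C[OF j]]) auto
    from frechet_derivative_at[OF this, symmetric] show ?thesis
      by (simp add: induced_metric_def rmet_warped fun_eq_iff)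
  qed
  then show "j < m \<Longrightarrow> y \<in> Dj j \<Longrightarrow> induced_metric (rmet (warped_chart a lam (cc j))) (\<lambda>y. (w (rinv (cc j) y), y)) y
      = (\<lambda>v v'. (lam (w (rinv (cc j) y)))\<^sup>2 * rmet (cc j) y v v'
         + frechet_derivative (\<lambda>y. w (rinv (cc j) y)) (at y) v * frechet_derivative (\<lambda>y. w (rinv (cc j) y)) (at y) v')" .
  show "chart_cover (warped_product a lam P) ((\<lambda>x. (w x, x)) ` N) m ?d Dj ?Y"
  proof
    fix j assume j: "j < m"
    show "?d j \<in> warped_product a lam P"
      using cP[OF j] by (simp add: warped_product_def)
    show "local_param (?d j) ((\<lambda>x. (w x, x)) ` N) (Dj j) (?Y j)"
      by (rule local_param_graph(1)[OF cP[OF j] Dj(1) Dj(2)[OF j] sm[OF cP[OF j]] wa])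
    show "continuous_on (Dj j) (area_density (?d j) (?Y j))"
    proof -
      have cw: "continuous_on (Dj j) (\<lambda>y. w (rinv (cc j) y))"
        by (rule continuous_on_subset[OF C1_continuous_on[OF C[OF j]] Dj(2)[OF j]])
      have "continuous_on (Dj j) (\<lambda>y. lam (w (rinv (cc j) y)))"
        by (rule continuous_on_compose2[OF lam cw]) (use wa rinv_N[OF cP[OF j]] Dj(2)[OF j] in auto)
      then have "continuous_on (Dj j) (\<lambda>y. sqrt (gram_det (\<lambda>v v'. (lam (w (rinv (cc j) y)))\<^sup>2 * rmet (cc j) y v v'
         + frechet_derivative (\<lambda>y. w (rinv (cc j) y)) (at y) v * frechet_derivative (\<lambda>y. w (rinv (cc j) y)) (at y) v')))"
        by (intro continuous_on_real_sqrt continuous_on_gram_det continuous_on_add continuous_on_mult continuous_on_power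
            continuous_metric j continuous_on_subset[OF C1_continuous_derivative[OF C[OF j]] Dj(2)[OF j]])
      then show ?thesis
        by (rule continuous_on_eq) (simp add: area_density_def ind[OF j])
    qed
    show "bilinear (induced_metric (rmet (?d j)) (?Y j) y)" if y: "y \<in> Dj j" for y
    proof -
      have yr: "y \<in> rimg (cc j)" using y Dj(2)[OF j] by auto
      have "linear (frechet_derivative (\<lambda>y. w (rinv (cc j) y)) (at y))"
        by (rule has_derivative_linear[OF C1_has_derivative[OF C[OF j] yr]])
      then show ?thesis
        unfolding ind[OF j y] using positive_inner_bilinear[OF met_pos[OF cP[OF j] yr]]
        by (auto simp: bilinear_def linear_iff algebra_simps)
    qed
    show "smooth_transition c W X (?d j) (Dj j) (?Y j)"
      if "c \<in> warped_product a lam P" "local_param c ((\<lambda>x. (w x, x)) ` N) W X" for c and W :: "(real ^ 'n) set" and X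
      using that smooth_transition_graph[OF _ cP[OF j] Dj(1) Dj(2)[OF j] sm wa] by (auto simp: warped_product_def)
  next
    have "param (?d j) (?Y j) ` Dj j = (\<lambda>x. (w x, x)) ` (rinv (cc j) ` Dj j)" if j: "j < m" for j
      using local_param_graph(2)[OF cP[OF j] Dj(1) Dj(2)[OF j] sm[OF cP[OF j]] wa] by (auto simp: image_image)
    then have "(\<Union>j<m. param (?d j) (?Y j) ` Dj j) = (\<lambda>x. (w x, x)) ` (\<Union>j<m. rinv (cc j) ` Dj j)"
      by auto
    then show "(\<lambda>x. (w x, x)) ` N = (\<Union>j<m. param (?d j) (?Y j) ` Dj j)"
      using Ncover by (simp add: Dj_def)
  qed
qed

lemma chart_cover_product:
  assumes lam: "continuous_on {a..} lam"
  shows "chart_cover (warped_product a lam P) ({a<..} \<times> N) m (\<lambda>j. warped_chart a lam (cc j)) (\<lambda>j. {a<..} \<times> Dj j) (\<lambda>_ p. p)"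
proof
  let ?d = "\<lambda>j. warped_chart a lam (cc j)"
  have met: "rmet (?d j) p = (\<lambda>x y. fst x * fst y + (lam (fst p))\<^sup>2 * rmet (cc j) (snd p) (snd x) (snd y))" for j p
    by (cases p) (auto simp: warped_chart_def fun_eq_iff)
  fix j assume j: "j < m"
  show "?d j \<in> warped_product a lam P"
    using cP[OF j] by (simp add: warped_product_def)
  show "local_param (?d j) ({a<..} \<times> N) ({a<..} \<times> Dj j) (\<lambda>p. p)"
    by (rule local_param_product(1)[OF cP[OF j] Dj(1) Dj(2)[OF j]])
  show "continuous_on ({a<..} \<times> Dj j) (area_density (?d j) (\<lambda>p. p))"
    unfolding area_density_def induced_ident met
    by (intro continuous_on_real_sqrt continuous_on_gram_det continuous_on_add continuous_on_mult continuous_on_power continuous_on_const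
        continuous_on_compose2[OF continuous_metric[OF j] continuous_on_snd[OF continuous_on_id]]
        continuous_on_compose2[OF lam continuous_on_fst[OF continuous_on_id]]) auto
  show "bilinear (induced_metric (rmet (?d j)) (\<lambda>p. p) p)" if p: "p \<in> {a<..} \<times> Dj j" for p
  proof -
    have "snd p \<in> rimg (cc j)" using p Dj(2)[OF j] by auto
    then show ?thesis
      unfolding induced_ident met using positive_inner_bilinear[OF met_pos[OF cP[OF j]]]
      by (auto simp: bilinear_def linear_iff algebra_simps)
  qed
  show "smooth_transition c W X (?d j) ({a<..} \<times> Dj j) (\<lambda>p. p)"
    if "c \<in> warped_product a lam P" "local_param c ({a<..} \<times> N) W X" for c and W :: "(real \<times> (real ^ 'n)) set" and X
    using that smooth_transition_product[OF _ cP[OF j] Dj(1) Dj(2)[OF j]] by (auto simp: warped_product_def)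
next
  let ?d = "\<lambda>j. warped_chart a lam (cc j)"
  have "param (?d j) (\<lambda>p. p) ` ({a<..} \<times> Dj j) = {a<..} \<times> rinv (cc j) ` Dj j" if j: "j < m" for j
    using local_param_product(2)[OF cP[OF j] Dj(1) Dj(2)[OF j], of _ a lam] by (force simp: image_iff)
  then have "(\<Union>j<m. param (?d j) (\<lambda>p. p) ` ({a<..} \<times> Dj j)) = {a<..} \<times> (\<Union>j<m. rinv (cc j) ` Dj j)"
    by auto
  then show "{a<..} \<times> N = (\<Union>j<m. param (?d j) (\<lambda>p. p) ` ({a<..} \<times> Dj j))"
    using Ncover by (simp add: Dj_def)
qed

end

section \<open>Functions cut off at a zero\<close>

text \<open>
  At a double zero the two one-sided derivatives agree. The lemma serves both for the bump functions of
  the partition of unity and for the cut-off weight in the flux inequality. The premises on \<open>A\<close> are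
  conditional because \<open>A\<close> may lie outside the domain.
\<close>

lemma cutoff_has_derivative:
  fixes f :: "real \<Rightarrow> real"
  assumes f: "\<And>x. x \<in> S \<Longrightarrow> (f has_real_derivative f' x) (at x)" and fA: "A \<in> S \<Longrightarrow> f A = 0" "A \<in> S \<Longrightarrow> f' A = 0" and x: "x \<in> S"
  shows "((\<lambda>x. if x \<le> A then f x else 0) has_real_derivative (if x \<le> A then f' x else 0)) (at x)"
proof -
  let ?h = "\<lambda>x. if x \<le> A then f x else 0"
  consider "x < A" | "x > A" | "x = A" by linarith
  then show ?thesis
  proof cases
    case 1
    have "(?h has_real_derivative f' x) (at x)"
      by (rule has_field_derivative_transform_within_open[OF f[OF x], of "{..<A}"]) (use 1 in auto)
    then show ?thesis using 1 by simp
  next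
    case 2
    have "(?h has_real_derivative 0) (at x)"
      by (rule has_field_derivative_transform_within_open[OF DERIV_const, of "{A<..}"]) (use 2 in auto)
    then show ?thesis using 2 by simp
  next
    case 3
    have AS: "A \<in> S" using x 3 by simp
    have "((\<lambda>y. (f y - f A) / (y - A)) \<longlongrightarrow> 0) (at A)"
      using f[OF AS] fA(2)[OF AS] by (simp add: has_field_derivative_iff)
    then have "((\<lambda>y. (?h y - ?h A) / (y - A)) \<longlongrightarrow> 0) (at A)"
      by (rule Lim_null_comparison[rotated, OF tendsto_rabs_zero]) (simp add: fA(1)[OF AS])
    then show ?thesis
      using 3 fA[OF AS] by (simp add: has_field_derivative_iff)
  qed
qed

lemma cutoff_continuous:
  fixes f :: "real \<Rightarrow> real"
  assumes "continuous_on S f" "A \<in> S \<Longrightarrow> f A = 0"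
  shows "continuous_on S (\<lambda>x. if x \<le> A then f x else 0)"
proof -
  have "continuous_on ({x \<in> S. x \<le> A} \<union> {x \<in> S. A \<le> x}) (\<lambda>x. if x \<le> A then f x else 0)"
  proof (rule continuous_on_cases_local)
    show "closedin (top_of_set ({x \<in> S. x \<le> A} \<union> {x \<in> S. A \<le> x})) {x \<in> S. x \<le> A}"
      by (rule closedin_closed_Int[of "{..A}", THEN back_subst[of "closedin _"]]) auto
    show "closedin (top_of_set ({x \<in> S. x \<le> A} \<union> {x \<in> S. A \<le> x})) {x \<in> S. A \<le> x}"
      by (rule closedin_closed_Int[of "{A..}", THEN back_subst[of "closedin _"]]) auto
  qed (use assms in \<open>auto intro: continuous_on_subset\<close>)
  moreover have "{x \<in> S. x \<le> A} \<union> {x \<in> S. A \<le> x} = S" by auto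
  ultimately show ?thesis by simp
qed

section \<open>Products of gradients on the manifold\<close>

context manifold
begin

definition C1N :: "('a \<Rightarrow> real) \<Rightarrow> bool" where
  "C1N f \<longleftrightarrow> (\<forall>c\<in>P. C1 (rimg c) (\<lambda>y. f (rinv c y)))"

lemma C1N_D: "C1N f \<Longrightarrow> c \<in> P \<Longrightarrow> C1 (rimg c) (\<lambda>y. f (rinv c y))"
  by (simp add: C1N_def)

lemma C1N_continuous: "C1N f \<Longrightarrow> continuous_on N f"
  by (rule continuous_on_N) (rule C1_continuous_on[OF C1N_D])

definition grad :: "('a, real ^ 'n) rchart \<Rightarrow> ('a \<Rightarrow> real) \<Rightarrow> real ^ 'n \<Rightarrow> real ^ 'n" where
  "grad c f y = sharp (rmet c y) (frechet_derivative (\<lambda>y. f (rinv c y)) (at y))"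

text \<open>
  $\langle\nabla u,\nabla f\rangle=df(\nabla u)$ at a point, computed in an arbitrarily chosen chart.
\<close>

definition pair :: "('a \<Rightarrow> real) \<Rightarrow> ('a \<Rightarrow> real) \<Rightarrow> 'a \<Rightarrow> real" where
  "pair u f x = (let c = (SOME c. c \<in> P \<and> x \<in> rdom c); y = rcoord c x
     in frechet_derivative (\<lambda>y. f (rinv c y)) (at y) (grad c u y))"

text \<open>
  The differential of the coordinate change is an isometry of tangent spaces; hence it maps the gradient
  in one chart to the gradient in the other.
\<close>

lemma pair_chart_independent:
  assumes u: "C1N u" and f: "C1N f" and c: "c \<in> P" and d: "d \<in> P" and y: "y \<in> rcoord c ` (rdom c \<inter> rdom d)"
  defines "y' \<equiv> transition c d y"
  shows "frechet_derivative (\<lambda>y. f (rinv c y)) (at y) (grad c u y) = frechet_derivative (\<lambda>y. f (rinv d y)) (at y') (grad d u y')"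
proof -
  let ?V = "rcoord c ` (rdom c \<inter> rdom d)" and ?T = "frechet_derivative (transition c d) (at y)"
  have oV: "open ?V" by (rule open_overlap[OF c d])
  have t: "C1 ?V (transition c d)" by (rule smooth_on_C1(1)[OF trans_smooth[OF c d]])
  have yc: "y \<in> rimg c" and yd: "y' \<in> rimg d"
    using transition_facts[OF c d y] by (auto simp: y'_def)
  have T: "linear ?T"
    by (rule has_derivative_linear[OF C1_has_derivative[OF t y]])
  have chain: "frechet_derivative (\<lambda>y. h (rinv c y)) (at y) = (\<lambda>v. frechet_derivative (\<lambda>y. h (rinv d y)) (at y') (?T v))" if h: "C1N h" for h
  proof -
    have "((\<lambda>y. h (rinv d (transition c d y))) has_derivative (\<lambda>v. frechet_derivative (\<lambda>y. h (rinv d y)) (at y') (?T v))) (at y)"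
      unfolding y'_def by (rule has_derivative_compose[OF C1_has_derivative[OF t y] C1_has_derivative[OF C1N_D[OF h d] yd[unfolded y'_def]]])
    then have "((\<lambda>y. h (rinv c y)) has_derivative (\<lambda>v. frechet_derivative (\<lambda>y. h (rinv d y)) (at y') (?T v))) (at y)"
      by (rule has_derivative_transform_within_open[OF _ oV y]) (simp add: transition_facts(5)[OF c d])
    from frechet_derivative_at[OF this, symmetric] show ?thesis .
  qed
  have met: "rmet c y v w = rmet d y' (?T v) (?T w)" for v w
    unfolding y'_def by (rule met_trans[OF c d y])
  have "?T v = 0 \<Longrightarrow> v = 0" for v
  proof (rule ccontr)
    assume "?T v = 0" "v \<noteq> 0"
    then have "rmet d y' 0 0 > 0"
      using met[of v v] positive_inner_pos[OF met_pos[OF c yc], of v] by simp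
    then show False
      using linear_0[OF positive_inner_linear(1)[OF met_pos[OF d yd]]] by simp
  qed
  then have "surj ?T"
    using linear_injective_imp_surjective[OF T] linear_injective_0[OF T] by blast
  have lin: "linear (frechet_derivative (\<lambda>y. u (rinv c y)) (at y))"
    by (rule has_derivative_linear[OF C1_has_derivative[OF C1N_D[OF u c] yc]])
  have "grad d u y' = ?T (grad c u y)"
    unfolding grad_def[of d]
  proof (rule sharp_eqI[OF met_pos[OF d yd]])
    fix w
    obtain w' where w: "w = ?T w'"
      using \<open>surj ?T\<close> by (metis surjD)
    show "rmet d y' (?T (grad c u y)) w = frechet_derivative (\<lambda>y. u (rinv d y)) (at y') w"
      unfolding w met[symmetric] grad_def sharp_apply[OF met_pos[OF c yc] lin] by (simp add: chain[OF u])
  qed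
  then show ?thesis
    by (simp add: chain[OF f])
qed

lemma pair_eq:
  assumes u: "C1N u" and f: "C1N f" and c: "c \<in> P" and y: "y \<in> rimg c"
  shows "pair u f (rinv c y) = frechet_derivative (\<lambda>y. f (rinv c y)) (at y) (grad c u y)"
proof -
  define d where "d = (SOME d. d \<in> P \<and> rinv c y \<in> rdom d)"
  have d: "d \<in> P" "rinv c y \<in> rdom d"
    using someI[of "\<lambda>d. d \<in> P \<and> rinv c y \<in> rdom d" c] c rinv_in[OF c y] by (auto simp: d_def)
  have o: "y \<in> rcoord c ` (rdom c \<inter> rdom d)"
    by (rule in_overlap[OF c d(1) y d(2)])
  have "pair u f (rinv c y) = frechet_derivative (\<lambda>y. f (rinv d y)) (at (rcoord d (rinv c y))) (grad d u (rcoord d (rinv c y)))"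
    by (simp add: pair_def d_def Let_def)
  also have "\<dots> = frechet_derivative (\<lambda>y. f (rinv c y)) (at y) (grad c u y)"
    using pair_chart_independent[OF u f c d(1) o] by (simp add: transition_facts(1)[OF c d(1) o])
  finally show ?thesis .
qed

lemma C1N_mult: "C1N f \<Longrightarrow> C1N h \<Longrightarrow> C1N (\<lambda>x. f x * h x)"
  and C1N_sum: "(\<And>i. i \<in> I \<Longrightarrow> C1N (F i)) \<Longrightarrow> C1N (\<lambda>x. \<Sum>i\<in>I. F i x)"
  by (auto simp: C1N_def intro!: C1_add C1_mult C1_sum)

lemma C1N_divide:
  assumes "C1N f" "C1N h" "\<And>x. x \<in> N \<Longrightarrow> h x \<noteq> 0"
  shows "C1N (\<lambda>x. f x / h x)"
  unfolding C1N_def using assms C1N_D rinv_N by (auto intro!: C1_divide)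

lemma C1N_compose:
  assumes g: "C1 T g" and u: "C1N u" and T: "\<And>x. x \<in> N \<Longrightarrow> u x \<in> T"
  shows "C1N (\<lambda>x. g (u x))"
  unfolding C1N_def using T rinv_N by (auto intro!: C1_compose[OF g] C1N_D[OF u])

lemma in_chart:
  assumes "x \<in> N"
  obtains c y where "c \<in> P" "y \<in> rimg c" "x = rinv c y"
proof -
  obtain c where c: "c \<in> P" "x \<in> rdom c"
    using assms unfolding atlas[symmetric] by blast
  then show thesis
    using that[OF c(1) rcoord_in[OF c]] rinv_rcoord[OF c] by simp
qed

lemma pair_sum:
  assumes u: "C1N u" and F: "\<And>i. i \<in> I \<Longrightarrow> C1N (F i)" and x: "x \<in> N"
  shows "pair u (\<lambda>x. \<Sum>i\<in>I. F i x) x = (\<Sum>i\<in>I. pair u (F i) x)"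
proof -
  obtain c y where c: "c \<in> P" "y \<in> rimg c" "x = rinv c y"
    by (rule in_chart[OF x])
  have "((\<lambda>y. \<Sum>i\<in>I. F i (rinv c y)) has_derivative (\<lambda>v. \<Sum>i\<in>I. frechet_derivative (\<lambda>y. F i (rinv c y)) (at y) v)) (at y)"
    by (rule has_derivative_sum) (rule C1_has_derivative[OF C1N_D[OF F c(1)] c(2)])
  from frechet_derivative_at[OF this, symmetric] show ?thesis
    by (simp add: c(3) pair_eq[OF u C1N_sum[of I F] c(1,2)] F pair_eq[OF u F c(1,2)])
qed

lemma pair_compose:
  assumes u: "C1N u" and g: "\<And>r. r \<in> T \<Longrightarrow> (g has_real_derivative g' r) (at r)" "continuous_on T g'"
    and T: "\<And>x. x \<in> N \<Longrightarrow> u x \<in> T" and x: "x \<in> N"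
  shows "pair u (\<lambda>x. g (u x)) x = g' (u x) * pair u u x"
proof -
  obtain c y where c: "c \<in> P" "y \<in> rimg c" "x = rinv c y"
    by (rule in_chart[OF x])
  have "((\<lambda>y. g (u (rinv c y))) has_derivative (\<lambda>v. g' (u (rinv c y)) * frechet_derivative (\<lambda>y. u (rinv c y)) (at y) v)) (at y)"
    using g(1)[OF T[OF x]]
    by (intro has_derivative_compose[OF C1_has_derivative[OF C1N_D[OF u c(1)] c(2)]]) (simp add: has_field_derivative_def c(3))
  from frechet_derivative_at[OF this, symmetric] show ?thesis
    by (simp add: c(3) pair_eq[OF u C1N_compose[OF C1_real[OF g] u T] c(1,2)] pair_eq[OF u u c(1,2)])
qed

lemma pair_cong:
  assumes u: "C1N u" and f: "C1N f" "C1N h" and eq: "\<And>x. x \<in> N \<Longrightarrow> f x = h x" and x: "x \<in> N"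
  shows "pair u f x = pair u h x"
proof -
  obtain c y where c: "c \<in> P" "y \<in> rimg c" "x = rinv c y"
    by (rule in_chart[OF x])
  have "frechet_derivative (\<lambda>y. f (rinv c y)) (at y) = frechet_derivative (\<lambda>y. h (rinv c y)) (at y)"
    by (rule C1_frechet_eq[OF open_rimg[OF c(1)] c(2)]) (simp add: eq rinv_N[OF c(1)])
  then show ?thesis
    by (simp add: c(3) pair_eq[OF u f(1) c(1,2)] pair_eq[OF u f(2) c(1,2)])
qed

lemma pair_self_nonneg:
  assumes u: "C1N u" and x: "x \<in> N"
  shows "pair u u x \<ge> 0"
proof -
  obtain c y where c: "c \<in> P" "y \<in> rimg c" "x = rinv c y"
    by (rule in_chart[OF x])
  have lin: "linear (frechet_derivative (\<lambda>y. u (rinv c y)) (at y))"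
    by (rule has_derivative_linear[OF C1_has_derivative[OF C1N_D[OF u c(1)] c(2)]])
  have "rmet c y (grad c u y) (grad c u y) = frechet_derivative (\<lambda>y. u (rinv c y)) (at y) (grad c u y)"
    by (subst (1) grad_def) (rule sharp_apply[OF met_pos[OF c(1,2)] lin])
  then show ?thesis
    using positive_inner_nonneg[OF met_pos[OF c(1,2)], of "grad c u y"] by (simp add: c(3) pair_eq[OF u u c(1,2)])
qed

lemma pair_self_at_maximum:
  assumes u: "C1N u" and x: "x \<in> N" and max: "\<And>x'. x' \<in> N \<Longrightarrow> u x' \<le> u x"
  shows "pair u u x = 0"
proof -
  obtain c y where c: "c \<in> P" "y \<in> rimg c" "x = rinv c y"
    by (rule in_chart[OF x])
  have "frechet_derivative (\<lambda>y. u (rinv c y)) (at y) = (\<lambda>v. 0)"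
    by (rule differential_zero_maxmin[OF c(2) open_rimg[OF c(1)] C1_has_derivative[OF C1N_D[OF u c(1)] c(2)]])
      (use max rinv_N[OF c(1)] c(3) in auto)
  then show ?thesis
    by (simp add: c(3) pair_eq[OF u u c(1,2)])
qed

end

section \<open>Integration over the manifold\<close>

context covered_manifold
begin

abbreviation "vol_N \<equiv> volume_measure TYPE(real ^ 'n) P N"

lemma sets_vol_N: "sets vol_N = sets (restrict_space borel N)"
  and space_vol_N: "space vol_N = N"
  using base.sets_volume_measure base.space_volume_measure by auto

lemma compact_N: "compact N"
proof -
  have "compact (\<Union>j<m. rinv (cc j) ` cball (ctr j) (rad j))"
    by (intro compact_UN compact_continuous_image continuous_on_subset[OF rinv_cont[OF cP]] cb) auto
  moreover have "(\<Union>j<m. rinv (cc j) ` cball (ctr j) (rad j)) = N"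
  proof
    show "(\<Union>j<m. rinv (cc j) ` cball (ctr j) (rad j)) \<subseteq> N"
      using cb rinv_N[OF cP] by blast
    show "N \<subseteq> (\<Union>j<m. rinv (cc j) ` cball (ctr j) (rad j))"
      by (subst Ncover) (use ball_subset_cball in blast)
  qed
  ultimately show ?thesis by simp
qed

lemma continuous_measurable_N: "continuous_on N h \<Longrightarrow> h \<in> borel_measurable vol_N" for h :: "'a \<Rightarrow> real"
  using borel_measurable_continuous_on_restrict measurable_cong_sets[OF sets_vol_N refl] by blast

lemma emeasure_vol_N_finite: "emeasure vol_N N < \<infinity>"
proof -
  have fin: "(\<integral>\<^sup>+y. 1 * (ennreal (base.\<rho> j y) * indicator (base.piece j) y) \<partial>lborel) < \<infinity>" if j: "j < m" for j
  proof -
    let ?K = "cball (ctr j) (rad j)"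
    have "continuous_on ?K (\<lambda>y. sqrt (gram_det (rmet (cc j) y)))"
      by (intro continuous_on_real_sqrt continuous_on_gram_det
          continuous_on_subset[OF C1_continuous_on[OF smooth_on_C1(1)[OF met_smooth[OF cP[OF j]]]] cb[OF j]])
    then obtain B where B: "\<And>y. y \<in> ?K \<Longrightarrow> \<bar>sqrt (gram_det (rmet (cc j) y))\<bar> \<le> B"
      using compact_imp_bounded[OF compact_continuous_image[OF _ compact_cball]] by (fastforce simp: bounded_iff)
    have "(\<integral>\<^sup>+y. 1 * (ennreal (base.\<rho> j y) * indicator (base.piece j) y) \<partial>lborel)
       \<le> (\<integral>\<^sup>+y. ennreal B * indicator ?K y \<partial>lborel)"
    proof (rule nn_integral_mono)
      fix y
      show "1 * (ennreal (base.\<rho> j y) * indicator (base.piece j) y) \<le> ennreal B * indicator ?K y"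
      proof (cases "y \<in> base.piece j")
        case True
        then have "y \<in> ?K"
          using base.piece_subset[of j] by (auto simp: Dj_def)
        then show ?thesis
          using True B by (auto simp: area_density_def induced_ident intro!: ennreal_leI dest: abs_le_D1)
      qed simp
    qed
    also have "\<dots> = ennreal B * emeasure lborel ?K"
      by (simp add: nn_integral_cmult_indicator)
    also have "\<dots> < \<infinity>"
      using emeasure_lborel_cball_finite[of "ctr j" "rad j"] by (auto simp: ennreal_mult_less_top)
    finally show ?thesis .
  qed
  have "emeasure vol_N N = (\<integral>\<^sup>+x. 1 \<partial>vol_N)"
    by (simp add: space_vol_N)
  also have "\<dots> = (\<Sum>j<m. \<integral>\<^sup>+y. 1 * (ennreal (base.\<rho> j y) * indicator (base.piece j) y) \<partial>lborel)"
    by (rule base.nn_integral_volume_measure) simp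
  also have "\<dots> < \<infinity>"
    using fin by simp
  finally show ?thesis .
qed

sublocale vN: finite_measure vol_N
  using emeasure_vol_N_finite by (intro finite_measureI) (simp add: space_vol_N)

lemma continuous_integrable_N:
  fixes h :: "'a \<Rightarrow> real"
  assumes "continuous_on N h"
  shows "integrable vol_N h"
proof -
  obtain B where "\<And>x. x \<in> N \<Longrightarrow> \<bar>h x\<bar> \<le> B"
    using compact_imp_bounded[OF compact_continuous_image[OF assms compact_N]] by (auto simp: bounded_iff)
  then show ?thesis
    using continuous_measurable_N[OF assms]
    by (intro vN.integrable_const_bound[of _ B] AE_I2) (auto simp: space_vol_N)
qed

text \<open>
  Put the chart \<open>c\<close> in front of the chosen cover. The first piece is then the whole image of \<open>c\<close>, and
  the integrals over the other pieces vanish.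
\<close>

lemma nn_integral_chart:
  assumes c: "c \<in> P" and F: "F \<in> borel_measurable (restrict_space borel N)" and zero: "\<And>x. x \<in> N - rdom c \<Longrightarrow> F x = 0"
  shows "(\<integral>\<^sup>+x. F x \<partial>vol_N) = (\<integral>\<^sup>+y. F (rinv c y) * (ennreal (sqrt (gram_det (rmet c y))) * indicator (rimg c) y) \<partial>lborel)"
proof -
  let ?ch = "case_nat c cc" and ?D = "case_nat (rimg c) Dj"
  have im: "rinv c ` rimg c = rdom c"
    using homeomorphism_image2[OF chart_hom[OF c]] .
  have "chart_cover P N (Suc m) ?ch ?D (\<lambda>_ y. y)"
  proof (rule chart_cover_charts)
    show "?ch j \<in> P" "open (?D j)" "?D j \<subseteq> rimg (?ch j)" if "j < Suc m" for j
      using that c cP Dj open_rimg[OF c] by (auto split: nat.split)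
    have "(\<Union>j<Suc m. rinv (?ch j) ` ?D j) = rinv c ` rimg c \<union> (\<Union>j<m. rinv (cc j) ` Dj j)"
      by (auto simp: lessThan_Suc_eq_insert_0)
    also have "(\<Union>j<m. rinv (cc j) ` Dj j) = N"
      using Ncover by (simp only: Dj_def)
    finally show "N = (\<Union>j<Suc m. rinv (?ch j) ` ?D j)"
      using rdom_sub[OF c] im by auto
  qed
  then interpret E: chart_cover P N "Suc m" ?ch ?D "\<lambda>_ y. y" .
  have p0: "E.piece 0 = rimg c"
    by (auto simp: E.piece_def)
  have "(\<integral>\<^sup>+x. F x \<partial>vol_N) = (\<Sum>j<Suc m. \<integral>\<^sup>+y. F (param (?ch j) (\<lambda>y. y) y) * (ennreal (area_density (?ch j) (\<lambda>y. y) y) * indicator (E.piece j) y) \<partial>lborel)"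
    by (rule E.nn_integral_volume_measure[OF F])
  also have "\<dots> = (\<integral>\<^sup>+y. F (param c (\<lambda>y. y) y) * (ennreal (area_density c (\<lambda>y. y) y) * indicator (rimg c) y) \<partial>lborel)
     + (\<Sum>j<m. \<integral>\<^sup>+y. F (param (cc j) (\<lambda>y. y) y) * (ennreal (area_density (cc j) (\<lambda>y. y) y) * indicator (E.piece (Suc j)) y) \<partial>lborel)"
    by (simp only: sum.lessThan_Suc_shift p0 nat.case)
  also have "(\<Sum>j<m. \<integral>\<^sup>+y. F (param (cc j) (\<lambda>y. y) y) * (ennreal (area_density (cc j) (\<lambda>y. y) y) * indicator (E.piece (Suc j)) y) \<partial>lborel) = 0"
  proof (rule sum.neutral, rule ballI)
    fix j assume "j \<in> {..<m}"
    then have j: "j < m" by simp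
    have "F (param (cc j) (\<lambda>y. y) y) = 0" if y: "y \<in> E.piece (Suc j)" for y
    proof (rule zero)
      have "param (cc j) (\<lambda>y. y) y \<notin> rinv c ` rimg c" "y \<in> Dj j"
        using y by (auto simp: E.piece_def param_def comp_def)
      then show "param (cc j) (\<lambda>y. y) y \<in> N - rdom c"
        using im rinv_N[OF cP[OF j]] Dj(2)[OF j] by (auto simp: param_def)
    qed
    then have z: "F (param (cc j) (\<lambda>y. y) y) * (ennreal (area_density (cc j) (\<lambda>y. y) y) * indicator (E.piece (Suc j)) y) = 0" for y
      by (cases "y \<in> E.piece (Suc j)") auto
    show "(\<integral>\<^sup>+y. F (param (cc j) (\<lambda>y. y) y) * (ennreal (area_density (cc j) (\<lambda>y. y) y) * indicator (E.piece (Suc j)) y) \<partial>lborel) = 0"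
      unfolding z by simp
  qed
  finally show ?thesis
    by (simp add: param_def comp_def area_density_def induced_ident)
qed

text \<open>
  The positive and the negative part of \<open>h\<close> are both covered by the formula for nonnegative functions.
\<close>

lemma integral_chart:
  fixes h :: "'a \<Rightarrow> real"
  assumes c: "c \<in> P" and h: "continuous_on N h" and zero: "\<And>x. x \<in> N - rdom c \<Longrightarrow> h x = 0"
  defines "f \<equiv> \<lambda>y. indicator (rimg c) y * (h (rinv c y) * sqrt (gram_det (rmet c y)))"
  shows "integrable lborel f" "(\<integral>x. h x \<partial>vol_N) = (\<integral>y. f y \<partial>lborel)"
proof -
  have hm: "h \<in> borel_measurable (restrict_space borel N)"
    by (rule borel_measurable_continuous_on_restrict[OF h])
  have hi: "integrable vol_N h"
    by (rule continuous_integrable_N[OF h])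
  have fm: "f \<in> borel_measurable lborel"
  proof -
    have "continuous_on (rimg c) (\<lambda>y. h (rinv c y) * sqrt (gram_det (rmet c y)))"
      by (intro continuous_on_mult continuous_on_real_sqrt continuous_on_gram_det continuous_on_compose2[OF h rinv_cont[OF c]]
          C1_continuous_on[OF smooth_on_C1(1)[OF met_smooth[OF c]]]) (use rinv_N[OF c] in auto)
    from borel_measurable_open_indicator[OF open_rimg[OF c] this] show ?thesis
      by (simp add: f_def mult.commute)
  qed
  have nn: "(\<integral>\<^sup>+x. ennreal (k * h x) \<partial>vol_N) = (\<integral>\<^sup>+y. ennreal (k * f y) \<partial>lborel)" if "k = 1 \<or> k = -1" for k :: real
  proof -
    have "(\<integral>\<^sup>+x. ennreal (k * h x) \<partial>vol_N) = (\<integral>\<^sup>+y. ennreal (k * h (rinv c y)) * (ennreal (sqrt (gram_det (rmet c y))) * indicator (rimg c) y) \<partial>lborel)"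
      by (rule nn_integral_chart[OF c]) (use hm zero in auto)
    also have "\<dots> = (\<integral>\<^sup>+y. ennreal (k * f y) \<partial>lborel)"
    proof (rule nn_integral_cong)
      fix y
      show "ennreal (k * h (rinv c y)) * (ennreal (sqrt (gram_det (rmet c y))) * indicator (rimg c) y) = ennreal (k * f y)"
      proof (cases "y \<in> rimg c")
        case True
        then have "0 \<le> sqrt (gram_det (rmet c y))"
          using gram_det_pos[OF met_pos[OF c True]] by simp
        from ennreal_mult''[OF this, of "k * h (rinv c y)"] True show ?thesis
          by (simp add: f_def mult_ac)
      qed (simp add: f_def)
    qed
    finally show ?thesis .
  qed
  have nn1: "(\<integral>\<^sup>+x. ennreal (h x) \<partial>vol_N) = (\<integral>\<^sup>+y. ennreal (f y) \<partial>lborel)"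
    and nn2: "(\<integral>\<^sup>+x. ennreal (- h x) \<partial>vol_N) = (\<integral>\<^sup>+y. ennreal (- f y) \<partial>lborel)"
    using nn[of 1] nn[of "-1"] by simp_all
  show fi: "integrable lborel f"
    using hi fm nn1 nn2 by (simp add: real_integrable_def)
  show "(\<integral>x. h x \<partial>vol_N) = (\<integral>y. f y \<partial>lborel)"
    by (simp add: real_lebesgue_integral_def[OF hi] real_lebesgue_integral_def[OF fi] nn1 nn2)
qed

section \<open>A partition of unity\<close>

text \<open>
  $(|y-y_j|^2-R_j^2)^2$ inside the \<open>j\<close>-th ball and zero outside, a function of
  class $C^1$ that is positive exactly on the open ball.
\<close>

definition bump :: "nat \<Rightarrow> 'a \<Rightarrow> real" where
  "bump j x = (if x \<in> rdom (cc j) then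
     (let t = (rcoord (cc j) x - ctr j) \<bullet> (rcoord (cc j) x - ctr j) - (rad j)\<^sup>2 in if t \<le> 0 then t\<^sup>2 else 0) else 0)"

lemma C1_bump_coord: "C1 UNIV (\<lambda>y :: real ^ 'n. let t = (y - p) \<bullet> (y - p) - R in if t \<le> 0 then t\<^sup>2 else (0::real))"
proof -
  have "C1 UNIV (\<lambda>t::real. if t \<le> 0 then t\<^sup>2 else 0)"
    by (rule C1_real[where \<phi>' = "\<lambda>t. if t \<le> 0 then 2 * t else 0"], rule cutoff_has_derivative[where S = UNIV])
      (auto intro!: derivative_eq_intros cutoff_continuous continuous_intros)
  moreover have "C1 UNIV (\<lambda>y. (y - p) \<bullet> (y - p) - R)"
    by (rule C1I[where f' = "\<lambda>y v. (y - p) \<bullet> v + v \<bullet> (y - p)"]) (auto intro!: derivative_eq_intros continuous_intros)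
  ultimately show ?thesis
    unfolding Let_def by (rule C1_compose) auto
qed

lemma in_ball_iff: "(y - p) \<bullet> (y - p) - R\<^sup>2 \<le> 0 \<longleftrightarrow> y \<in> cball p R" "(y - p) \<bullet> (y - p) - R\<^sup>2 < 0 \<longleftrightarrow> y \<in> ball p R"
  if "R > 0" for y p :: "real ^ 'n" and R :: real
proof -
  have e: "(y - p) \<bullet> (y - p) = (dist p y)\<^sup>2"
    by (simp add: dist_norm norm_minus_commute dot_square_norm)
  show "(y - p) \<bullet> (y - p) - R\<^sup>2 \<le> 0 \<longleftrightarrow> y \<in> cball p R"
    unfolding e using that by (simp add: power2_le_iff_abs_le)
  show "(y - p) \<bullet> (y - p) - R\<^sup>2 < 0 \<longleftrightarrow> y \<in> ball p R"
    unfolding e using that by (auto intro: power_strict_mono power_less_imp_less_base)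
qed

text \<open>
  In another chart, cover the image by the overlap with the \<open>j\<close>-th chart and by the complement of the
  closed ball, where the function vanishes. The complement is open since compact subsets of the
  manifold are closed, and for this the Hausdorff property is essential.
\<close>

lemma C1N_bump:
  assumes j: "j < m"
  shows "C1N (bump j)"
  unfolding C1N_def
proof
  fix d assume d: "d \<in> P"
  let ?b = "\<lambda>y. let t = (y - ctr j) \<bullet> (y - ctr j) - (rad j)\<^sup>2 in if t \<le> 0 then t\<^sup>2 else (0::real)"
  let ?K = "rinv (cc j) ` cball (ctr j) (rad j)"
  note c = cP[OF j]
  define V1 where "V1 = rcoord d ` (rdom d \<inter> rdom (cc j))"
  define V2 where "V2 = {y \<in> rimg d. rinv d y \<notin> ?K}"
  have oV1: "open V1"
    unfolding V1_def by (rule open_overlap[OF d c])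
  have K: "compact ?K" "?K \<subseteq> N"
    using cb[OF j] rinv_N[OF c] by (auto intro!: compact_continuous_image continuous_on_subset[OF rinv_cont[OF c]])
  have "Hausdorff_space (top_of_set N)"
    using rm by (simp add: riemannian_manifold_def)
  then have "closedin (top_of_set N) ?K"
    using K by (intro compactin_imp_closedin) (auto simp: compactin_subtopology)
  then have "openin (top_of_set N) (N - ?K)"
    by (simp add: openin_diff)
  then obtain T where T: "open T" "N - ?K = N \<inter> T"
    by (auto simp: openin_open)
  have "V2 = rimg d \<inter> rinv d -` T"
    using T(2) rinv_N[OF d] by (auto simp: V2_def)
  then have oV2: "open V2"
    using continuous_openin_preimage_gen[OF rinv_cont[OF d] T(1)] open_rimg[OF d] by (simp add: openin_open_eq)
  have c1: "C1 V1 (\<lambda>y. ?b (transition d (cc j) y))"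
    unfolding V1_def by (rule C1_compose[OF C1_bump_coord smooth_on_C1(1)[OF trans_smooth[OF d c]]]) simp
  have e1: "?b (transition d (cc j) y) = bump j (rinv d y)" if "y \<in> V1" for y
    using transition_facts(1,2)[OF d c that[unfolded V1_def]] by (simp add: bump_def)
  have 1: "C1 V1 (\<lambda>y. bump j (rinv d y))"
    by (rule C1_cong[where f = "\<lambda>y. ?b (transition d (cc j) y)" and g = "\<lambda>y. bump j (rinv d y)", OF oV1 e1 c1])
  have 2: "C1 V2 (\<lambda>y. bump j (rinv d y))"
  proof (rule C1_cong[where f = "\<lambda>_. 0", OF oV2 _ C1_const])
    fix y assume y: "y \<in> V2"
    show "0 = bump j (rinv d y)"
    proof (cases "rinv d y \<in> rdom (cc j)")
      case True
      then have "rcoord (cc j) (rinv d y) \<notin> cball (ctr j) (rad j)"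
        using y imageI[of "rcoord (cc j) (rinv d y)" "cball (ctr j) (rad j)" "rinv (cc j)"] rinv_rcoord[OF c True]
        by (auto simp: V2_def)
      then show ?thesis
        using in_ball_iff(1)[OF rad[OF j], of "rcoord (cc j) (rinv d y)" "ctr j"] by (simp add: bump_def)
    qed (simp add: bump_def)
  qed
  have "rimg d = V1 \<union> V2"
  proof -
    have "y \<in> V1" if "y \<in> rimg d" "rinv d y \<in> ?K" for y
      using in_overlap[OF d c that(1)] that(2) rinv_in[OF c] cb[OF j] by (auto simp: V1_def)
    moreover have "V1 \<subseteq> rimg d"
      using rcoord_in[OF d] by (auto simp: V1_def)
    ultimately show ?thesis
      by (auto simp: V2_def)
  qed
  then show "C1 (rimg d) (\<lambda>y. bump j (rinv d y))"
    using C1_Un[OF oV1 oV2 1 2] by simp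
qed

lemma bump_nonneg: "bump j x \<ge> 0"
  by (simp add: bump_def Let_def)

lemma bump_zero:
  assumes j: "j < m" and y: "y \<in> rimg (cc j)" "y \<notin> cball (ctr j) (rad j)"
  shows "bump j (rinv (cc j) y) = 0"
  using in_ball_iff(1)[OF rad[OF j], of y "ctr j"] y rinv_in[OF cP[OF j]] rcoord_rinv[OF cP[OF j]] by (simp add: bump_def)

lemma bump_pos:
  assumes x: "x \<in> N"
  shows "(\<Sum>j<m. bump j x) > 0"
proof -
  obtain j y where j: "j < m" "y \<in> ball (ctr j) (rad j)" "x = rinv (cc j) y"
    using x Ncover by auto
  then have y: "y \<in> rimg (cc j)"
    using cb[OF j(1)] ball_subset_cball by blast
  have "(y - ctr j) \<bullet> (y - ctr j) - (rad j)\<^sup>2 < 0"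
    using in_ball_iff(2)[OF rad[OF j(1)]] j(2) by simp
  then have "bump j x > 0"
    using rinv_in[OF cP[OF j(1)] y] rcoord_rinv[OF cP[OF j(1)] y] by (simp add: bump_def j(3))
  then show ?thesis
    using j(1) bump_nonneg by (intro sum_pos2[of _ j]) auto
qed

definition "chi j x = bump j x / (\<Sum>i<m. bump i x)"

lemma C1N_chi: "j < m \<Longrightarrow> C1N (chi j)"
  unfolding chi_def using bump_pos by (intro C1N_divide C1N_bump C1N_sum) (auto simp: less_imp_neq[symmetric])

lemma chi_nonneg: "chi j x \<ge> 0"
  by (simp add: chi_def bump_nonneg sum_nonneg)

lemma sum_chi: "x \<in> N \<Longrightarrow> (\<Sum>j<m. chi j x) = 1"
  using bump_pos[of x] by (simp add: chi_def sum_divide_distrib[symmetric])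

end

section \<open>The flux inequality for mean convex graphs\<close>

locale star_graph = covered_manifold N P m cc ctr rad
  for N :: "'a::topological_space set" and P :: "('a, real ^ 'n) rchart set" and m cc ctr rad +
  fixes lam :: "real \<Rightarrow> real" and a :: real and u :: "'a \<Rightarrow> real"
  assumes lamc: "continuous_on {a..} lam" and lsm: "smooth_on {a<..} lam"
    and lpos: "\<And>r. a < r \<Longrightarrow> lam r > 0" and l1pos: "\<And>r. a < r \<Longrightarrow> deriv lam r > 0"
    and l2nn: "\<And>r. a < r \<Longrightarrow> deriv (deriv lam) r \<ge> 0"
    and usm: "\<And>c. c \<in> P \<Longrightarrow> smooth_on (rimg c) (\<lambda>y. u (rinv c y))" and ua: "\<And>x. x \<in> N \<Longrightarrow> a < u x"
    and mc: "mean_convex (warped_product a lam P) ((\<lambda>x. (u x, x)) ` N)"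
begin

lemma C1N_u: "C1N u"
  using usm smooth_on_C1(1) by (auto simp: C1N_def)

definition "Q x = pair u u x"
definition "s x = (lam (u x))\<^sup>2 + Q x"

lemma Q_nonneg: "x \<in> N \<Longrightarrow> Q x \<ge> 0"
  unfolding Q_def by (rule pair_self_nonneg[OF C1N_u])

lemma s_pos: "x \<in> N \<Longrightarrow> s x > 0"
  using lpos[OF ua] Q_nonneg by (auto simp: s_def intro!: add_pos_nonneg zero_less_power)

lemma graph_chart: "c \<in> P \<Longrightarrow> graph_in_chart (rimg c) (rmet c) (\<lambda>y. u (rinv c y)) lam a"
  by unfold_locales (use open_rimg met_pos met_smooth usm ua rinv_N lsm lpos in auto)

lemma deriv_lam:
  assumes r: "a < r"
  shows "(lam has_real_derivative deriv lam r) (at r)" "(deriv lam has_real_derivative deriv (deriv lam) r) (at r)"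
proof -
  have d: "lam differentiable (at r)" if "a < r" for r
    using smooth_on_C1(1)[OF lsm] that by (auto simp: C1_def)
  then show "(lam has_real_derivative deriv lam r) (at r)"
    using deriv_eq_frechet(2) r by blast
  have "C1 {a<..} (deriv lam)"
    by (rule C1_cong[where f = "\<lambda>x. frechet_derivative lam (at x) 1", OF _ _ smooth_on_C1(2)[OF lsm]])
      (use deriv_eq_frechet(1)[OF d] in auto)
  then have "deriv lam differentiable (at r)"
    using r by (auto simp: C1_def)
  then show "(deriv lam has_real_derivative deriv (deriv lam) r) (at r)"
    by (rule deriv_eq_frechet(2))
qed

lemma continuous_deriv_lam: "continuous_on {a<..} (deriv lam)" "continuous_on {a<..} (deriv (deriv lam))"
proof -
  have d: "lam differentiable (at r)" "deriv lam differentiable (at r)" if "a < r" for r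
    using deriv_lam[OF that] real_differentiable_def by blast+
  have C: "C1 {a<..} (deriv lam)"
    by (rule C1_cong[where f = "\<lambda>x. frechet_derivative lam (at x) 1", OF _ _ smooth_on_C1(2)[OF lsm]])
      (use deriv_eq_frechet(1)[OF d(1)] in auto)
  then show "continuous_on {a<..} (deriv lam)"
    by (rule C1_continuous_on)
  show "continuous_on {a<..} (deriv (deriv lam))"
    by (rule continuous_on_eq[OF C1_continuous_derivative[OF C, of 1]]) (use deriv_eq_frechet(1)[OF d(2)] in auto)
qed

lemma continuous_pair:
  assumes f: "C1N f"
  shows "continuous_on N (pair u f)"
proof (rule continuous_on_N)
  fix c assume c: "c \<in> P"
  interpret g: graph_in_chart "rimg c" "rmet c" "\<lambda>y. u (rinv c y)" lam a
    by (rule graph_chart[OF c])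
  have z: "g.z y = grad c u y" for y
    by (simp add: g.z_def grad_def g.dU_def[abs_def])
  let ?F = "\<lambda>y v. frechet_derivative (\<lambda>y. f (rinv c y)) (at y) v"
  have "continuous_on (rimg c) (\<lambda>y. \<Sum>b\<in>Basis. (g.z y \<bullet> b) * ?F y b)"
    by (intro continuous_on_sum continuous_on_mult continuous_on_inner continuous_on_const
        C1_continuous_on[OF g.C1_z] C1_continuous_derivative[OF C1N_D[OF f c]])
  then show "continuous_on (rimg c) (\<lambda>y. pair u f (rinv c y))"
  proof (rule continuous_on_eq)
    fix y assume y: "y \<in> rimg c"
    show "(\<Sum>b\<in>Basis. (g.z y \<bullet> b) * ?F y b) = pair u f (rinv c y)"
      using g.linear_expand[OF has_derivative_linear[OF C1_has_derivative[OF C1N_D[OF f c] y]], of "g.z y"]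
      by (simp add: pair_eq[OF C1N_u f c y] z)
  qed
qed

lemma continuous_on_u: "continuous_on {a<..} g \<Longrightarrow> continuous_on N (\<lambda>x. g (u x))"
  by (rule continuous_on_compose2[OF _ C1N_continuous[OF C1N_u]]) (use ua in auto)

lemma continuous_lam: "continuous_on {a<..} lam"
  by (rule continuous_on_subset[OF lamc]) auto

lemma continuous_Q: "continuous_on N Q" and continuous_s: "continuous_on N s"
proof -
  show "continuous_on N Q"
    unfolding Q_def[abs_def] by (rule continuous_pair[OF C1N_u])
  then show "continuous_on N s"
    unfolding s_def[abs_def] by (intro continuous_on_add continuous_on_power continuous_on_u continuous_lam)
qed

lemma mean_curvature_pos:
  assumes c: "c \<in> P" and y: "y \<in> rimg c"
  shows "graph_in_chart.H (rmet c) (\<lambda>y. u (rinv c y)) lam y > 0"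
proof -
  interpret g: graph_in_chart "rimg c" "rmet c" "\<lambda>y. u (rinv c y)" lam a
    by (rule graph_chart[OF c])
  let ?d = "warped_chart a lam c"
  have Gm: "g.Gm = rmet ?d"
    by (simp add: g.Gm_def warped_chart_def)
  have X: "g.X = (\<lambda>y. (u (rinv c y), y))"
    by (simp add: g.X_def[abs_def])
  have "local_param ?d ((\<lambda>x. (u x, x)) ` N) (rimg c) g.X"
    unfolding X by (rule local_param_graph(1)[OF c open_rimg[OF c] _ usm[OF c] less_imp_le[OF ua]]) auto
  moreover have "?d \<in> warped_product a lam P"
    using c by (simp add: warped_product_def)
  ultimately show ?thesis
    using mc y g.unit_normal_\<nu>[OF y] unfolding mean_convex_def g.H_def Gm by blast
qed

text \<open>
  For a function \<open>F\<close> supported in one coordinate ball: the divergence of $F\sqrt{\det g}\,\nabla u/\sqrt s$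
  has integral zero, and mean convexity bounds it from above by the integrand in question.
\<close>

lemma local_inequality:
  assumes j: "j < m" and F: "C1N F" and nonneg: "\<And>x. x \<in> N \<Longrightarrow> F x \<ge> 0"
    and supp: "\<And>y. y \<in> rimg (cc j) \<Longrightarrow> y \<notin> cball (ctr j) (rad j) \<Longrightarrow> F (rinv (cc j) y) = 0"
    and off: "\<And>x. x \<in> N - rdom (cc j) \<Longrightarrow> F x = 0" "\<And>x. x \<in> N - rdom (cc j) \<Longrightarrow> pair u F x = 0"
  defines "h \<equiv> \<lambda>x. (F x * (real CARD('n) * lam (u x) * deriv lam (u x)) + pair u F x) / sqrt (s x)"
  shows "continuous_on N h" "(\<integral>x. h x \<partial>vol_N) \<ge> 0"
proof -
  let ?c = "cc j"
  note c = cP[OF j]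
  interpret g: graph_in_chart "rimg ?c" "rmet ?c" "\<lambda>y. u (rinv ?c y)" lam a
    by (rule graph_chart[OF c])
  have z: "g.z y = grad ?c u y" for y
    by (simp add: g.z_def grad_def g.dU_def[abs_def])
  have Q: "g.Q y = Q (rinv ?c y)" if "y \<in> rimg ?c" for y
    by (simp add: g.Q_def Q_def pair_eq[OF C1N_u C1N_u c that] z g.dU_def)
  have s: "g.s y = s (rinv ?c y)" if "y \<in> rimg ?c" for y
    by (simp add: g.s_def s_def Q[OF that])
  show ch: "continuous_on N h"
    unfolding h_def using s_pos
    by (intro continuous_on_divide continuous_on_add continuous_on_mult continuous_on_const continuous_on_real_sqrt
        continuous_s continuous_pair[OF F] C1N_continuous[OF F] continuous_on_u continuous_lam continuous_deriv_lam)
      (auto simp: less_imp_neq[symmetric])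
  have "h x = 0" if "x \<in> N - rdom ?c" for x
    using off[OF that] by (simp add: h_def)
  note I = integral_chart[OF c ch this]
  let ?f = "\<lambda>y. F (rinv ?c y)"
  \<comment> \<open>The components of the field whose divergence is integrated.\<close>
  define Z where "Z b y = ?f y * sqrt (g.G y) / sqrt (g.s y) * (g.z y \<bullet> b)" for b y
  have f: "C1 (rimg ?c) ?f"
    by (rule C1N_D[OF F c])
  have Z: "C1 (rimg ?c) (Z b)" for b
    unfolding Z_def[abs_def] using g.G_pos g.s_pos
    by (intro C1_mult C1_divide f C1_sqrt g.C1_G g.C1_s C1_linear[OF bounded_linear_inner_left g.C1_z])
      (auto simp: less_imp_neq[symmetric])
  have Z0: "Z b y = 0" if "y \<in> rimg ?c - cball (ctr j) (rad j)" for b y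
    using supp that by (simp add: Z_def)
  note div = integral_divergence_zero[OF open_rimg[OF c] compact_cball cb[OF j] Z Z0]
  have le: "indicator (rimg ?c) y * (\<Sum>b\<in>Basis. frechet_derivative (Z b) (at y) b)
      \<le> indicator (rimg ?c) y * (h (rinv ?c y) * sqrt (gram_det (rmet ?c y)))" for y
  proof (cases "y \<in> rimg ?c")
    case True
    let ?L = "lam (u (rinv ?c y))" and ?L1 = "deriv lam (u (rinv ?c y))"
    note yN = rinv_N[OF c True]
    have "g.divz y \<le> real CARD('n) * ?L * ?L1"
    proof -
      have "0 \<le> ?L * sqrt (g.s y) * g.H y"
        using lpos[OF ua[OF yN]] g.s_pos[OF True] mean_curvature_pos[OF c True] by simp
      then show ?thesis
        using g.divz_eq_mean_curvature[OF True] by simp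
    qed
    then have "?f y * g.divz y \<le> ?f y * (real CARD('n) * ?L * ?L1)"
      using nonneg[OF yN] by (rule mult_left_mono)
    then have "sqrt (g.G y) / sqrt (g.s y) * (pair u F (rinv ?c y) + ?f y * g.divz y)
        \<le> sqrt (g.G y) / sqrt (g.s y) * (pair u F (rinv ?c y) + ?f y * (real CARD('n) * ?L * ?L1))"
      using g.G_pos[OF True] g.s_pos[OF True] by (intro mult_left_mono) auto
    moreover have "(\<Sum>b\<in>Basis. frechet_derivative (Z b) (at y) b) = sqrt (g.G y) / sqrt (g.s y) * (pair u F (rinv ?c y) + ?f y * g.divz y)"
      unfolding Z_def[abs_def] g.divergence_formula[OF f True] by (simp add: pair_eq[OF C1N_u F c True] z)
    moreover have "h (rinv ?c y) * sqrt (gram_det (rmet ?c y))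
       = sqrt (g.G y) / sqrt (g.s y) * (pair u F (rinv ?c y) + ?f y * (real CARD('n) * ?L * ?L1))"
      by (simp add: h_def s[OF True] g.G_def field_simps)
    ultimately show ?thesis
      using True by simp
  qed simp
  have "0 = (\<integral>y. indicator (rimg ?c) y * (\<Sum>b\<in>Basis. frechet_derivative (Z b) (at y) b) \<partial>lborel)"
    using div(2) by simp
  also have "\<dots> \<le> (\<integral>y. indicator (rimg ?c) y * (h (rinv ?c y) * sqrt (gram_det (rmet ?c y))) \<partial>lborel)"
    by (rule integral_mono[OF div(1) I(1) le])
  also have "\<dots> = (\<integral>x. h x \<partial>vol_N)"
    using I(2) by simp
  finally show "(\<integral>x. h x \<partial>vol_N) \<ge> 0" .
qed

text \<open>
  Apply the local inequality to $\chi_j\Phi(u)$ and sum over $j$. The derivatives of the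
  partition of unity cancel because $\nabla u$ is paired with $\nabla\sum_j\chi_j\Phi(u)=\nabla\Phi(u)$.
\<close>

theorem weighted_flux_inequality:
  assumes \<Phi>: "\<And>r. a < r \<Longrightarrow> (\<Phi> has_real_derivative \<Phi>' r) (at r)" "continuous_on {a<..} \<Phi>'"
    and nonneg: "\<And>r. a < r \<Longrightarrow> \<Phi> r \<ge> 0"
  shows "(\<integral>x. (\<Phi> (u x) * (real CARD('n) * lam (u x) * deriv lam (u x)) + \<Phi>' (u x) * Q x) / sqrt (s x) \<partial>vol_N) \<ge> 0"
proof -
  have \<Phi>C: "C1 {a<..} \<Phi>"
    by (rule C1_real) (use \<Phi> in auto)
  have \<Phi>u: "C1N (\<lambda>x. \<Phi> (u x))"
    by (rule C1N_compose[OF \<Phi>C C1N_u]) (use ua in auto)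
  define F where "F j x = chi j x * \<Phi> (u x)" for j x
  have F: "C1N (F j)" if "j < m" for j
    unfolding F_def[abs_def] by (intro C1N_mult C1N_chi that \<Phi>u)
  define h where "h j x = (F j x * (real CARD('n) * lam (u x) * deriv lam (u x)) + pair u (F j) x) / sqrt (s x)" for j x
  have b0: "bump j x = 0" if "j < m" "x \<in> N - rdom (cc j)" for j x
    using that by (simp add: bump_def)
  have h: "continuous_on N (h j)" "(\<integral>x. h j x \<partial>vol_N) \<ge> 0" if j: "j < m" for j
  proof -
    have z: "F j (rinv (cc j) y) = 0" if "y \<in> rimg (cc j)" "y \<notin> cball (ctr j) (rad j)" for y
      using bump_zero[OF j that] by (simp add: F_def chi_def)
    have z': "F j x = 0" if "x \<in> N - rdom (cc j)" for x
      using b0[OF j that] by (simp add: F_def chi_def)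
    have z'': "pair u (F j) x = 0" if x: "x \<in> N - rdom (cc j)" for x
    proof -
      \<comment> \<open>\<open>F j\<close> is nonnegative, so its zero \<open>x\<close> is a minimum and its differential vanishes there.\<close>
      obtain d y where d: "d \<in> P" "y \<in> rimg d" "x = rinv d y"
        using in_chart[of x] x by auto
      have "frechet_derivative (\<lambda>y. F j (rinv d y)) (at y) = (\<lambda>v. 0)"
        by (rule differential_zero_maxmin[OF d(2) open_rimg[OF d(1)] C1_has_derivative[OF C1N_D[OF F[OF j] d(1)] d(2)]])
          (use z'[OF x] d(3) chi_nonneg nonneg ua rinv_N[OF d(1)] in \<open>auto simp: F_def\<close>)
      then show ?thesis
        by (simp add: d(3) pair_eq[OF C1N_u F[OF j] d(1,2)])
    qed
    show "continuous_on N (h j)" "(\<integral>x. h j x \<partial>vol_N) \<ge> 0"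
      unfolding h_def[abs_def]
      using local_inequality[OF j F[OF j] _ z z' z''] chi_nonneg nonneg ua by (auto simp: F_def)
  qed
  have eq: "(\<Phi> (u x) * (real CARD('n) * lam (u x) * deriv lam (u x)) + \<Phi>' (u x) * Q x) / sqrt (s x) = (\<Sum>j<m. h j x)" if x: "x \<in> N" for x
  proof -
    have S: "(\<Sum>j<m. F j x) = \<Phi> (u x)" if "x \<in> N" for x
      using sum_chi[OF that] by (simp add: F_def sum_distrib_right[symmetric])
    have "(\<Sum>j<m. pair u (F j) x) = pair u (\<lambda>x. \<Sum>j<m. F j x) x"
      by (rule pair_sum[OF C1N_u _ x, symmetric]) (simp add: F)
    also have "\<dots> = pair u (\<lambda>x. \<Phi> (u x)) x"
      by (rule pair_cong[OF C1N_u C1N_sum \<Phi>u S x]) (simp add: F)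
    also have "\<dots> = \<Phi>' (u x) * Q x"
      unfolding Q_def by (rule pair_compose[OF C1N_u _ \<Phi>(2) _ x]) (use \<Phi>(1) ua in auto)
    finally show ?thesis
      unfolding h_def sum_divide_distrib[symmetric] sum.distrib sum_distrib_right[symmetric] S[OF x] by simp
  qed
  have "(\<integral>x. (\<Phi> (u x) * (real CARD('n) * lam (u x) * deriv lam (u x)) + \<Phi>' (u x) * Q x) / sqrt (s x) \<partial>vol_N) = (\<integral>x. (\<Sum>j<m. h j x) \<partial>vol_N)"
    by (rule Bochner_Integration.integral_cong) (simp_all add: eq space_vol_N)
  also have "\<dots> = (\<Sum>j<m. \<integral>x. h j x \<partial>vol_N)"
    by (rule Bochner_Integration.integral_sum) (use h(1) continuous_integrable_N in auto)
  also have "\<dots> \<ge> 0"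
    using h(2) by (intro sum_nonneg) auto
  finally show ?thesis .
qed

end

section \<open>Areas and volumes in the warped product\<close>

context covered_manifold
begin

text \<open>
  On the graph and on the warped product the cover consists of the lifts of the same balls, with the
  same pieces. Comparing integrals there with integrals over the base therefore reduces to comparing
  densities in each chart.
\<close>

lemma base_integral:
  assumes F: "F \<in> borel_measurable (restrict_space borel N)"
  shows "(\<integral>\<^sup>+x. F x \<partial>vol_N) = (\<Sum>j<m. \<integral>\<^sup>+y. F (rinv (cc j) y) * (ennreal (sqrt (gram_det (rmet (cc j) y))) * indicator (base.piece j) y) \<partial>lborel)"
  using base.nn_integral_volume_measure[OF F] by (simp add: param_def comp_def area_density_def induced_ident)

lemma in_piece: "y \<in> base.piece j \<longleftrightarrow> y \<in> Dj j \<and> (\<forall>i<j. rinv (cc j) y \<notin> rinv (cc i) ` Dj i)"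
  by (auto simp: base.piece_def param_def comp_def)

lemma graph_integral:
  assumes sm: "\<And>c. c \<in> P \<Longrightarrow> smooth_on (rimg c) (\<lambda>y. w (rinv c y))" and wa: "\<And>x. x \<in> N \<Longrightarrow> a \<le> w x"
    and lam: "continuous_on {a..} lam"
  defines "S \<equiv> (\<lambda>x. (w x, x)) ` N"
  shows "sets (warped_area a lam P S) = sets (restrict_space borel S)"
    and "space (warped_area a lam P S) = S"
    and "F \<in> borel_measurable (restrict_space borel S) \<Longrightarrow>
      (\<And>j y. j < m \<Longrightarrow> y \<in> Dj j \<Longrightarrow>
        sqrt (gram_det (\<lambda>v v'. (lam (w (rinv (cc j) y)))\<^sup>2 * rmet (cc j) y v v'
         + frechet_derivative (\<lambda>y. w (rinv (cc j) y)) (at y) v * frechet_derivative (\<lambda>y. w (rinv (cc j) y)) (at y) v'))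
        = D (rinv (cc j) y) * sqrt (gram_det (rmet (cc j) y))) \<Longrightarrow>
      (\<And>x. x \<in> N \<Longrightarrow> D x \<ge> 0) \<Longrightarrow> continuous_on N D \<Longrightarrow>
      (\<integral>\<^sup>+p. F p \<partial>warped_area a lam P S) = (\<integral>\<^sup>+x. F (w x, x) * ennreal (D x) \<partial>vol_N)"
proof -
  let ?d = "\<lambda>j. warped_chart a lam (cc j)" and ?Y = "\<lambda>j y. (w (rinv (cc j) y), y)"
  interpret g: chart_cover "warped_product a lam P" S m ?d Dj ?Y
    unfolding S_def by (rule chart_cover_graph(1)[OF sm wa lam])
  show "sets (warped_area a lam P S) = sets (restrict_space borel S)"
    and "space (warped_area a lam P S) = S"
    using g.sets_volume_measure g.space_volume_measure by (auto simp: warped_area_def)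
  have \<psi>: "param (?d j) (?Y j) y = (w (rinv (cc j) y), rinv (cc j) y)" if "j < m" "y \<in> Dj j" for j y
    by (rule local_param_graph(2)[OF cP[OF that(1)] Dj(1) Dj(2)[OF that(1)] sm[OF cP[OF that(1)]] wa that(2)])
  have piece: "g.piece j = base.piece j" if j: "j < m" for j
  proof -
    have *: "param (?d j) (?Y j) y \<notin> param (?d i) (?Y i) ` Dj i \<longleftrightarrow> rinv (cc j) y \<notin> rinv (cc i) ` Dj i"
      if "y \<in> Dj j" "i < j" for i y
      using \<psi>[OF j that(1)] \<psi>[of i] that j by (auto simp: image_iff)
    have "y \<in> g.piece j \<longleftrightarrow> y \<in> base.piece j" for y
      unfolding g.piece_def in_piece mem_Collect_eq using * by blast
    then show ?thesis by blast
  qed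
  assume F: "F \<in> borel_measurable (restrict_space borel S)"
    and D: "\<And>j y. j < m \<Longrightarrow> y \<in> Dj j \<Longrightarrow>
        sqrt (gram_det (\<lambda>v v'. (lam (w (rinv (cc j) y)))\<^sup>2 * rmet (cc j) y v v'
         + frechet_derivative (\<lambda>y. w (rinv (cc j) y)) (at y) v * frechet_derivative (\<lambda>y. w (rinv (cc j) y)) (at y) v'))
        = D (rinv (cc j) y) * sqrt (gram_det (rmet (cc j) y))"
    and Dn: "\<And>x. x \<in> N \<Longrightarrow> D x \<ge> 0" and Dc: "continuous_on N D"
  have wc: "continuous_on N w"
    by (rule continuous_on_N) (rule C1_continuous_on[OF smooth_on_C1(1)[OF sm]])
  have gm: "(\<lambda>x. (w x, x)) \<in> measurable (restrict_space borel N) (restrict_space borel S)"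
  proof (rule measurable_restrict_space2)
    show "(\<lambda>x. (w x, x)) \<in> space (restrict_space borel N) \<rightarrow> S"
      by (auto simp: S_def space_restrict_space)
    show "(\<lambda>x. (w x, x)) \<in> borel_measurable (restrict_space borel N)"
      by (intro borel_measurable_continuous_on_restrict continuous_on_Pair wc continuous_on_id)
  qed
  have FD: "(\<lambda>x. F (w x, x) * ennreal (D x)) \<in> borel_measurable (restrict_space borel N)"
    using measurable_compose[OF gm F] borel_measurable_continuous_on_restrict[OF Dc] by measurable
  have "(\<integral>\<^sup>+p. F p \<partial>warped_area a lam P S)
     = (\<Sum>j<m. \<integral>\<^sup>+y. F (param (?d j) (?Y j) y) * (ennreal (area_density (?d j) (?Y j) y) * indicator (g.piece j) y) \<partial>lborel)"
    unfolding warped_area_def by (rule g.nn_integral_volume_measure[OF F])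
  also have "\<dots> = (\<Sum>j<m. \<integral>\<^sup>+y. F (w (rinv (cc j) y), rinv (cc j) y) * ennreal (D (rinv (cc j) y)) *
      (ennreal (sqrt (gram_det (rmet (cc j) y))) * indicator (base.piece j) y) \<partial>lborel)"
  proof (intro sum.cong refl nn_integral_cong)
    fix j y assume "j \<in> {..<m}"
    then have j: "j < m" by simp
    show "F (param (?d j) (?Y j) y) * (ennreal (area_density (?d j) (?Y j) y) * indicator (g.piece j) y)
      = F (w (rinv (cc j) y), rinv (cc j) y) * ennreal (D (rinv (cc j) y)) *
      (ennreal (sqrt (gram_det (rmet (cc j) y))) * indicator (base.piece j) y)"
    proof (cases "y \<in> base.piece j")
      case True
      then have y: "y \<in> Dj j" by (simp add: in_piece)
      have "y \<in> rimg (cc j)" using y Dj(2)[OF j] by auto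
      then have Dy: "D (rinv (cc j) y) \<ge> 0"
        by (rule Dn[OF rinv_N[OF cP[OF j]]])
      have ind: "induced_metric (rmet (?d j)) (?Y j) y = (\<lambda>v v'. (lam (w (rinv (cc j) y)))\<^sup>2 * rmet (cc j) y v v'
         + frechet_derivative (\<lambda>y. w (rinv (cc j) y)) (at y) v * frechet_derivative (\<lambda>y. w (rinv (cc j) y)) (at y) v')"
        by (rule chart_cover_graph(2)[OF sm wa lam j y])
      have ad: "area_density (?d j) (?Y j) y = D (rinv (cc j) y) * sqrt (gram_det (rmet (cc j) y))"
        unfolding area_density_def ind by (rule D[OF j y])
      show ?thesis
        unfolding ad \<psi>[OF j y] piece[OF j] ennreal_mult'[OF Dy] by (simp add: mult_ac)
    qed (simp add: piece[OF j])
  qed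
  also have "\<dots> = (\<integral>\<^sup>+x. F (w x, x) * ennreal (D x) \<partial>vol_N)"
    by (rule base_integral[OF FD, symmetric])
  finally show "(\<integral>\<^sup>+p. F p \<partial>warped_area a lam P S) = (\<integral>\<^sup>+x. F (w x, x) * ennreal (D x) \<partial>vol_N)" .
qed

text \<open>
  The boundary is the graph of the constant function \<open>a\<close>. If \<open>lam a = 0\<close>, it degenerates and has area $0$,
  in agreement with the formula.
\<close>

lemma area_boundary:
  assumes lam: "continuous_on {a..} lam" and lam_a: "lam a \<ge> 0"
  shows "measure (warped_area a lam P ({a} \<times> N)) ({a} \<times> N) = lam a ^ CARD('n) * measure vol_N N"
proof -
  have S: "{a} \<times> N = (\<lambda>x. (a, x)) ` N" by auto
  let ?A = "warped_area a lam P ({a} \<times> N)"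
  have sp: "space ?A = {a} \<times> N"
    unfolding S by (rule graph_integral(2)[where w = "\<lambda>_. a"]) (use lam smooth_on_const in auto)
  have "emeasure ?A ({a} \<times> N) = (\<integral>\<^sup>+p. 1 \<partial>?A)"
    by (simp add: sp)
  also have "\<dots> = (\<integral>\<^sup>+x. 1 * ennreal (lam a ^ CARD('n)) \<partial>vol_N)"
    unfolding S
  proof (rule graph_integral(3)[where w = "\<lambda>_. a" and D = "\<lambda>_. lam a ^ CARD('n)"])
    show "sqrt (gram_det (\<lambda>v v'. (lam a)\<^sup>2 * rmet (cc j) y v v' + frechet_derivative (\<lambda>y. a) (at y) v * frechet_derivative (\<lambda>y. a) (at y) v'))
        = lam a ^ CARD('n) * sqrt (gram_det (rmet (cc j) y))" for j y
      using lam_a by (simp add: frechet_derivative_const gram_det_scale real_sqrt_mult real_sqrt_power)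
  qed (use lam lam_a smooth_on_const in auto)
  also have "\<dots> = ennreal (lam a ^ CARD('n)) * emeasure vol_N N"
    by (simp add: space_vol_N)
  finally show ?thesis
    using lam_a by (simp add: measure_def enn2real_mult)
qed

end

context star_graph
begin

lemma lam_a_nonneg: "lam a \<ge> 0"
proof -
  have "(lam \<longlongrightarrow> lam a) (at a within {a..})"
    using lamc by (auto simp: continuous_on_def)
  then have "(lam \<longlongrightarrow> lam a) (at_right a)"
    by (rule tendsto_within_subset) auto
  moreover have "eventually (\<lambda>r. lam r \<ge> 0) (at_right a)"
    using lpos by (auto simp: eventually_at_right_field intro!: exI[of _ "a + 1"] less_imp_le)
  ultimately show ?thesis
    by (rule tendsto_lowerbound) simp
qed

definition "\<Sigma> = (\<lambda>x. (u x, x)) ` N"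

text \<open>
  The induced metric is $\lambda^2g+du\otimes du$, so the matrix determinant lemma gives
  $\lambda^{2(n-1)}(\lambda^2+|\nabla u|^2)\det g$.
\<close>

lemma area_density_graph:
  assumes j: "j < m" and y: "y \<in> Dj j"
  shows "sqrt (gram_det (\<lambda>v v'. (lam (u (rinv (cc j) y)))\<^sup>2 * rmet (cc j) y v v'
         + frechet_derivative (\<lambda>y. u (rinv (cc j) y)) (at y) v * frechet_derivative (\<lambda>y. u (rinv (cc j) y)) (at y) v'))
    = (lam (u (rinv (cc j) y)) ^ (CARD('n) - 1) * sqrt (s (rinv (cc j) y))) * sqrt (gram_det (rmet (cc j) y))"
proof -
  have yr: "y \<in> rimg (cc j)" using y Dj(2)[OF j] by auto
  note c = cP[OF j]
  let ?q = "frechet_derivative (\<lambda>y. u (rinv (cc j) y)) (at y)" and ?L = "lam (u (rinv (cc j) y))"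
  have q: "linear ?q"
    by (rule has_derivative_linear[OF C1_has_derivative[OF C1N_D[OF C1N_u c] yr]])
  have L: "?L > 0" by (rule lpos[OF ua[OF rinv_N[OF c yr]]])
  have "?q (sharp (rmet (cc j) y) ?q) = Q (rinv (cc j) y)"
    by (simp add: Q_def pair_eq[OF C1N_u C1N_u c yr] grad_def)
  then have "gram_det (\<lambda>v v'. ?L\<^sup>2 * rmet (cc j) y v v' + ?q v * ?q v') = (?L\<^sup>2) ^ (CARD('n) - 1) * s (rinv (cc j) y) * gram_det (rmet (cc j) y)"
    using gram_det_rank_one[OF met_pos[OF c yr] q, of "?L\<^sup>2"] L by (simp add: s_def)
  then show ?thesis
    using L by (simp add: real_sqrt_mult real_sqrt_power)
qed

lemma dens_continuous: "continuous_on N (\<lambda>x. lam (u x) ^ (CARD('n) - 1) * sqrt (s x))"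
  by (intro continuous_on_mult continuous_on_power continuous_on_u continuous_lam continuous_on_real_sqrt continuous_s)

lemma dens_nonneg: "x \<in> N \<Longrightarrow> lam (u x) ^ (CARD('n) - 1) * sqrt (s x) \<ge> 0"
  using lpos[OF ua] s_pos by (simp add: less_imp_le)

lemma integral_graph_area:
  assumes F: "continuous_on {a<..} F" "\<And>r. a < r \<Longrightarrow> F r \<ge> (0::real)"
  shows "(LINT p:\<Sigma>|warped_area a lam P \<Sigma>. F (fst p)) = (\<integral>x. F (u x) * (lam (u x) ^ (CARD('n) - 1) * sqrt (s x)) \<partial>vol_N)"
proof -
  let ?A = "warped_area a lam P \<Sigma>" and ?D = "\<lambda>x. lam (u x) ^ (CARD('n) - 1) * sqrt (s x)"
  have st: "sets ?A = sets (restrict_space borel \<Sigma>)" and sp: "space ?A = \<Sigma>"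
    unfolding \<Sigma>_def using graph_integral(1,2)[OF usm _ lamc] ua by (auto intro: less_imp_le)
  have fm: "(\<lambda>p. F (fst p)) \<in> borel_measurable (restrict_space borel \<Sigma>)"
    by (intro borel_measurable_continuous_on_restrict continuous_on_compose2[OF F(1) continuous_on_fst[OF continuous_on_id]])
      (use ua in \<open>auto simp: \<Sigma>_def\<close>)
  have "(LINT p:\<Sigma>|?A. F (fst p)) = (\<integral>p. F (fst p) \<partial>?A)"
    unfolding set_lebesgue_integral_def by (rule Bochner_Integration.integral_cong) (auto simp: sp)
  also have "\<dots> = enn2real (\<integral>\<^sup>+p. ennreal (F (fst p)) \<partial>?A)"
  proof (rule integral_eq_nn_integral)
    show "(\<lambda>p. F (fst p)) \<in> borel_measurable ?A"
      using fm by (simp only: measurable_cong_sets[OF st refl])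
    show "AE p in ?A. 0 \<le> F (fst p)"
    proof (rule AE_I2)
      fix p assume "p \<in> space ?A"
      then have "p \<in> \<Sigma>"
        by (simp only: sp)
      then show "0 \<le> F (fst p)"
        using F(2) ua by (auto simp: \<Sigma>_def)
    qed
  qed
  also have "(\<integral>\<^sup>+p. ennreal (F (fst p)) \<partial>?A) = (\<integral>\<^sup>+x. ennreal (F (fst (u x, x))) * ennreal (?D x) \<partial>vol_N)"
    unfolding \<Sigma>_def
  proof (rule graph_integral(3)[where w = u and F = "\<lambda>p. ennreal (F (fst p))" and D = ?D, OF usm _ lamc])
    show "(\<lambda>p. ennreal (F (fst p))) \<in> borel_measurable (restrict_space borel ((\<lambda>x. (u x, x)) ` N))"
      using fm by (simp add: \<Sigma>_def)
  qed (use ua area_density_graph dens_continuous dens_nonneg in \<open>auto intro: less_imp_le\<close>)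
  also have "\<dots> = (\<integral>\<^sup>+x. ennreal (F (u x) * ?D x) \<partial>vol_N)"
    using F(2) ua by (intro nn_integral_cong) (simp add: space_vol_N ennreal_mult')
  also have "enn2real \<dots> = (\<integral>x. F (u x) * ?D x \<partial>vol_N)"
  proof (rule integral_eq_nn_integral[symmetric])
    show "(\<lambda>x. F (u x) * ?D x) \<in> borel_measurable vol_N"
      by (intro continuous_measurable_N continuous_on_mult[OF continuous_on_u[OF F(1)] dens_continuous])
    show "AE x in vol_N. 0 \<le> F (u x) * ?D x"
      using F(2) ua dens_nonneg by (intro AE_I2) (auto simp: space_vol_N intro!: mult_nonneg_nonneg)
  qed
  finally show ?thesis .
qed

lemma area_graph: "measure (warped_area a lam P \<Sigma>) \<Sigma> = (\<integral>x. lam (u x) ^ (CARD('n) - 1) * sqrt (s x) \<partial>vol_N)"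
proof -
  have sp: "space (warped_area a lam P \<Sigma>) = \<Sigma>"
    unfolding \<Sigma>_def using graph_integral(2)[OF usm _ lamc] ua by (auto intro: less_imp_le)
  have "(LINT p:\<Sigma>|warped_area a lam P \<Sigma>. 1) = measure (warped_area a lam P \<Sigma>) \<Sigma>"
    unfolding set_lebesgue_integral_def using sets.top[of "warped_area a lam P \<Sigma>"] by (simp add: sp)
  then show ?thesis
    using integral_graph_area[of "\<lambda>_. 1"] by simp
qed

text \<open>
  The integrand is the derivative of $\lambda^{n+k}/(n+k)$.
\<close>

lemma radial_integral:
  assumes k: "k \<ge> 1" and b: "a < b"
  shows "(\<integral>\<^sup>+r. ennreal (lam r powr (k - 1) * deriv lam r * lam r ^ CARD('n)) * indicator {a<..<b} r \<partial>lborel)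
    = ennreal ((lam b powr (real CARD('n) + k) - lam a powr (real CARD('n) + k)) / (real CARD('n) + k))"
proof -
  let ?e = "real CARD('n) + k"
  let ?f = "\<lambda>r. lam r powr (k - 1) * deriv lam r * lam r ^ CARD('n)"
  define G where "G r = lam r powr ?e / ?e" for r
  have e: "?e > 0" using k by simp
  have "(G has_real_derivative ?f r) (at r)" if r: "a < r" for r
  proof -
    have "(G has_real_derivative ?e * lam r powr (?e - 1) * deriv lam r / ?e) (at r)"
      unfolding G_def by (rule DERIV_cdivide[OF DERIV_chain2[OF has_real_derivative_powr[OF lpos[OF r]] deriv_lam(1)[OF r]]])
    moreover have "lam r powr (k - 1) * lam r ^ CARD('n) = lam r powr (?e - 1)"
      using lpos[OF r] by (simp add: powr_realpow[symmetric] powr_add[symmetric] algebra_simps)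
    then have "?e * lam r powr (?e - 1) * deriv lam r / ?e = ?f r"
      using e by (simp add: mult_ac)
    ultimately show ?thesis by simp
  qed
  \<comment> \<open>At the end point \<open>a\<close> only the continuity of \<open>lam\<close> is available, and \<open>lam a\<close> may be zero.\<close>
  then have "(?f has_integral G b - G a) {a..b}"
  proof (intro fundamental_theorem_of_calculus_interior)
    show "continuous_on {a..b} G"
      unfolding G_def using e lam_a_nonneg lpos
      by (intro continuous_on_divide continuous_on_powr' continuous_on_const continuous_on_subset[OF lamc])
        (auto simp: le_less)
  qed (use b in \<open>auto simp: has_real_derivative_iff_has_vector_derivative\<close>)
  then have hi: "(?f has_integral G b - G a) {a<..<b}"
    using has_integral_Icc_iff_Ioo by blast
  have fn: "0 \<le> ?f r" if "r \<in> {a<..<b}" for r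
    using that lpos[of r] l1pos[of r] by simp
  have cont: "continuous_on {a<..<b} ?f"
    using lpos by (intro continuous_on_mult continuous_on_power continuous_on_powr continuous_on_const
        continuous_on_subset[OF continuous_lam] continuous_on_subset[OF continuous_deriv_lam(1)]) (auto simp: less_imp_neq[symmetric])
  have m: "(\<lambda>r. ?f r * indicator {a<..<b} r) \<in> borel_measurable borel"
    by (rule borel_measurable_open_indicator[OF _ cont]) auto
  have "((\<lambda>r. ?f r * indicator {a<..<b} r) has_integral G b - G a) UNIV"
  proof -
    have "(\<lambda>r. ?f r * indicator {a<..<b} r) = (\<lambda>r. if r \<in> {a<..<b} then ?f r else 0)"
      by (auto simp: fun_eq_iff indicator_def)
    then show ?thesis
      using hi by (simp only: has_integral_restrict_UNIV)
  qed
  moreover have "0 \<le> ?f r * indicator {a<..<b} r" for r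
    using fn[of r] by (cases "r \<in> {a<..<b}") auto
  ultimately have "(\<integral>\<^sup>+r. ennreal (?f r * indicator {a<..<b} r) \<partial>lborel) = ennreal (G b - G a)"
    using nn_integral_has_integral_lborel[OF m] by blast
  moreover have "ennreal (?f r * indicator {a<..<b} r) = ennreal (?f r) * indicator {a<..<b} r" for r
    by (cases "r \<in> {a<..<b}") auto
  ultimately show ?thesis
    by (simp add: G_def diff_divide_distrib)
qed

lemma lam_mono: "a \<le> r \<Longrightarrow> r < r' \<Longrightarrow> lam r < lam r'"
  using DERIV_pos_imp_increasing_open[of r r' lam] deriv_lam(1) l1pos continuous_on_subset[OF lamc, of "{r..r'}"]
  by (auto dest: le_less_trans)

lemma enclosed_domain_eq: "enclosed_domain a \<Sigma> = {p \<in> {a<..} \<times> N. fst p < u (snd p)}"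
  by (auto simp: enclosed_domain_def \<Sigma>_def)

text \<open>
  The volume element is $\lambda^n\,dr\,dv_N$; by Tonelli's theorem the inner integral in $r$ is the
  one of \<open>radial_integral\<close>.
\<close>

lemma volume_integral:
  assumes k: "k \<ge> 1"
  shows "(LINT p:enclosed_domain a \<Sigma>|warped_volume a lam N P. lam (fst p) powr (k - 1) * deriv lam (fst p))
    = (\<integral>x. (lam (u x) powr (real CARD('n) + k) - lam a powr (real CARD('n) + k)) / (real CARD('n) + k) \<partial>vol_N)"
proof -
  let ?S = "{a<..} \<times> N" and ?V = "warped_volume a lam N P" and ?\<Omega> = "enclosed_domain a \<Sigma>" and ?e = "real CARD('n) + k"
  let ?f = "\<lambda>r. lam r powr (k - 1) * deriv lam r" and ?d = "\<lambda>j. warped_chart a lam (cc j)"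
  let ?F = "\<lambda>p. indicator ?\<Omega> p * ?f (fst p)"
  define J where "J x = (lam (u x) powr ?e - lam a powr ?e) / ?e" for x
  interpret g: chart_cover "warped_product a lam P" ?S m ?d "\<lambda>j. {a<..} \<times> Dj j" "\<lambda>_ p. p"
    by (rule chart_cover_product[OF lamc])
  have st: "sets ?V = sets (restrict_space borel ?S)" and sp: "space ?V = ?S"
    unfolding warped_volume_def by (rule g.sets_volume_measure g.space_volume_measure)+
  have fc: "continuous_on {a<..} ?f"
    using lpos by (intro continuous_on_mult continuous_on_powr continuous_on_const continuous_lam continuous_deriv_lam(1))
      (auto simp: less_imp_neq[symmetric])
  have f0: "?f r \<ge> 0" if "a < r" for r
    using lpos[OF that] l1pos[OF that] by simp
  have Jc: "continuous_on N J"
    unfolding J_def[abs_def] using lpos ua k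
    by (intro continuous_on_divide continuous_on_diff continuous_on_powr continuous_on_const continuous_on_u continuous_lam)
      (auto simp: less_imp_neq[symmetric])
  have Jn: "J x \<ge> 0" if "x \<in> N" for x
    using lam_mono[OF order_refl ua[OF that]] lam_a_nonneg k by (auto simp: J_def intro!: divide_nonneg_nonneg powr_mono2)
  have Fm: "?F \<in> borel_measurable (restrict_space borel ?S)"
  proof -
    have "(\<lambda>p. u (snd p) - fst p) \<in> borel_measurable (restrict_space borel ?S)"
      by (intro borel_measurable_continuous_on_restrict continuous_on_diff continuous_on_fst continuous_on_id
          continuous_on_compose2[OF C1N_continuous[OF C1N_u] continuous_on_snd[OF continuous_on_id]]) auto
    from measurable_sets[OF this, of "{0<..}"] have om: "?\<Omega> \<in> sets (restrict_space borel ?S)"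
      by (auto simp: enclosed_domain_eq space_restrict_space vimage_def Int_def conj_commute)
    have fm: "(\<lambda>p. ?f (fst p)) \<in> borel_measurable (restrict_space borel ?S)"
      by (intro borel_measurable_continuous_on_restrict continuous_on_compose2[OF fc continuous_on_fst[OF continuous_on_id]]) auto
    show ?thesis
      by (rule borel_measurable_times[OF borel_measurable_indicator[OF om] fm])
  qed
  have Fn: "?F p \<ge> 0" for p
    using f0 by (auto simp: enclosed_domain_eq indicator_def)
  have piece: "(r, y) \<in> g.piece j \<longleftrightarrow> a < r \<and> y \<in> base.piece j" if j: "j < m" for r y j
  proof -
    have *: "param (?d j) (\<lambda>p. p) (r, y) \<notin> param (?d i) (\<lambda>p. p) ` ({a<..} \<times> Dj i) \<longleftrightarrow> rinv (cc j) y \<notin> rinv (cc i) ` Dj i"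
      if "y \<in> Dj j" "a < r" "i < j" for i
    proof -
      have i: "i < m" using that j by simp
      have 1: "param (?d j) (\<lambda>p. p) (r, y) = (r, rinv (cc j) y)"
        using local_param_product(2)[OF cP[OF j] Dj(1) Dj(2)[OF j], of "(r, y)" a lam] that by simp
      have 2: "param (?d i) (\<lambda>p. p) ` ({a<..} \<times> Dj i) = {a<..} \<times> rinv (cc i) ` Dj i"
        using local_param_product(2)[OF cP[OF i] Dj(1) Dj(2)[OF i], of _ a lam] by (force simp: image_iff)
      show ?thesis
        unfolding 1 2 using that by simp
    qed
    show ?thesis
      unfolding g.piece_def in_piece mem_Collect_eq using * by auto
  qed
  have dens: "area_density (?d j) (\<lambda>p. p) (r, y) = lam r ^ CARD('n) * sqrt (gram_det (rmet (cc j) y))"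
    if "j < m" "a < r" "y \<in> Dj j" for j r y
  proof -
    have y: "y \<in> rimg (cc j)" using that Dj(2)[OF that(1)] by auto
    note P = met_pos[OF cP[OF that(1)] y]
    have "positive_inner (\<lambda>v w. (lam r)\<^sup>2 * rmet (cc j) y v w)"
      using positive_inner_rank_one[OF P linear_zero, of "(lam r)\<^sup>2" 0] lpos[OF that(2)] by simp
    from gram_det_block[OF this]
    have "gram_det (induced_metric (rmet (?d j)) (\<lambda>p. p) (r, y)) = ((lam r)\<^sup>2) ^ CARD('n) * gram_det (rmet (cc j) y)"
      by (simp add: induced_ident gram_det_scale block_def warped_chart_def case_prod_beta')
    then show ?thesis
      using lpos[OF that(2)] by (simp add: area_density_def real_sqrt_mult real_sqrt_power)
  qed
  define B where "B j y = ennreal (sqrt (gram_det (rmet (cc j) y))) * indicator (base.piece j) y" for j y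
  define A where "A j r y = ennreal (lam r powr (k - 1) * deriv lam r * lam r ^ CARD('n)) * indicator {a<..<u (rinv (cc j) y)} r" for j r y
  have eq: "ennreal (?F (param (?d j) (\<lambda>p. p) (r, y))) * (ennreal (area_density (?d j) (\<lambda>p. p) (r, y)) * indicator (g.piece j) (r, y))
     = A j r y * B j y" if j: "j < m" for j r y
  proof (cases "a < r \<and> y \<in> base.piece j")
    case True
    then have y: "y \<in> Dj j" "a < r" by (auto simp: in_piece)
    have 1: "param (?d j) (\<lambda>p. p) (r, y) = (r, rinv (cc j) y)"
      using local_param_product(2)[OF cP[OF j] Dj(1) Dj(2)[OF j], of "(r, y)" a lam] y by simp
    have yN: "rinv (cc j) y \<in> N"
      using rinv_N[OF cP[OF j]] Dj(2)[OF j] y by auto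
    have L: "0 \<le> lam r ^ CARD('n)"
      using lpos[OF y(2)] by simp
    show ?thesis
    proof (cases "r < u (rinv (cc j) y)")
      case r: True
      then have mem: "(r, rinv (cc j) y) \<in> ?\<Omega>"
        using yN y by (simp add: enclosed_domain_eq)
      have "ennreal (?f r) * ennreal (lam r ^ CARD('n)) = ennreal (?f r * lam r ^ CARD('n))"
        by (rule ennreal_mult[OF f0[OF y(2)] L, symmetric])
      then show ?thesis
        unfolding 1 dens[OF j y(2,1)] ennreal_mult'[OF L] using True r y mem
        by (simp add: A_def B_def piece[OF j] mult.assoc[symmetric])
    next
      case False
      then show ?thesis
        unfolding 1 using y by (simp add: A_def enclosed_domain_eq)
    qed
  next
    case False
    then have "(r, y) \<notin> g.piece j"
      using piece[OF j] by blast
    moreover have "A j r y * B j y = 0"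
      using False by (auto simp: A_def B_def indicator_def)
    ultimately show ?thesis by simp
  qed
  have meas: "(\<lambda>p. A j (fst p) (snd p) * B j (snd p)) \<in> borel_measurable borel" if j: "j < m" for j
  proof -
    let ?U = "\<lambda>y. u (rinv (cc j) y)"
    define W where "W = {p \<in> {a<..} \<times> Dj j. fst p < ?U (snd p)}"
    have cU: "continuous_on (Dj j) ?U"
      by (rule continuous_on_subset[OF C1_continuous_on[OF C1N_D[OF C1N_u cP[OF j]]] Dj(2)[OF j]])
    have "open (({a<..} \<times> Dj j) \<inter> (\<lambda>p. ?U (snd p) - fst p) -` {0<..})"
      by (intro continuous_open_preimage open_Times Dj(1) continuous_on_diff continuous_on_fst continuous_on_id
          continuous_on_compose2[OF cU continuous_on_snd[OF continuous_on_id]]) auto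
    also have "({a<..} \<times> Dj j) \<inter> (\<lambda>p. ?U (snd p) - fst p) -` {0<..} = W"
      by (auto simp: W_def)
    finally have oW: "open W" .
    let ?h = "\<lambda>p. (?f (fst p) * lam (fst p) ^ CARD('n)) * sqrt (gram_det (rmet (cc j) (snd p)))"
    have "continuous_on W ?h"
      by (intro continuous_on_mult continuous_on_compose2[OF fc continuous_on_fst[OF continuous_on_id]] continuous_on_power
          continuous_on_compose2[OF continuous_lam continuous_on_fst[OF continuous_on_id]] continuous_on_real_sqrt continuous_on_gram_det
          continuous_on_compose2[OF continuous_metric[OF j] continuous_on_snd[OF continuous_on_id]]) (auto simp: W_def)
    from borel_measurable_open_indicator[OF oW this]
    have 1: "(\<lambda>p. ennreal (?h p * indicator W p)) \<in> borel_measurable borel"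
      by simp
    have "snd -` base.piece j \<in> sets (borel :: (real \<times> (real ^ 'n)) measure)"
      using measurable_sets[OF borel_measurable_continuous_onI[OF continuous_on_snd[OF continuous_on_id]] base.piece_borel[OF j]] by simp
    with 1 have "(\<lambda>p. ennreal (?h p * indicator W p) * indicator (snd -` base.piece j) p) \<in> borel_measurable borel"
      by measurable
    also have "(\<lambda>p. ennreal (?h p * indicator W p) * indicator (snd -` base.piece j) p) = (\<lambda>p. A j (fst p) (snd p) * B j (snd p))"
    proof (rule ext)
      fix p
      show "ennreal (?h p * indicator W p) * indicator (snd -` base.piece j) p = A j (fst p) (snd p) * B j (snd p)"
      proof (cases "p \<in> W \<and> snd p \<in> base.piece j")
        case True
        then have "a < fst p"
          by (auto simp: W_def)
        then have "0 \<le> ?f (fst p) * lam (fst p) ^ CARD('n)"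
          by (intro mult_nonneg_nonneg[OF f0 zero_le_power] less_imp_le[OF lpos])
        from ennreal_mult'[OF this] True show ?thesis
          by (auto simp: A_def B_def W_def)
      next
        case False
        then show ?thesis
          by (auto simp: A_def B_def W_def in_piece indicator_def mem_Times_iff)
      qed
    qed
    finally show ?thesis .
  qed
  have inner: "(\<integral>\<^sup>+r. A j r y * B j y \<partial>lborel) = ennreal (J (rinv (cc j) y)) * B j y" if j: "j < m" for j y
  proof (cases "y \<in> base.piece j")
    case True
    then have yN: "rinv (cc j) y \<in> N"
      using rinv_N[OF cP[OF j]] Dj(2)[OF j] by (auto simp: in_piece)
    have m: "(\<lambda>r. A j r y) \<in> borel_measurable borel"
    proof -
      have "continuous_on {a<..<u (rinv (cc j) y)} (\<lambda>r. ?f r * lam r ^ CARD('n))"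
        by (intro continuous_on_mult continuous_on_power continuous_on_subset[OF fc] continuous_on_subset[OF continuous_lam]) auto
      from borel_measurable_open_indicator[OF _ this]
      have "(\<lambda>r. ennreal (?f r * lam r ^ CARD('n) * indicator {a<..<u (rinv (cc j) y)} r)) \<in> borel_measurable borel"
        by simp
      also have "(\<lambda>r. ennreal (?f r * lam r ^ CARD('n) * indicator {a<..<u (rinv (cc j) y)} r)) = (\<lambda>r. A j r y)"
        by (auto simp: A_def fun_eq_iff indicator_def)
      finally show ?thesis .
    qed
    have "(\<integral>\<^sup>+r. A j r y * B j y \<partial>lborel) = (\<integral>\<^sup>+r. A j r y \<partial>lborel) * B j y"
      using m by (intro nn_integral_multc) simp
    also have "(\<integral>\<^sup>+r. A j r y \<partial>lborel) = ennreal (J (rinv (cc j) y))"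
      unfolding A_def J_def by (rule radial_integral[OF k ua[OF yN]])
    finally show ?thesis .
  qed (simp add: B_def)
  have "(LINT p:?\<Omega>|?V. ?f (fst p)) = (\<integral>p. ?F p \<partial>?V)"
    by (simp add: set_lebesgue_integral_def)
  also have "\<dots> = enn2real (\<integral>\<^sup>+p. ennreal (?F p) \<partial>?V)"
    by (rule integral_eq_nn_integral) (use Fm Fn in \<open>simp_all add: measurable_cong_sets[OF st refl]\<close>)
  also have "(\<integral>\<^sup>+p. ennreal (?F p) \<partial>?V) = (\<Sum>j<m. \<integral>\<^sup>+p. ennreal (?F (param (?d j) (\<lambda>p. p) p)) *
      (ennreal (area_density (?d j) (\<lambda>p. p) p) * indicator (g.piece j) p) \<partial>lborel)"
    unfolding warped_volume_def by (rule g.nn_integral_volume_measure) (use Fm in simp)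
  also have "\<dots> = (\<Sum>j<m. \<integral>\<^sup>+p. A j (fst p) (snd p) * B j (snd p) \<partial>(lborel \<Otimes>\<^sub>M lborel))"
    using eq by (intro sum.cong refl) (simp add: lborel_prod split_paired_all nn_integral_cong)
  also have "\<dots> = (\<Sum>j<m. \<integral>\<^sup>+y. ennreal (J (rinv (cc j) y)) * B j y \<partial>lborel)"
  proof (rule sum.cong[OF refl])
    fix j assume "j \<in> {..<m}"
    then have j: "j < m" by simp
    have "pair_sigma_finite (lborel :: real measure) (lborel :: (real ^ 'n) measure)"
      by (simp add: pair_sigma_finite_def sigma_finite_lborel)
    from pair_sigma_finite.nn_integral_snd[OF this, of "\<lambda>p. A j (fst p) (snd p) * B j (snd p)"]
    show "(\<integral>\<^sup>+p. A j (fst p) (snd p) * B j (snd p) \<partial>(lborel \<Otimes>\<^sub>M lborel)) = (\<integral>\<^sup>+y. ennreal (J (rinv (cc j) y)) * B j y \<partial>lborel)"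
      using meas[OF j] inner[OF j] by (simp add: lborel_prod)
  qed
  also have "\<dots> = (\<integral>\<^sup>+x. ennreal (J x) \<partial>vol_N)"
    unfolding B_def by (rule base_integral[symmetric]) (use borel_measurable_continuous_on_restrict[OF Jc] in simp)
  also have "enn2real \<dots> = (\<integral>x. J x \<partial>vol_N)"
    by (rule integral_eq_nn_integral[symmetric]) (use continuous_measurable_N[OF Jc] Jn in \<open>auto intro!: AE_I2 simp: space_vol_N\<close>)
  finally show ?thesis
    by (simp add: J_def)
qed

end

section \<open>The gap between a power and its tangent\<close>

text \<open>
  The Bregman divergence $t^p-A^p-pA^{p-1}(t-A)$ of the function $t^p$, which is convex for $p>1$.
\<close>

definition bregman :: "real \<Rightarrow> real \<Rightarrow> real \<Rightarrow> real" where
  "bregman p A t = (p - 1) * A powr p - p * A powr (p - 1) * t + t powr p"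

lemma bregman_derivative:
  assumes "t > 0"
  shows "(bregman p A has_real_derivative p * (t powr (p - 1) - A powr (p - 1))) (at t)"
  unfolding bregman_def[abs_def] using assms
  by (auto intro!: derivative_eq_intros simp: algebra_simps)

lemma bregman_zero: "A > 0 \<Longrightarrow> bregman p A A = 0"
  by (simp add: bregman_def powr_diff field_simps)

lemma bregman_pos:
  assumes p: "p > 1" and A: "A > 0" and t: "t > 0" "t \<noteq> A"
  shows "bregman p A t > 0"
proof (cases "t < A")
  case True
  have "\<exists>y. (bregman p A has_real_derivative y) (at x) \<and> y < 0" if "t \<le> x" "x < A" for x
  proof -
    have "x powr (p - 1) < A powr (p - 1)"
      using that t p by (intro powr_less_mono2) auto
    then show ?thesis
      using bregman_derivative[of x p A] that t p by (intro exI conjI) (auto simp: mult_less_0_iff)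
  qed
  then have "bregman p A t > bregman p A A"
    using True t
    by (intro DERIV_neg_imp_decreasing_open[of t A "bregman p A"] continuous_at_imp_continuous_on ballI)
      (auto intro: DERIV_isCont[OF bregman_derivative])
  then show ?thesis
    by (simp add: bregman_zero[OF A])
next
  case False
  have "\<exists>y. (bregman p A has_real_derivative y) (at x) \<and> y > 0" if "A < x" for x
  proof -
    have "x powr (p - 1) > A powr (p - 1)"
      using that A p by (intro powr_less_mono2) auto
    then show ?thesis
      using bregman_derivative[of x p A] that A p
      by (intro exI[of _ "p * (x powr (p - 1) - A powr (p - 1))"] conjI) auto
  qed
  then have "bregman p A A < bregman p A t"
    using False t A
    by (intro DERIV_pos_imp_increasing_open[of A t "bregman p A"] continuous_at_imp_continuous_on ballI)
      (auto intro: DERIV_isCont[OF bregman_derivative])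
  then show ?thesis
    by (simp add: bregman_zero[OF A])
qed

lemma powr_eq_mult_powr_minus_one: "t > 0 \<Longrightarrow> t powr p = t * t powr (p - 1)" for t :: real
  by (simp add: powr_diff)

text \<open>
  With $B$ for the Bregman divergence, $S=B(w)+wB'(w)(v-1)$. For $w>A$ both summands are nonnegative and the
  first is positive, while $T=0$. For $w\le A$, $S-T=(1-1/v)(B(w)-wB'(w))$ with $B(w)\ge0\ge B'(w)$, and
  the last factor vanishes only for $w=A$.
\<close>

lemma pointwise_comparison:
  fixes p A w v :: real
  assumes p: "p > 1" and A: "A > 0" and w: "w > 0" and v: "v \<ge> 1"
  defines "S \<equiv> p * w powr p * v - (p - 1) * w powr p + (p - 1) * A powr p - p * A powr (p - 1) * w * v"
    and "T \<equiv> (if w \<le> A then bregman p A w / v + p * (w powr (p - 1) - A powr (p - 1)) * w * (v - 1 / v) else 0)"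
  shows "T \<le> S" "S = T \<Longrightarrow> w \<le> A" "S = T \<Longrightarrow> w < A \<Longrightarrow> v = 1"
proof -
  let ?d = "p * (w powr (p - 1) - A powr (p - 1))"
  have wp: "w powr p = w * w powr (p - 1)"
    by (rule powr_eq_mult_powr_minus_one[OF w])
  have S: "S = bregman p A w + w * ?d * (v - 1)"
    unfolding S_def bregman_def wp by (simp add: algebra_simps)
  have ST: "S - T = (1 - 1 / v) * (bregman p A w - w * ?d)" if "w \<le> A"
    using that v unfolding S T_def by (simp add: field_simps)
  have neg: "?d \<le> 0" if "w \<le> A"
    using that w p powr_mono2[of "p - 1" w A] by (simp add: mult_le_0_iff)
  have pos: "?d > 0" if "w > A"
    using that A p powr_less_mono2[of "p - 1" A w] by simp
  have breg: "bregman p A w \<ge> 0"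
    using bregman_pos[OF p A w] bregman_zero[OF A, of p] by (cases "w = A") auto
  have big: "S > T" if "w > A"
  proof -
    have "bregman p A w > 0"
      using bregman_pos[OF p A w] that by simp
    moreover have "w * ?d * (v - 1) \<ge> 0"
      using v by (intro mult_nonneg_nonneg less_imp_le[OF w] less_imp_le[OF pos[OF that]]) auto
    ultimately show ?thesis
      using that unfolding S T_def by simp
  qed
  have small: "S - T \<ge> 0" if "w \<le> A"
  proof -
    have "w * ?d \<le> 0"
      using neg[OF that] w by (simp add: mult_le_0_iff)
    then show ?thesis
      unfolding ST[OF that] using breg v by (intro mult_nonneg_nonneg) auto
  qed
  show "T \<le> S"
    using big small by (cases "w \<le> A") auto
  show "S = T \<Longrightarrow> w \<le> A"
    using big by (cases "w \<le> A") auto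
  assume eq: "S = T" and wA: "w < A"
  have "bregman p A w > 0"
    using bregman_pos[OF p A w] wA by simp
  moreover have "w * ?d \<le> 0"
    using neg wA w by (simp add: mult_le_0_iff)
  ultimately have "bregman p A w - w * ?d > 0"
    by linarith
  then have "1 - 1 / v = 0"
    using ST wA eq by simp
  then show "v = 1"
    using v by simp
qed

section \<open>The inequality for graphs\<close>

context covered_manifold
begin

text \<open>
  The volume measure is positive on nonempty open sets because its density in a chart is positive.
\<close>

lemma integral_zero_imp_zero:
  fixes h :: "'a \<Rightarrow> real"
  assumes h: "continuous_on N h" and nn: "\<And>x. x \<in> N \<Longrightarrow> h x \<ge> 0" and le: "(\<integral>x. h x \<partial>vol_N) \<le> 0" and x: "x \<in> N"
  shows "h x = 0"
proof (rule ccontr)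
  assume "h x \<noteq> 0"
  obtain c y where c: "c \<in> P" "y \<in> rimg c" "x = rinv c y"
    by (rule in_chart[OF x])
  have hc: "continuous_on (rimg c) (\<lambda>y. h (rinv c y))"
    by (rule continuous_on_compose2[OF h rinv_cont[OF c(1)]]) (use rinv_N[OF c(1)] in auto)
  define B where "B = rimg c \<inter> (\<lambda>y. h (rinv c y)) -` (- {0})"
  have oB: "open B"
    unfolding B_def by (rule continuous_open_preimage[OF hc open_rimg[OF c(1)]]) auto
  have yB: "y \<in> B"
    using c \<open>h x \<noteq> 0\<close> by (simp add: B_def)
  have "AE x in vol_N. h x = 0"
  proof -
    have "(\<integral>x. h x \<partial>vol_N) = 0"
      using le by (intro antisym Bochner_Integration.integral_nonneg_AE AE_I2) (auto simp: space_vol_N nn)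
    moreover have "AE x in vol_N. 0 \<le> h x"
      by (rule AE_I2) (simp add: space_vol_N nn)
    ultimately show ?thesis
      using integral_nonneg_eq_0_iff_AE[OF continuous_integrable_N[OF h]] by simp
  qed
  then obtain Z where Z: "{x \<in> space vol_N. h x \<noteq> 0} \<subseteq> Z" "emeasure vol_N Z = 0" "Z \<in> sets vol_N"
    by (rule AE_E) auto
  have lpc: "local_param c N (rimg c) (\<lambda>y. y)"
    by (rule local_param_chart[OF c(1) open_rimg[OF c(1)]]) simp
  have "is_volume TYPE(real ^ 'n) P N vol_N"
    using base.is_volume_vol by (simp add: base.volume_measure_eq)
  then have "emeasure vol_N (param c (\<lambda>y. y) ` B) = (\<integral>\<^sup>+y. ennreal (area_density c (\<lambda>y. y) y) * indicator B y \<partial>lborel)"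
    using c(1) lpc oB unfolding is_volume_def B_def by auto
  moreover have "emeasure vol_N (param c (\<lambda>y. y) ` B) = 0"
  proof -
    have "param c (\<lambda>y. y) ` B \<subseteq> Z"
      using Z(1) rinv_N[OF c(1)] by (auto simp: B_def param_def space_vol_N)
    then show ?thesis
      using emeasure_mono[OF _ Z(3)] Z(2) by (metis le_zero_eq)
  qed
  ultimately have 0: "(\<integral>\<^sup>+y. ennreal (area_density c (\<lambda>y. y) y) * indicator B y \<partial>lborel) = 0"
    by simp
  have d: "area_density c (\<lambda>y. y) y > 0" if "y \<in> B" for y
    using gram_det_pos[OF met_pos[OF c(1)]] that by (simp add: area_density_def induced_ident B_def)
  have "continuous_on B (area_density c (\<lambda>y. y))"
    unfolding area_density_def induced_ident
    by (intro continuous_on_real_sqrt continuous_on_gram_det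
        continuous_on_subset[OF C1_continuous_on[OF smooth_on_C1(1)[OF met_smooth[OF c(1)]]]]) (auto simp: B_def)
  from borel_measurable_open_indicator[OF oB this]
  have "(\<lambda>y. ennreal (area_density c (\<lambda>y. y) y * indicator B y)) \<in> borel_measurable borel"
    by simp
  moreover have e: "ennreal (area_density c (\<lambda>y. y) y * indicator B y) = ennreal (area_density c (\<lambda>y. y) y) * indicator B y" for y
    by (simp add: indicator_def)
  ultimately have "AE y in lborel. ennreal (area_density c (\<lambda>y. y) y) * indicator B y = 0"
    using 0 by (subst (asm) nn_integral_0_iff_AE) simp_all
  then have "AE y in lborel. y \<notin> B"
    by eventually_elim (auto simp: indicator_def ennreal_eq_0_iff not_le dest: d split: if_splits)
  then have "emeasure lborel B = 0"
    using AE_iff_measurable[of B lborel "\<lambda>y. y \<notin> B"] oB by auto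
  then have "B \<in> null_sets lebesgue"
    using oB by (intro null_sets_completionI) auto
  then show False
    using open_not_negligible[OF oB] yB by (auto simp: negligible_iff_null_sets)
qed

end

context star_graph
begin

definition "L x = lam (u x)"
definition "v x = sqrt (s x) / L x"
definition "w x = L x ^ CARD('n)"

lemma L_pos: "x \<in> N \<Longrightarrow> L x > 0"
  unfolding L_def by (rule lpos[OF ua])

lemma w_pos: "x \<in> N \<Longrightarrow> w x > 0"
  by (simp add: w_def L_pos)

lemma v_ge_1: "x \<in> N \<Longrightarrow> v x \<ge> 1"
proof -
  assume x: "x \<in> N"
  have "(L x)\<^sup>2 \<le> s x"
    using Q_nonneg[OF x] by (simp add: s_def L_def)
  then have "L x \<le> sqrt (s x)"
    by (rule real_le_rsqrt)
  then show ?thesis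
    using L_pos[OF x] by (simp add: v_def)
qed

lemma v_eq_1: "x \<in> N \<Longrightarrow> Q x = 0 \<Longrightarrow> v x = 1"
  using L_pos[of x] by (simp add: v_def s_def L_def)

lemma dens_eq: "x \<in> N \<Longrightarrow> lam (u x) ^ (CARD('n) - 1) * sqrt (s x) = w x * v x"
proof -
  assume x: "x \<in> N"
  have "w x = L x * L x ^ (CARD('n) - 1)"
    unfolding w_def by (metis power_eq_if zero_less_card_finite less_numeral_extra(3))
  then show ?thesis
    using L_pos[OF x] by (simp add: v_def L_def)
qed

lemma continuous_L: "continuous_on N L" and continuous_w: "continuous_on N w" and continuous_v: "continuous_on N v"
proof -
  show L: "continuous_on N L"
    unfolding L_def[abs_def] by (rule continuous_on_u[OF continuous_lam])
  then show "continuous_on N w"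
    unfolding w_def[abs_def] by (intro continuous_on_power)
  show "continuous_on N v"
    unfolding v_def[abs_def] using L_pos
    by (intro continuous_on_divide continuous_on_real_sqrt continuous_s L) (auto simp: less_imp_neq[symmetric])
qed

lemma continuous_w_powr: "continuous_on N (\<lambda>x. w x powr p)"
  using w_pos by (intro continuous_on_powr continuous_w continuous_on_const) (auto simp: less_imp_neq[symmetric])

text \<open>
  The flux inequality with the weight $\Phi=\psi(w)/(n\lambda')$, where $\psi$ is the Bregman divergence
  cut off at $A$. Dividing by $n\lambda'$ makes the first term of the flux $\psi(w)\lambda$ and, as
  $w'=n\lambda^{n-1}\lambda'$, the second one $\psi'(w)\lambda^{n-1}|\nabla u|^2$ up to a term
  $-\psi(w)\lambda''|\nabla u|^2/(n\lambda'^2)\le0$.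
\<close>

lemma bregman_flux:
  assumes p: "p > 1" and A: "A > 0"
  defines "T \<equiv> \<lambda>x. (if w x \<le> A then bregman p A (w x) / v x + p * (w x powr (p - 1) - A powr (p - 1)) * w x * (v x - 1 / v x) else 0)"
  shows "(\<integral>x. T x \<partial>vol_N) \<ge> 0" "continuous_on N T"
proof -
  let ?n = "real CARD('n)"
  define \<psi> where "\<psi> t = (if t \<le> A then bregman p A t else 0)" for t
  define \<psi>' where "\<psi>' t = (if t \<le> A then p * (t powr (p - 1) - A powr (p - 1)) else 0)" for t
  define W where "W r = lam r ^ CARD('n)" for r
  define W' where "W' r = ?n * lam r ^ (CARD('n) - 1) * deriv lam r" for r
  define \<Phi> where "\<Phi> r = \<psi> (W r) / (?n * deriv lam r)" for r
  define \<Phi>' where "\<Phi>' r = (\<psi>' (W r) * W' r * (?n * deriv lam r) - \<psi> (W r) * (?n * deriv (deriv lam) r))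
     / ((?n * deriv lam r) * (?n * deriv lam r))" for r
  have \<psi>: "(\<psi> has_real_derivative \<psi>' t) (at t)" if "t > 0" for t
    unfolding \<psi>_def[abs_def] \<psi>'_def
    by (rule cutoff_has_derivative[where S = "{0<..}"]) (use bregman_derivative bregman_zero that in auto)
  have \<psi>c: "continuous_on {0<..} \<psi>"
    using \<psi> DERIV_isCont by (blast intro: continuous_at_imp_continuous_on)
  have \<psi>'c: "continuous_on {0<..} \<psi>'"
    unfolding \<psi>'_def[abs_def]
    by (rule cutoff_continuous) (auto intro!: continuous_intros)
  have \<psi>n: "\<psi> t \<ge> 0" if "t > 0" for t
    using bregman_pos[OF p A that] bregman_zero[OF A, of p] by (cases "t = A") (auto simp: \<psi>_def less_imp_le)
  have Wp: "W r > 0" if "a < r" for r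
    using lpos[OF that] by (simp add: W_def)
  have n0: "?n * deriv lam r > 0" if "a < r" for r
    using l1pos[OF that] by simp
  have W: "(W has_real_derivative W' r) (at r)" if "a < r" for r
    unfolding W_def[abs_def] W'_def using deriv_lam(1)[OF that] by (auto intro!: derivative_eq_intros simp: mult_ac)
  have d1: "(\<Phi> has_real_derivative \<Phi>' r) (at r)" if r: "a < r" for r
  proof -
    have "((\<lambda>r. ?n * deriv lam r) has_real_derivative ?n * deriv (deriv lam) r) (at r)"
      by (rule DERIV_cmult[OF deriv_lam(2)[OF r]])
    moreover have "?n * deriv lam r \<noteq> 0"
      using n0[OF r] by linarith
    ultimately show ?thesis
      unfolding \<Phi>_def[abs_def] \<Phi>'_def by (rule DERIV_divide[OF DERIV_chain2[OF \<psi>[OF Wp[OF r]] W[OF r]]])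
  qed
  have Wc: "continuous_on {a<..} W"
    unfolding W_def[abs_def] by (intro continuous_on_power continuous_lam)
  have d2: "continuous_on {a<..} \<Phi>'"
  proof -
    have "(?n * deriv lam r) * (?n * deriv lam r) \<noteq> 0" if "r \<in> {a<..}" for r
      using n0[of r] that by auto
    then show ?thesis
      unfolding \<Phi>'_def[abs_def] W'_def[abs_def]
      by (intro continuous_on_divide continuous_on_diff continuous_on_mult continuous_on_const continuous_on_power
          continuous_lam continuous_deriv_lam continuous_on_compose2[OF \<psi>c Wc] continuous_on_compose2[OF \<psi>'c Wc])
        (use Wp in auto)
  qed
  have d3: "\<Phi> r \<ge> 0" if "a < r" for r
    unfolding \<Phi>_def using \<psi>n[OF Wp[OF that]] n0[OF that] by simp
  have T: "T x = \<psi> (w x) / v x + \<psi>' (w x) * w x * (v x - 1 / v x)" for x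
    by (simp add: T_def \<psi>_def \<psi>'_def)
  show Tc: "continuous_on N T"
    unfolding T[abs_def] using v_ge_1
    by (intro continuous_on_add continuous_on_mult continuous_on_divide continuous_on_diff continuous_on_const continuous_v continuous_w
        continuous_on_compose2[OF \<psi>c continuous_w] continuous_on_compose2[OF \<psi>'c continuous_w]) (use w_pos in force)+
  let ?I = "\<lambda>x. (\<Phi> (u x) * (?n * lam (u x) * deriv lam (u x)) + \<Phi>' (u x) * Q x) / sqrt (s x)"
  have le: "?I x \<le> T x" if x: "x \<in> N" for x
  proof -
    let ?r = "u x" and ?\<sigma> = "sqrt (s x)"
    have r: "a < ?r" by (rule ua[OF x])
    have \<sigma>: "?\<sigma> > 0" "?\<sigma> * ?\<sigma> = s x" using s_pos[OF x] by auto
    have Ww: "W ?r = w x" by (simp add: W_def w_def L_def)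
    have n0': "?n > 0" "deriv lam ?r > 0" "L x > 0" using l1pos[OF r] L_pos[OF x] by auto
    have W': "L x ^ (CARD('n) - 1) = w x / L x"
      using n0'(3) unfolding w_def by (metis nonzero_mult_div_cancel_left power_eq_if zero_less_card_finite less_numeral_extra(3) less_irrefl)
    have "\<Phi> ?r * (?n * lam ?r * deriv lam ?r) = \<psi> (w x) * L x"
      using n0' by (simp add: \<Phi>_def Ww L_def)
    moreover have "\<Phi>' ?r * Q x \<le> \<psi>' (w x) * (w x / L x) * Q x"
    proof -
      have "\<Phi>' ?r = \<psi>' (w x) * W' ?r / (?n * deriv lam ?r) - \<psi> (w x) * (?n * deriv (deriv lam) ?r) / ((?n * deriv lam ?r) * (?n * deriv lam ?r))"
        unfolding \<Phi>'_def Ww using n0' by (simp add: diff_divide_distrib)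
      \<comment> \<open>Here the convexity of the warping function enters.\<close>
      also have "\<dots> \<le> \<psi>' (w x) * W' ?r / (?n * deriv lam ?r)"
        using \<psi>n[OF w_pos[OF x]] l2nn[OF r] n0' by (simp add: divide_nonneg_nonneg)
      also have "\<psi>' (w x) * W' ?r / (?n * deriv lam ?r) = \<psi>' (w x) * L x ^ (CARD('n) - 1)"
        using n0' by (simp add: W'_def L_def)
      also have "\<dots> = \<psi>' (w x) * (w x / L x)"
        by (simp only: W')
      finally show ?thesis
        by (rule mult_right_mono[OF _ Q_nonneg[OF x]])
    qed
    ultimately have "?I x \<le> (\<psi> (w x) * L x + \<psi>' (w x) * (w x / L x) * Q x) / ?\<sigma>"
      using \<sigma> by (intro divide_right_mono) auto
    also have "\<dots> = T x"
    proof -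
      have Q: "Q x = ?\<sigma> * ?\<sigma> - L x * L x"
        unfolding \<sigma>(2) by (simp add: s_def L_def power2_eq_square)
      have id: "(c * l + d * (e / l) * (\<sigma> * \<sigma> - l * l)) / \<sigma> = c / (\<sigma> / l) + d * e * (\<sigma> / l - 1 / (\<sigma> / l))"
        if "\<sigma> > 0" "l > 0" for c d e l \<sigma> :: real
        using that by (simp add: field_simps)
      show ?thesis
        unfolding T v_def Q by (rule id[OF \<sigma>(1) n0'(3)])
    qed
    finally show ?thesis .
  qed
  have "0 \<le> (\<integral>x. ?I x \<partial>vol_N)"
    by (rule weighted_flux_inequality[OF d1 d2 d3])
  also have "\<dots> \<le> (\<integral>x. T x \<partial>vol_N)"
  proof (rule integral_mono)
    show "integrable vol_N T" by (rule continuous_integrable_N[OF Tc])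
    show "integrable vol_N ?I"
    proof (rule continuous_integrable_N)
      have \<Phi>c: "continuous_on {a<..} \<Phi>"
        using d1 DERIV_isCont by (blast intro: continuous_at_imp_continuous_on)
      show "continuous_on N ?I"
        using s_pos by (intro continuous_on_divide continuous_on_add continuous_on_mult continuous_on_const continuous_on_real_sqrt
          continuous_s continuous_Q continuous_on_u \<Phi>c d2 continuous_lam continuous_deriv_lam) (auto simp: less_imp_neq[symmetric])
    qed
  qed (use le in \<open>simp add: space_vol_N\<close>)
  finally show "(\<integral>x. T x \<partial>vol_N) \<ge> 0" .
qed

lemma integral_const_N: "(\<integral>x. c \<partial>vol_N) = c * measure vol_N N" for c :: real
  by (simp add: space_vol_N)

lemma volume_pos:
  assumes "N \<noteq> {}"
  shows "measure vol_N N > 0"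
proof (rule ccontr)
  assume "\<not> measure vol_N N > 0"
  then have "(\<integral>x. 1 \<partial>vol_N) \<le> (0::real)"
    using integral_const_N[of 1] by simp
  then show False
    using integral_zero_imp_zero[of "\<lambda>_. 1"] assms by auto
qed

lemma lam_inj: "a < r \<Longrightarrow> a < r' \<Longrightarrow> lam r = lam r' \<Longrightarrow> r = r'"
  using lam_mono[of r r'] lam_mono[of r' r] by (cases r r' rule: linorder_cases) auto

lemma w_inj: "x \<in> N \<Longrightarrow> x' \<in> N \<Longrightarrow> w x = w x' \<Longrightarrow> u x = u x'"
  using L_pos[of x] L_pos[of x'] lam_inj[OF ua ua] by (auto simp: w_def L_def power_eq_iff_eq_base)

lemma u_le_if_w_le:
  assumes "x \<in> N" "x' \<in> N" "w x \<le> w x'"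
  shows "u x \<le> u x'"
proof (rule ccontr)
  assume "\<not> u x \<le> u x'"
  then have "L x' < L x"
    using lam_mono[of "u x'" "u x"] ua assms by (simp add: L_def less_imp_le)
  then have "w x' < w x"
    unfolding w_def using L_pos assms by (intro power_strict_mono) (auto simp: less_imp_le)
  then show False using assms by simp
qed

text \<open>
  \<open>B / V\<close> is the mean $A$ of $wv$ over the base, so the linear part of the Bregman divergence
  contributes $-A^p|N|$ to the integral of $S$, and the difference of the two sides is that integral.
\<close>

theorem graph_inequality:
  assumes p: "p > 1" and ne: "N \<noteq> {}"
  defines "V \<equiv> measure vol_N N" and "B \<equiv> (\<integral>x. w x * v x \<partial>vol_N)"
  shows "p * (\<integral>x. w x powr p * v x \<partial>vol_N) \<ge> (p - 1) * (\<integral>x. w x powr p \<partial>vol_N) + (B / V) powr p * V" (is "?ge")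
    and "p * (\<integral>x. w x powr p * v x \<partial>vol_N) = (p - 1) * (\<integral>x. w x powr p \<partial>vol_N) + (B / V) powr p * V
      \<longleftrightarrow> (\<exists>r. \<forall>x\<in>N. u x = r)" (is "?eq \<longleftrightarrow> ?const")
    and "B > 0"
proof -
  have V: "V > 0" unfolding V_def by (rule volume_pos[OF ne])
  have cwv: "continuous_on N (\<lambda>x. w x * v x)" and cwpv: "continuous_on N (\<lambda>x. w x powr p * v x)"
    by (intro continuous_on_mult continuous_w continuous_v continuous_w_powr)+
  have wv: "w x * v x > 0" if "x \<in> N" for x
    using w_pos[OF that] v_ge_1[OF that] by simp
  show B: "B > 0"
  proof (rule ccontr)
    assume "\<not> B > 0"
    then have "w x * v x = 0" if "x \<in> N" for x
      using integral_zero_imp_zero[OF cwv _ _ that] wv by (auto simp: B_def less_imp_le)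
    then show False
      using ne wv by (metis equals0I less_irrefl)
  qed
  define A where "A = B / V"
  have A: "A > 0" using V B by (simp add: A_def)
  define S where "S x = p * w x powr p * v x - (p - 1) * w x powr p + (p - 1) * A powr p - p * A powr (p - 1) * w x * v x" for x
  define T where "T x = (if w x \<le> A then bregman p A (w x) / v x + p * (w x powr (p - 1) - A powr (p - 1)) * w x * (v x - 1 / v x) else 0)" for x
  note T = bregman_flux[OF p A, folded T_def[abs_def]]
  have pc1: "T x \<le> S x" if "x \<in> N" for x
    unfolding T_def S_def by (rule pointwise_comparison(1)[OF p A w_pos[OF that] v_ge_1[OF that]])
  have pc2: "w x \<le> A" if "x \<in> N" "S x = T x" for x
    by (rule pointwise_comparison(2)[OF p A w_pos[OF that(1)] v_ge_1[OF that(1)] that(2)[unfolded T_def S_def]])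
  have pc3: "v x = 1" if "x \<in> N" "S x = T x" "w x < A" for x
    by (rule pointwise_comparison(3)[OF p A w_pos[OF that(1)] v_ge_1[OF that(1)] that(2)[unfolded T_def S_def] that(3)])
  have iw: "integrable vol_N (\<lambda>x. w x powr p)" "integrable vol_N (\<lambda>x. w x powr p * v x)" "integrable vol_N (\<lambda>x. w x * v x)"
    by (intro continuous_integrable_N continuous_w_powr cwv cwpv)+
  have Sc: "continuous_on N S"
    unfolding S_def[abs_def] by (intro continuous_on_add continuous_on_diff continuous_on_mult continuous_on_const continuous_w continuous_v continuous_w_powr)
  have intS: "(\<integral>x. S x \<partial>vol_N) = p * (\<integral>x. w x powr p * v x \<partial>vol_N) - (p - 1) * (\<integral>x. w x powr p \<partial>vol_N) - A powr p * V"
  proof -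
    have "(\<integral>x. S x \<partial>vol_N) = (\<integral>x. p * (w x powr p * v x) - (p - 1) * w x powr p + (p - 1) * A powr p - (p * A powr (p - 1)) * (w x * v x) \<partial>vol_N)"
      by (simp add: S_def mult.assoc)
    also have "\<dots> = p * (\<integral>x. w x powr p * v x \<partial>vol_N) - (p - 1) * (\<integral>x. w x powr p \<partial>vol_N) + (p - 1) * A powr p * V - (p * A powr (p - 1)) * B"
      using iw by (simp add: space_vol_N V_def B_def)
    \<comment> \<open>This is where \<open>A\<close> has to be the mean of $wv$.\<close>
    also have "(p * A powr (p - 1)) * B = p * A powr p * V"
      using V A by (simp add: A_def powr_eq_mult_powr_minus_one[of "B / V" p])
    finally show ?thesis
      by (simp add: algebra_simps)
  qed
  have iST: "integrable vol_N S" "integrable vol_N T"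
    by (rule continuous_integrable_N[OF Sc], rule continuous_integrable_N[OF T(2)])
  have "(\<integral>x. T x \<partial>vol_N) \<le> (\<integral>x. S x \<partial>vol_N)"
    by (rule integral_mono[OF iST(2,1)]) (use pc1 in \<open>simp add: space_vol_N\<close>)
  then have S0: "(\<integral>x. S x \<partial>vol_N) \<ge> 0"
    using T(1) by simp
  then show ?ge
    using intS by (simp add: A_def)
  have "?eq \<longleftrightarrow> (\<integral>x. S x \<partial>vol_N) = 0"
    unfolding intS by (auto simp: A_def)
  also have "\<dots> \<longleftrightarrow> ?const"
  proof
    assume 0: "(\<integral>x. S x \<partial>vol_N) = 0"
    have "(\<integral>x. S x - T x \<partial>vol_N) \<le> 0"
      using 0 T(1) iST by simp
    then have ST: "S x = T x" if "x \<in> N" for x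
      using integral_zero_imp_zero[OF continuous_on_diff[OF Sc T(2)] _ _ that] pc1 by simp
    have wA: "w x \<le> A" if "x \<in> N" for x
      using pc2[OF that ST[OF that]] .
    have v1: "v x = 1" if x: "x \<in> N" for x
    proof (cases "w x < A")
      case True
      then show ?thesis by (rule pc3[OF x ST[OF x]])
    next
      case False
      then have "u x' \<le> u x" if "x' \<in> N" for x'
        using u_le_if_w_le[OF that x] wA[OF that] by simp
      then have "Q x = 0"
        unfolding Q_def by (rule pair_self_at_maximum[OF C1N_u x])
      then show ?thesis
        by (rule v_eq_1[OF x])
    qed
    have "(\<integral>x. w x \<partial>vol_N) = B"
      unfolding B_def by (rule Bochner_Integration.integral_cong) (auto simp: space_vol_N v1)
    then have "(\<integral>x. A - w x \<partial>vol_N) \<le> 0"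
      using continuous_integrable_N[OF continuous_w] V by (simp add: space_vol_N V_def[symmetric] A_def)
    then have "A - w x = 0" if "x \<in> N" for x
      using integral_zero_imp_zero[OF continuous_on_diff[OF continuous_on_const continuous_w] _ _ that] wA by simp
    then have "w x = w x'" if "x \<in> N" "x' \<in> N" for x x'
      using that by (metis eq_iff_diff_eq_0)
    then have "u x = u x'" if "x \<in> N" "x' \<in> N" for x x'
      using w_inj that by blast
    then show ?const
      using ne by blast
  next
    assume ?const
    then obtain r where r: "\<And>x. x \<in> N \<Longrightarrow> u x = r" by blast
    define W where "W = lam r ^ CARD('n)"
    have w: "w x = W" if "x \<in> N" for x
      using r[OF that] by (simp add: w_def L_def W_def)
    have v: "v x = 1" if "x \<in> N" for x
      using pair_self_at_maximum[OF C1N_u that] r that by (intro v_eq_1) (auto simp: Q_def)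
    have "B = (\<integral>x. W \<partial>vol_N)"
      unfolding B_def by (rule Bochner_Integration.integral_cong) (auto simp: space_vol_N w v)
    then have AW: "A = W"
      using V by (simp add: A_def space_vol_N V_def)
    have W: "W > 0" using A AW by simp
    have "S x = 0" if "x \<in> N" for x
      unfolding S_def w[OF that] v[OF that] AW using powr_eq_mult_powr_minus_one[OF W, of p] by (simp add: algebra_simps)
    then have "(\<integral>x. S x \<partial>vol_N) = (\<integral>x. 0 \<partial>vol_N)"
      by (intro Bochner_Integration.integral_cong) (auto simp: space_vol_N)
    then show "(\<integral>x. S x \<partial>vol_N) = 0" by simp
  qed
  finally show "?eq \<longleftrightarrow> ?const" .
qed

lemma w_powr: "x \<in> N \<Longrightarrow> w x powr (1 + k / real CARD('n)) = lam (u x) powr (real CARD('n) + k)"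
proof -
  assume x: "x \<in> N"
  have "w x = L x powr real CARD('n)"
    using L_pos[OF x] by (simp add: w_def powr_realpow)
  then show ?thesis
    by (simp add: powr_powr L_def distrib_left)
qed

text \<open>
  Substituting the formulas for the areas and for the volume integral and multiplying by $p=(n+k)/n$ gives
  \<open>graph_inequality\<close>; the term $\lambda(a)^{n+k}|N|$ from the volume integral cancels the boundary term.
\<close>

theorem weighted_inequality:
  assumes k: "k \<ge> 1" and ne: "N \<noteq> {}"
  defines "n \<equiv> real CARD('n)"
  defines "lhs \<equiv> (LINT p:\<Sigma>|warped_area a lam P \<Sigma>. lam (fst p) powr k)"
    and "rhs \<equiv> n / (n + k) * measure vol_N N powr (- k / n) * measure (warped_area a lam P \<Sigma>) \<Sigma> powr ((n + k) / n)
      + k * (LINT p:enclosed_domain a \<Sigma>|warped_volume a lam N P. lam (fst p) powr (k - 1) * deriv lam (fst p))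
      + k / (n + k) * lam a powr k * measure (warped_area a lam P ({a} \<times> N)) ({a} \<times> N)"
  shows "lhs \<ge> rhs \<and> (lhs = rhs \<longleftrightarrow> (\<exists>r. \<Sigma> = {r} \<times> N))"
proof -
  define p where "p = 1 + k / n"
  define V where "V = measure vol_N N"
  define B where "B = (\<integral>x. w x * v x \<partial>vol_N)"
  define I where "I = (\<integral>x. w x powr p \<partial>vol_N)"
  define \<Lambda> where "\<Lambda> = lam a powr (n + k)"
  have n: "n > 0" by (simp add: n_def)
  have p: "p > 1" using k n by (simp add: p_def)
  have pn: "n / (n + k) = 1 / p" "k / (n + k) = (p - 1) / p" "- k / n = 1 - p" "(n + k) / n = p"
    using n k by (simp_all add: p_def field_simps)
  have V: "V > 0" unfolding V_def by (rule volume_pos[OF ne])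
  note G = graph_inequality[OF p ne, folded V_def B_def I_def]
  have B: "B > 0" by (rule G(3))
  have w_p: "w x powr p = lam (u x) powr (n + k)" if "x \<in> N" for x
    unfolding p_def n_def by (rule w_powr[OF that])
  have lhs: "lhs = (\<integral>x. w x powr p * v x \<partial>vol_N)"
  proof -
    have "lhs = (\<integral>x. lam (u x) powr k * (lam (u x) ^ (CARD('n) - 1) * sqrt (s x)) \<partial>vol_N)"
      unfolding lhs_def
      by (rule integral_graph_area)
        (use lpos in \<open>auto intro!: continuous_on_powr continuous_lam continuous_on_const simp: less_imp_neq[symmetric]\<close>)
    also have "\<dots> = (\<integral>x. w x powr p * v x \<partial>vol_N)"
    proof (rule Bochner_Integration.integral_cong[OF refl])
      fix x assume "x \<in> space vol_N"
      then have x: "x \<in> N" by (simp add: space_vol_N)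
      have "w x powr p = lam (u x) powr k * w x"
        unfolding w_p[OF x] using L_pos[OF x] by (simp add: powr_add powr_realpow w_def L_def n_def)
      then show "lam (u x) powr k * (lam (u x) ^ (CARD('n) - 1) * sqrt (s x)) = w x powr p * v x"
        unfolding dens_eq[OF x] by simp
    qed
    finally show ?thesis .
  qed
  have area: "measure (warped_area a lam P \<Sigma>) \<Sigma> = B"
    unfolding area_graph B_def
    by (rule Bochner_Integration.integral_cong[OF refl], rule dens_eq) (simp add: space_vol_N)
  have iw: "integrable vol_N (\<lambda>x. w x powr p)"
    by (rule continuous_integrable_N[OF continuous_w_powr])
  have vol: "(LINT p:enclosed_domain a \<Sigma>|warped_volume a lam N P. lam (fst p) powr (k - 1) * deriv lam (fst p)) = (I - \<Lambda> * V) / (n + k)"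
  proof -
    have "(LINT p:enclosed_domain a \<Sigma>|warped_volume a lam N P. lam (fst p) powr (k - 1) * deriv lam (fst p))
      = (\<integral>x. (w x powr p - \<Lambda>) / (n + k) \<partial>vol_N)"
      unfolding volume_integral[OF k] by (rule Bochner_Integration.integral_cong) (simp_all add: w_p space_vol_N \<Lambda>_def n_def)
    also have "\<dots> = (I - \<Lambda> * V) / (n + k)"
      using iw by (simp add: I_def V_def space_vol_N mult.commute)
    finally show ?thesis .
  qed
  have boundary: "lam a powr k * measure (warped_area a lam P ({a} \<times> N)) ({a} \<times> N) = \<Lambda> * V"
  proof -
    have "lam a powr k * lam a ^ CARD('n) = \<Lambda>"
    proof (cases "lam a = 0")
      case False
      then show ?thesis
        using lam_a_nonneg by (simp add: \<Lambda>_def powr_add powr_realpow n_def)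
    qed (simp add: \<Lambda>_def)
    then show ?thesis
      unfolding area_boundary[OF lamc lam_a_nonneg] by (simp add: V_def)
  qed
  have isop: "V powr (1 - p) * B powr p = (B / V) powr p * V"
    using V B by (simp add: powr_divide powr_diff)
  have "rhs = 1 / p * (V powr (1 - p) * B powr p) + k * ((I - \<Lambda> * V) / (n + k)) + (p - 1) / p * (\<Lambda> * V)"
    unfolding rhs_def area vol pn V_def[symmetric] boundary[symmetric] by simp
  also have "k * ((I - \<Lambda> * V) / (n + k)) = (p - 1) / p * (I - \<Lambda> * V)"
    unfolding pn(2)[symmetric] by simp
  finally have "rhs = 1 / p * (V powr (1 - p) * B powr p) + (p - 1) / p * I"
    by (simp add: right_diff_distrib)
  then have rhs: "p * rhs = (p - 1) * I + (B / V) powr p * V"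
    using p unfolding isop by (simp add: distrib_left)
  have const: "(\<exists>r. \<forall>x\<in>N. u x = r) \<longleftrightarrow> (\<exists>r. \<Sigma> = {r} \<times> N)"
    by (auto simp: \<Sigma>_def set_eq_iff image_iff)
  have "p * lhs \<ge> p * rhs"
    unfolding rhs lhs by (rule G(1))
  moreover have "p * lhs = p * rhs \<longleftrightarrow> (\<exists>r. \<Sigma> = {r} \<times> N)"
    unfolding rhs lhs const[symmetric] by (rule G(2))
  ultimately show ?thesis
    using p by simp
qed

end

theorem theorem4p2:
  fixes N :: "'a::topological_space set"
    and P :: "('a, real ^ 'n) rchart set"
    and lam :: "real \<Rightarrow> real"
    and a k :: real
    and \<Sigma> :: "(real \<times> 'a) set"
  assumes "k \<ge> 1" and "a \<ge> 0"
    and "riemannian_manifold N P" and "compact N"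
    and "nonneg_sectional_curvature P"
    and "continuous_on {a..} lam" and "smooth_on {a<..} lam"
    and "\<forall>r>a. lam r > 0"
    and "\<forall>r>a. deriv (deriv lam) r \<ge> 0"
    and "\<forall>r>a. deriv lam r > 0"
    and "Limsup at_top (\<lambda>r. ereal (deriv (deriv lam) r * lam r / (deriv lam r)\<^sup>2)) < \<infinity>"
    and "Limsup (inf at_top (principal {r. deriv (deriv lam) r > 0}))
           (\<lambda>r. ereal (deriv (deriv (deriv lam)) r * lam r
                        / (deriv lam r * deriv (deriv lam) r))) < \<infinity>"
    and "(SUP r\<in>{a<..}. ereal (deriv lam r)) < \<infinity> \<Longrightarrow> positive_ricci_curvature P"
    and "(SUP r\<in>{a<..}. ereal (deriv lam r)) = \<infinity> \<Longrightarrow>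
           Liminf at_top (\<lambda>r. ereal (deriv (deriv lam) r * lam r / (deriv lam r)\<^sup>2)) > 0"
    and "closed_hypersurface (warped_product a lam P) \<Sigma>"
    and "star_shaped a N P \<Sigma>"
    and "mean_convex (warped_product a lam P) \<Sigma>"
  shows "let n = real CARD('n);
             \<Omega> = enclosed_domain a \<Sigma>;
             \<Gamma> = {a} \<times> N;
             d\<mu> = warped_area a lam P \<Sigma>;
             dv = warped_volume a lam N P;
             vol_N = measure (volume_measure TYPE(real ^ 'n) P N) N;
             area_\<Sigma> = measure d\<mu> \<Sigma>;
             area_\<Gamma> = measure (warped_area a lam P \<Gamma>) \<Gamma>;
             lhs = (LINT p:\<Sigma>|d\<mu>. lam (fst p) powr k);
             rhs = n / (n + k) * vol_N powr (- k / n) * area_\<Sigma> powr ((n + k) / n)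
                   + k * (LINT p:\<Omega>|dv. lam (fst p) powr (k - 1) * deriv lam (fst p))
                   + k / (n + k) * lam a powr k * area_\<Gamma>
         in lhs \<ge> rhs \<and> (lhs = rhs \<longleftrightarrow> (\<exists>r. \<Sigma> = {r} \<times> N))"
proof -
  obtain u where u: "smooth_function P u" "\<forall>x\<in>N. a < u x" "\<Sigma> = (\<lambda>x. (u x, x)) ` N"
    using assms(16) unfolding star_shaped_def by blast
  show ?thesis
  proof (cases "N = {}")
    case True
    \<comment> \<open>On the empty manifold both sides are $0$, and the empty hypersurface is a slice.\<close>
    then have "\<Sigma> = {}" "enclosed_domain a \<Sigma> = {}"
      using u(3) by (auto simp: enclosed_domain_def)
    then show ?thesis
      by (simp add: True set_lebesgue_integral_def)
  next
    case False
    interpret M: manifold N P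
      by unfold_locales (rule assms(3))
    obtain m cc ctr rad where cover: "\<forall>j<m. cc j \<in> P \<and> rad j > (0::real) \<and> cball (ctr j) (rad j) \<subseteq> rimg (cc j)"
        "N = (\<Union>j<(m::nat). rinv (cc j) ` ball (ctr j) (rad j))"
      using M.finite_ball_cover[OF assms(4)] by blast
    interpret G: star_graph N P m cc ctr rad lam a u
    proof unfold_locales
      show "N = (\<Union>j<m. rinv (cc j) ` ball (ctr j) (rad j))"
        by (rule cover(2))
      show "smooth_on (rimg c) (\<lambda>y. u (rinv c y))" if "c \<in> P" for c
        using u(1) that by (simp add: smooth_function_def comp_def)
      show "mean_convex (warped_product a lam P) ((\<lambda>x. (u x, x)) ` N)"
        using assms(17) u(3) by simp
    qed (use cover(1) assms u(2) in blast)+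
    show ?thesis
      using G.weighted_inequality[OF assms(1) False] unfolding G.\<Sigma>_def u(3)[symmetric] Let_def .
  qed
qed

end
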